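(* Let $r\ge1$, let $N$ be a non-negative integer, and let $a,b_1,\dots,b_{r+1},c,x_1,\dots,x_r$ be nonzero complex parameters, generic subject to $a^2q=b_1\cdots b_{r+1}cx_1\cdots x_r$. Put $B=b_1\cdots b_{r+1}$ and $X=x_1\cdots x_r$. Then $$\sum_{\substack{k_1,\dots,k_r\ge0\\ |\mathbf k|\le N}}\frac{\Delta(\mathbf xq^{2\mathbf k};p)}{\Delta(\mathbf x;p)}\frac{\theta(aq^{3|\mathbf k|};p)}{\theta(a;p)}\frac{(a,q^{-N},q^{N+1};q,p)_{|\mathbf k|}}{(aq^{N+2},aq^{1-N};q^2,p)_{|\mathbf k|}\prod_{i=1}^{r+1}(ab_iq/BX;q,p)_{|\mathbf k|}}q^{|\mathbf k|-e_2(\mathbf k)}$$ $$\times\prod_{i=1}^r\frac{(c/x_i;q^2,p)_{|\mathbf k|}\,(c/ax_i;q,p)_{|\mathbf k|-k_i}\prod_{j=1}^{r+1}(b_jx_i;q^2,p)_{k_i}}{(c/x_i;q^2,p)_{|\mathbf k|-k_i}\,(ax_iq^{k_i-|\mathbf k|+1}/c;q,p)_{k_i}\prod_{j=1}^r(q^2x_i/x_j;q^2,p)_{k_i}}$$ equals $$\frac{(aq^2;q^2,p)_m}{(q/a;q^2,p)_m}\prod_{i=1}^r\frac{(cq/ax_i;q^2,p)_m}{(ax_iq^2/c;q^2,p)_m}\prod_{i=1}^{r+1}\frac{(aq^2/b_ic;q^2,p)_m}{(b_icq/a;q^2,p)_m}\quad\text{if }N=2m,$$ and $$\frac{(aq;q^2,p)_m}{(1/a;q^2,p)_m}\prod_{i=1}^r\frac{(c/ax_i;q^2,p)_m}{(ax_iq/c;q^2,p)_m}\prod_{i=1}^{r+1}\frac{(aq/b_ic;q^2,p)_m}{(b_ic/a;q^2,p)_m}\quad\text{if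 }N=2m-1.$$
   Context: $p,q$ are complex numbers with $|p|<1$, $q\ne0$, and $q^k\notin p^{\mathbb Z}$ for all integers $k>0$ (if $p=0$: $q^k\ne1$). For $x\ne0$, $\theta(x;p)=\prod_{j=0}^\infty(1-p^jx)(1-p^{j+1}/x)$. Elliptic shifted factorials: $(a;q,p)_k=\prod_{j=0}^{k-1}\theta(aq^j;p)$ for $k\in\mathbb Z_{\ge0}$ (similarly with base $q^2$), and $(a_1,\dots,a_m;q,p)_k=(a_1;q,p)_k\cdots(a_m;q,p)_k$. For $\mathbf k=(k_1,\dots,k_r)$, $|\mathbf k|=k_1+\cdots+k_r$ and $e_2(\mathbf k)=\sum_{1\le i<j\le r}k_ik_j$. For $\mathbf x=(x_1,\dots,x_r)$, $\Delta(\mathbf x;p)=\prod_{1\le i<j\le r}x_j\theta(x_i/x_j;p)$, and $\mathbf xq^{2\mathbf k}=(x_1q^{2k_1},\dots,x_rq^{2k_r})$. In expressions such as $ab_iq/BX$, everything after the slash is in the denominator. All parameters are assumed generic so that no denominator vanishes. *)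

theory Defs
  imports "HOL-Analysis.Analysis"
begin

text \<open>
  The argument order follows the usual notation: \<open>theta x p\<close> is $\theta(x;p)$ and
  \<open>efac a q p n\<close> is $(a;q,p)_n$. For $p = 0$ the convention \<open>0 ^ 0 = 1\<close> gives
  $\theta(x;0) = 1-x$. Zero factors are harmless: \<^const>\<open>prodinf\<close> is then 0, provided
  the remaining product converges (lemma \<open>theta_has_prod\<close>).
\<close>

definition theta :: "complex \<Rightarrow> complex \<Rightarrow> complex" where
  "theta x p = (\<Prod>j. (1 - p ^ j * x) * (1 - p ^ (j + 1) / x))"

definition efac :: "complex \<Rightarrow> complex \<Rightarrow> complex \<Rightarrow> nat \<Rightarrow> complex" where
  "efac a q p n = (\<Prod>j<n. theta (a * q ^ j) p)"

text \<open>
  Vectors are functions on \<open>nat\<close>, of which only the values at \<open>1, \<dots>, r\<close> matter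
  (for the parameters $b$: at \<open>1, \<dots>, r + 1\<close>).
\<close>

definition Delta :: "nat \<Rightarrow> (nat \<Rightarrow> complex) \<Rightarrow> complex \<Rightarrow> complex" where
  "Delta r x p = (\<Prod>j=1..r. \<Prod>i=1..<j. x j * theta (x i / x j) p)"

definition weight :: "nat \<Rightarrow> (nat \<Rightarrow> nat) \<Rightarrow> nat" where
  "weight r k = (\<Sum>i=1..r. k i)"

definition e2 :: "nat \<Rightarrow> (nat \<Rightarrow> nat) \<Rightarrow> nat" where
  "e2 r k = (\<Sum>j=1..r. \<Sum>i=1..<j. k i * k j)"

text \<open>
  The extensional function space makes each multi-index occur exactly once.
\<close>

definition multi_indices :: "nat \<Rightarrow> nat \<Rightarrow> (nat \<Rightarrow> nat) set" where
  "multi_indices r N = {k \<in> {1..r} \<rightarrow>\<^sub>E UNIV. weight r k \<le> N}"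

lemma finite_multi_indices: "finite (multi_indices r N)"
proof (rule finite_subset)
  show "multi_indices r N \<subseteq> {1..r} \<rightarrow>\<^sub>E {0..N}"
  proof
    fix k assume k: "k \<in> multi_indices r N"
    have "k i \<le> N" if "i \<in> {1..r}" for i
      using k member_le_sum[of i "{1..r}" k] that
      by (auto simp: multi_indices_def weight_def)
    with k show "k \<in> {1..r} \<rightarrow>\<^sub>E {0..N}"
      by (auto simp: multi_indices_def PiE_iff)
  qed
qed (auto intro: finite_PiE)

lemma theta_has_prod:
  assumes "norm p < 1"
  shows "(\<lambda>j. (1 - p ^ j * x) * (1 - p ^ (j + 1) / x)) has_prod theta x p"
proof -
  let ?f = "\<lambda>j. (1 - p ^ j * x) * (1 - p ^ (j + 1) / x)"
  let ?C = "norm x + norm (1 / x) + norm (x * (1 / x))"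
  have "summable (\<lambda>j. norm (?f j - 1))"
  proof (rule summable_comparison_test')
    show "summable (\<lambda>j. ?C * norm p ^ j)"
      using assms by (intro summable_mult summable_geometric) auto
    fix j :: nat
    have le: "norm p ^ (j + 1) \<le> norm p ^ j" "norm p ^ (j + (j + 1)) \<le> norm p ^ j"
      using assms by (intro power_decreasing; simp)+
    have "?f j - 1 = p ^ (j + (j + 1)) * (x * (1 / x)) - p ^ j * x - p ^ (j + 1) * (1 / x)"
      by (cases "x = 0") (simp_all add: field_simps power_add)
    also have "norm \<dots> \<le> norm (p ^ (j + (j + 1)) * (x * (1 / x))) + norm (p ^ j * x)
                          + norm (p ^ (j + 1) * (1 / x))"
      by (intro order_trans[OF norm_triangle_ineq4] add_mono order_refl norm_triangle_ineq4)
    also have "\<dots> = norm p ^ (j + (j + 1)) * norm (x * (1 / x)) + norm p ^ j * norm x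
                    + norm p ^ (j + 1) * norm (1 / x)"
      by (simp only: norm_mult norm_power)
    also have "\<dots> \<le> norm p ^ j * norm (x * (1 / x)) + norm p ^ j * norm x
                    + norm p ^ j * norm (1 / x)"
      by (intro add_mono mult_right_mono le order_refl norm_ge_zero)
    also have "\<dots> = ?C * norm p ^ j"
      by (simp only: algebra_simps)
    finally show "norm (norm (?f j - 1)) \<le> ?C * norm p ^ j"
      by simp
  qed
  then have "convergent_prod ?f"
    by (intro abs_convergent_prod_imp_convergent_prod)
       (simp add: abs_convergent_prod_conv_summable)
  then show ?thesis
    unfolding theta_def by (rule convergent_prod_has_prod)
qed

lemma theta_0: "theta x 0 = 1 - x"
proof -
  have "(\<lambda>j. (1 - 0 ^ j * x) * (1 - 0 ^ (j + 1) / x)) = (\<lambda>j. if j = 0 then 1 - x else 1)"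
    by (auto simp: fun_eq_iff)
  then show ?thesis
    using theta_has_prod[of 0 x] has_prod_If_finite[of "\<lambda>j. j = 0" "\<lambda>_. 1 - x"]
    by (auto dest: has_prod_unique2)
qed

text \<open>The summand; \<open>X\<close> and \<open>B\<close> are the products of the $x_i$ and of the $b_i$.\<close>

definition summand ::
  "nat \<Rightarrow> nat \<Rightarrow> complex \<Rightarrow> complex \<Rightarrow> complex \<Rightarrow> (nat \<Rightarrow> complex) \<Rightarrow> complex \<Rightarrow> (nat \<Rightarrow> complex)
    \<Rightarrow> (nat \<Rightarrow> nat) \<Rightarrow> complex" where
  "summand r N p q a b c x k =
    (let n = weight r k; B = (\<Prod>i=1..r+1. b i); X = (\<Prod>i=1..r. x i) in
      Delta r (\<lambda>i. x i * q ^ (2 * k i)) p / Delta r x p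
      * (theta (a * q ^ (3 * n)) p / theta a p)
      * ((efac a q p n * efac (q powi (- int N)) q p n * efac (q ^ (N + 1)) q p n)
         / (efac (a * q ^ (N + 2)) (q\<^sup>2) p n * efac (a * q powi (1 - int N)) (q\<^sup>2) p n
            * (\<Prod>i=1..r+1. efac (a * b i * q / (B * X)) q p n)))
      * q powi (int n - int (e2 r k))
      * (\<Prod>i=1..r.
          (efac (c / x i) (q\<^sup>2) p n * efac (c / (a * x i)) q p (n - k i)
             * (\<Prod>j=1..r+1. efac (b j * x i) (q\<^sup>2) p (k i)))
          / (efac (c / x i) (q\<^sup>2) p (n - k i)
             * efac (a * x i * q powi (int (k i) - int n + 1) / c) q p (k i)
             * (\<Prod>j=1..r. efac (q\<^sup>2 * x i / x j) (q\<^sup>2) p (k i)))))"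

text \<open>Genericity: exactly that no denominator of the summand with index \<open>k\<close> vanishes.\<close>

definition summand_generic ::
  "nat \<Rightarrow> nat \<Rightarrow> complex \<Rightarrow> complex \<Rightarrow> complex \<Rightarrow> (nat \<Rightarrow> complex) \<Rightarrow> complex \<Rightarrow> (nat \<Rightarrow> complex)
    \<Rightarrow> (nat \<Rightarrow> nat) \<Rightarrow> bool" where
  "summand_generic r N p q a b c x k \<longleftrightarrow>
    (let n = weight r k; B = (\<Prod>i=1..r+1. b i); X = (\<Prod>i=1..r. x i) in
      Delta r x p \<noteq> 0 \<and> theta a p \<noteq> 0
      \<and> efac (a * q ^ (N + 2)) (q\<^sup>2) p n \<noteq> 0 \<and> efac (a * q powi (1 - int N)) (q\<^sup>2) p n \<noteq> 0
      \<and> (\<forall>i\<in>{1..r+1}. efac (a * b i * q / (B * X)) q p n \<noteq> 0)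
      \<and> (\<forall>i\<in>{1..r}.
          efac (c / x i) (q\<^sup>2) p (n - k i) \<noteq> 0
          \<and> efac (a * x i * q powi (int (k i) - int n + 1) / c) q p (k i) \<noteq> 0
          \<and> (\<forall>j\<in>{1..r}. efac (q\<^sup>2 * x i / x j) (q\<^sup>2) p (k i) \<noteq> 0)))"

end

theory Submission
  imports Defs
begin

text \<open>
  Put \<open>n = |k|\<close>. For fixed \<open>n\<close> the inner sum over \<open>k\<close> is a balanced Kajihara-Noumi sum of dimension
  \<open>r\<close> in base \<open>q\<^sup>2\<close> whose two free denominator parameters differ by the factor \<open>q\<close>. Two applications of
  the elliptic partial fraction identity give a two-term recursion in \<open>n\<close> for such sums, which
  is solved by the dual sum of dimension two, that is, by a single sum over \<open>k\<^sub>1 + k\<^sub>2 = n\<close>. In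
  this single sum the parameters enter only through the products on the right-hand side of the
  theorem for \<open>N = 0, \<dots>, n\<close>: the value \<open>N\<close> is determined by \<open>|2 (k\<^sub>2 - k\<^sub>1) + 1| = 2 N + 1\<close>, which is why
  the parity of \<open>N\<close> matters. The outer sum over \<open>n\<close> inverts this triangular system; the
  orthogonality relation telescopes.

  All identities are proved in additive form: with \<open>s z = exp (- z) \<theta>(exp (2 z); p)\<close>, which is odd
  and satisfies the three-term relation of Weierstrass, all monomial prefactors cancel.
  The three-term relation follows from the Jacobi triple product, which shows that
  \<open>s (x + y) s (x - y)\<close> is an antisymmetric quad_kernel of rank two. Intermediate denominators that are not
  covered by the genericity assumptions are made nonzero by a perturbation of the parameters.
\<close>

section \<open>Elliptic partial fractions\<close>

text \<open>Kajihara-Noumi duality exchanges the dimension of a sum with the number of its free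
  denominator parameters, here two. The recursion sees \<open>b\<close> and \<open>x\<close> only
  through \<open>ratio r x b\<close> at the points \<open>g1 + l h\<close> and
  \<open>g2 + l h\<close>. With \<open>h = 2 e\<close> and \<open>g2 = g1 + e\<close> these points
  interleave to progressions of step \<open>e\<close>, and the factors of the summand that depend on
  \<open>n\<close> alone divide out the values at \<open>a - c - l e\<close> for
  \<open>l < n\<close>. The ratio may then be an arbitrary nonvanishing function \<open>P\<close>:
  the outer sum is linear in the values \<open>alt_ratio P d\<close>, and the coefficient of each
  one with \<open>d < N\<close> is shown to vanish.

  Genericity shapes the rest. The recursion shifts \<open>t\<close>, \<open>g1\<close>,
  \<open>g2\<close> and needs all their integer translates to avoid the zeros of \<open>s\<close>,
  far more than the denominators of the summand guarantee. The perturbation moves \<open>a\<close>,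
  \<open>b\<close>, \<open>c\<close> and leaves \<open>x\<close> fixed, so the condition on
  \<open>x i - x j\<close> is carried along with the bound \<open>N\<close> that the denominators of
  the summand do supply.\<close>

text \<open>Every disc is uncountable, so 0 is a limit point of the complement of a countable set.
  Both uses are perturbations in one complex parameter \<open>t\<close>.\<close>

lemma eq_at_0_of_eq_off_countable:
  fixes f g :: "complex \<Rightarrow> complex"
  assumes "countable B" "isCont f 0" "isCont g 0" "\<And>t. t \<notin> B \<Longrightarrow> f t = g t"
  shows "f 0 = g 0"
proof -
  have "0 islimpt (- B)"
    unfolding islimpt_eq_infinite_ball
  proof (intro allI impI)
    fix e :: real assume "e > 0"
    then have "uncountable (ball (0::complex) e)" by (rule uncountable_ball)
    moreover have "ball 0 e \<subseteq> (- B \<inter> ball 0 e) \<union> B" by auto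
    ultimately show "infinite (- B \<inter> ball 0 e)"
      using assms(1) by (meson countable_Un countable_finite countable_subset)
  qed
  then have nt: "at 0 within (- B) \<noteq> bot" by (simp add: trivial_limit_within)
  have f: "(f \<longlongrightarrow> f 0) (at 0 within (- B))" and g: "(g \<longlongrightarrow> g 0) (at 0 within (- B))"
    using assms(2,3) by (auto simp: isCont_def intro: tendsto_within_subset)
  have "\<forall>\<^sub>F t in at 0 within (- B). g t = f t"
    using assms(4) by (auto simp: eventually_at_filter)
  from tendsto_cong[THEN iffD1, OF this g] show ?thesis
    using f nt tendsto_unique by blast
qed

text \<open>Everything up to the additive form of the theorem uses only these properties.
  \<open>weierstrass\<close> is the Pluecker relation for the minors of a kernel of rank two;
  countability of the zeros lets a generic line avoid them.\<close>

locale odd_theta =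
  fixes s :: "complex \<Rightarrow> complex"
  assumes odd: "s (- z) = - s z"
    and weierstrass: "s (x + y) * s (x - y) * s (u + v) * s (u - v)
          - s (x + v) * s (x - v) * s (u + y) * s (u - y) = s (y + v) * s (y - v) * s (x + u) * s (x - u)"
    and cont: "isCont s z"
    and zeros: "countable {z. s z = 0}"
begin

lemma s_0 [simp]: "s 0 = 0"
  using odd[of 0] by simp

lemma odd_diff: "s (x - y) = - s (y - x)"
  using odd[of "y - x"] by simp

lemma continuous_s [continuous_intros]:
  "isCont f z \<Longrightarrow> isCont (\<lambda>x. s (f x)) z"
  by (rule isCont_o2[OF _ cont])

lemma countable_zeros_affine:
  assumes "w \<noteq> 0"
  shows "countable {t. s (g + w * t) = 0}"
proof -
  have inj: "inj_on (\<lambda>t. g + w * t) {t. s (g + w * t) = 0}" using assms by (auto simp: inj_on_def)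
  have "countable ((\<lambda>t. g + w * t) ` {t. s (g + w * t) = 0})"
    by (rule countable_subset[OF _ zeros]) auto
  then show ?thesis using inj by (rule countable_image_inj_on)
qed

text \<open>For theta functions the terms are, up to a common factor, the residues of the product of
  \<open>s (w + \<beta> j) / s (w - z j)\<close> over \<open>j\<close>. The balance
  \<open>(\<Sum>i\<in>I. z i + \<beta> i) = 0\<close> makes this function of \<open>w\<close>
  elliptic, so its residues sum to zero.\<close>

definition pfrac :: "'i set \<Rightarrow> ('i \<Rightarrow> complex) \<Rightarrow> ('i \<Rightarrow> complex) \<Rightarrow> complex" where
  "pfrac I z \<beta> = (\<Sum>i\<in>I. (\<Prod>j\<in>I. s (z i + \<beta> j)) / (\<Prod>j\<in>I-{i}. s (z i - z j)))"

text \<open>With \<open>\<beta> a = - z a\<close> the term of \<open>a\<close> vanishes, and in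
  every other term \<open>s (z i - z a)\<close> occurs above and below. This lowers the number of
  points in the induction.\<close>

lemma pfrac_reduce:
  assumes "finite I" "a \<in> I" "\<beta> a = - z a"
    and ne: "\<And>i j. i \<in> I \<Longrightarrow> j \<in> I \<Longrightarrow> i \<noteq> j \<Longrightarrow> s (z i - z j) \<noteq> 0"
  shows "pfrac I z \<beta> = pfrac (I - {a}) z \<beta>"
proof -
  have "(\<Prod>j\<in>I. s (z i + \<beta> j)) / (\<Prod>j\<in>I-{i}. s (z i - z j)) =
        (\<Prod>j\<in>I-{a}. s (z i + \<beta> j)) / (\<Prod>j\<in>I-{a}-{i}. s (z i - z j))"
    if i: "i \<in> I - {a}" for i
  proof -
    have "(\<Prod>j\<in>I. s (z i + \<beta> j)) = s (z i - z a) * (\<Prod>j\<in>I-{a}. s (z i + \<beta> j))"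
      using assms by (subst prod.remove[of I a]) auto
    moreover have "(\<Prod>j\<in>I-{i}. s (z i - z j)) = s (z i - z a) * (\<Prod>j\<in>I-{a}-{i}. s (z i - z j))"
      using assms i prod.remove[of "I-{i}" a "\<lambda>j. s (z i - z j)"]
      by (auto simp: Diff_insert2[symmetric] insert_commute)
    ultimately show ?thesis using ne[of i a] i assms(2) by auto
  qed
  moreover have "(\<Prod>j\<in>I. s (z a + \<beta> j)) = 0"
    using assms by (subst prod.remove[of I a]) auto
  ultimately show ?thesis
    unfolding pfrac_def using assms by (subst sum.remove[of I a]) auto
qed

text \<open>
  For three or more points, two of the \<open>\<beta>\<close>'s can be moved with fixed sum; the sum is a
  combination of its values at positions where one \<open>\<beta>\<close> cancels one \<open>z\<close>.
\<close>

lemma partial_fractions: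
  assumes "finite I" "I \<noteq> {}"
    and "\<And>i j. i \<in> I \<Longrightarrow> j \<in> I \<Longrightarrow> i \<noteq> j \<Longrightarrow> s (z i - z j) \<noteq> 0"
    and "(\<Sum>i\<in>I. z i + \<beta> i) = 0"
  shows "pfrac I z \<beta> = 0"
  using assms
proof (induction "card I" arbitrary: I \<beta> rule: less_induct)
  case less
  note ne = less.prems(3)
  show ?case
  proof (cases "card I \<le> 1")
    case True
    then obtain a where "I = {a}"
      using less.prems by (metis One_nat_def card_0_eq card_1_singletonE le_SucE le_zero_eq)
    then show ?thesis using less.prems by (auto simp: pfrac_def)
  next
    case False
    then obtain a b where ab: "a \<in> I" "b \<in> I" "a \<noteq> b"
      using card_le_Suc0_iff_eq[OF less.prems(1)] by auto
    let ?J = "I - {a, b}"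
    have split: "(\<Prod>j\<in>I. f j) = f a * f b * (\<Prod>j\<in>?J. f j)" for f :: "'a \<Rightarrow> complex"
      using ab less.prems(1) prod.remove[of I a f] prod.remove[of "I-{a}" b f]
      by (simp add: Diff_insert2[symmetric] mult.assoc)
    have splits: "(\<Sum>j\<in>I. f j) = f a + f b + (\<Sum>j\<in>?J. f j)" for f :: "'a \<Rightarrow> complex"
      using ab less.prems(1) sum.remove[of I a f] sum.remove[of "I-{a}" b f]
      by (simp add: Diff_insert2[symmetric] add.assoc)
    show ?thesis
    \<comment> \<open>Two points are special: the balance forces
      \<open>z a + z b + \<beta> a + \<beta> b = 0\<close>, so the divisor \<open>D\<close> below is
      always zero and no perturbation helps. The two terms cancel by oddness.\<close>
    proof (cases "?J = {}")
      case True
      then have I: "I = {a, b}" using ab by auto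
      have "z a + \<beta> a = - (z b + \<beta> b)" "z b + \<beta> a = - (z a + \<beta> b)"
        using less.prems(4) ab unfolding I by (simp_all add: eq_neg_iff_add_eq_0 algebra_simps)
      then have "s (z a + \<beta> a) = - s (z b + \<beta> b)" "s (z b + \<beta> a) = - s (z a + \<beta> b)"
        by (metis odd)+
      then show ?thesis using ab odd_diff[of "z b" "z a"]
        unfolding pfrac_def I by (simp add: insert_Diff_if)
    next
      case False
      then obtain c where c: "c \<in> I" "c \<noteq> a" "c \<noteq> b" by auto
      have main: "pfrac I z \<gamma> = 0" if g: "(\<Sum>i\<in>I. z i + \<gamma> i) = 0" "s (z a + z b + \<gamma> a + \<gamma> b) \<noteq> 0" for \<gamma>
      proof -
        define \<sigma> where "\<sigma> = \<gamma> a + \<gamma> b"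
        define \<gamma>1 where "\<gamma>1 = \<gamma>(a := z b + \<sigma>, b := - z b)"
        define \<gamma>2 where "\<gamma>2 = \<gamma>(a := - z a, b := z a + \<sigma>)"
        have sums: "(\<Sum>i\<in>I. z i + \<gamma>1 i) = 0" "(\<Sum>i\<in>I. z i + \<gamma>2 i) = 0"
          using g(1) ab unfolding splits by (auto simp: \<gamma>1_def \<gamma>2_def \<sigma>_def algebra_simps)
        have 1: "pfrac I z \<gamma>1 = 0"
        proof -
          have "pfrac I z \<gamma>1 = pfrac (I - {b}) z \<gamma>1"
            using ab less.prems ne by (intro pfrac_reduce) (auto simp: \<gamma>1_def)
          also have "\<dots> = 0"
          proof (rule less.hyps)
            show "card (I - {b}) < card I" using ab less.prems by (intro card_Diff1_less) auto
            show "(\<Sum>i\<in>I - {b}. z i + \<gamma>1 i) = 0" using sums(1) ab less.prems(1)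
              by (subst (asm) sum.remove[of I b]) (auto simp: \<gamma>1_def)
          qed (use less.prems ab ne in auto)
          finally show ?thesis .
        qed
        have 2: "pfrac I z \<gamma>2 = 0"
        proof -
          have "pfrac I z \<gamma>2 = pfrac (I - {a}) z \<gamma>2"
            using ab less.prems ne by (intro pfrac_reduce) (auto simp: \<gamma>2_def)
          also have "\<dots> = 0"
          proof (rule less.hyps)
            show "card (I - {a}) < card I" using ab less.prems by (intro card_Diff1_less) auto
            show "(\<Sum>i\<in>I - {a}. z i + \<gamma>2 i) = 0" using sums(2) ab less.prems(1)
              by (subst (asm) sum.remove[of I a]) (auto simp: \<gamma>2_def)
          qed (use less.prems ab ne in auto)
          finally show ?thesis .
        qed
        define D where "D = s (z a + z b + \<sigma>) * s (z a - z b)"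
        define C1 where "C1 = s (z a + \<gamma> a) * s (z a + \<gamma> b)"
        define C2 where "C2 = - s (z b + \<gamma> a) * s (z b + \<gamma> b)"
        \<comment> \<open>As functions of \<open>w\<close> all three products have the form
          \<open>s (w + \<sigma>/2 + y) * s (w + \<sigma>/2 - y)\<close>; the three-term relation
          makes any three of these linearly dependent.\<close>
        have key: "D * (s (w + \<gamma> a) * s (w + \<gamma> b)) =
            C1 * (s (w + (z b + \<sigma>)) * s (w - z b)) + C2 * (s (w - z a) * s (w + (z a + \<sigma>)))" for w
        proof -
          have "s (w + \<gamma> a) * s (w + \<gamma> b) * s (z a + z b + \<sigma>) * s (z a - z b)
             - s (w + (z b + \<sigma>)) * s (w - z b) * s (z a + \<gamma> a) * s (z a + \<gamma> b)
             = s (z b + \<gamma> a) * s (- (z b + \<gamma> b)) * s (w + (z a + \<sigma>)) * s (w - z a)"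
          proof -
            have "w + \<sigma>/2 + (\<gamma> a - \<gamma> b)/2 = w + \<gamma> a" "w + \<sigma>/2 - (\<gamma> a - \<gamma> b)/2 = w + \<gamma> b"
              "z a + \<sigma>/2 + (z b + \<sigma>/2) = z a + z b + \<sigma>" "z a + \<sigma>/2 - (z b + \<sigma>/2) = z a - z b"
              "w + \<sigma>/2 + (z b + \<sigma>/2) = w + (z b + \<sigma>)" "w + \<sigma>/2 - (z b + \<sigma>/2) = w - z b"
              "z a + \<sigma>/2 + (\<gamma> a - \<gamma> b)/2 = z a + \<gamma> a" "z a + \<sigma>/2 - (\<gamma> a - \<gamma> b)/2 = z a + \<gamma> b"
              "(\<gamma> a - \<gamma> b)/2 + (z b + \<sigma>/2) = z b + \<gamma> a" "(\<gamma> a - \<gamma> b)/2 - (z b + \<sigma>/2) = - (z b + \<gamma> b)"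
              "w + \<sigma>/2 + (z a + \<sigma>/2) = w + (z a + \<sigma>)" "w + \<sigma>/2 - (z a + \<sigma>/2) = w - z a"
              unfolding \<sigma>_def by (simp_all add: field_simps)
            with weierstrass[of "w + \<sigma>/2" "(\<gamma> a - \<gamma> b)/2" "z a + \<sigma>/2" "z b + \<sigma>/2"]
            show ?thesis by (simp only:)
          qed
          then show ?thesis unfolding D_def C1_def C2_def odd by (simp add: algebra_simps)
        qed
        have "D * pfrac I z \<gamma> = C1 * pfrac I z \<gamma>1 + C2 * pfrac I z \<gamma>2"
          unfolding pfrac_def sum_distrib_left sum.distrib[symmetric]
        proof (rule sum.cong[OF refl])
          fix i assume "i \<in> I"
          have e: "(\<Prod>j\<in>?J. s (z i + \<gamma>1 j)) = (\<Prod>j\<in>?J. s (z i + \<gamma> j))"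
            "(\<Prod>j\<in>?J. s (z i + \<gamma>2 j)) = (\<Prod>j\<in>?J. s (z i + \<gamma> j))"
            by (auto intro!: prod.cong simp: \<gamma>1_def \<gamma>2_def)
          have v: "\<gamma>1 a = z b + \<sigma>" "\<gamma>1 b = - z b" "\<gamma>2 a = - z a" "\<gamma>2 b = z a + \<sigma>"
            using ab by (auto simp: \<gamma>1_def \<gamma>2_def)
          show "D * ((\<Prod>j\<in>I. s (z i + \<gamma> j)) / (\<Prod>j\<in>I - {i}. s (z i - z j))) =
             C1 * ((\<Prod>j\<in>I. s (z i + \<gamma>1 j)) / (\<Prod>j\<in>I - {i}. s (z i - z j))) +
             C2 * ((\<Prod>j\<in>I. s (z i + \<gamma>2 j)) / (\<Prod>j\<in>I - {i}. s (z i - z j)))"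
            unfolding split e v using arg_cong[OF key[of "z i"], of "\<lambda>t. t * (\<Prod>j\<in>?J. s (z i + \<gamma> j)) / (\<Prod>j\<in>I - {i}. s (z i - z j))"]
            by (simp add: add_divide_distrib distrib_right mult.assoc)
        qed
        moreover have "D \<noteq> 0" using g(2) ne[of a b] ab by (auto simp: D_def \<sigma>_def add.assoc)
        ultimately show ?thesis using 1 2 by simp
      qed
      \<comment> \<open>The third index \<open>c\<close> absorbs the change of
        \<open>\<beta> a\<close>: the total stays balanced while
        \<open>z a + z b + \<gamma> t a + \<gamma> t b\<close> moves with \<open>t\<close>, so
        \<open>D\<close> vanishes only for countably many \<open>t\<close>.\<close>
      define \<gamma> where "\<gamma> t = \<beta>(a := \<beta> a + t, c := \<beta> c - t)" for t
      have "pfrac I z (\<gamma> 0) = 0"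
      proof (rule eq_at_0_of_eq_off_countable[where g = "\<lambda>_. 0" and f = "\<lambda>t. pfrac I z (\<gamma> t)"])
        show "countable {t. s ((z a + z b + \<beta> a + \<beta> b) + 1 * t) = 0}"
          by (rule countable_zeros_affine) simp
        show "isCont (\<lambda>t. pfrac I z (\<gamma> t)) 0"
        proof -
          have "isCont (\<lambda>t. \<gamma> t j) 0" for j
            by (cases "j = c"; cases "j = a") (auto simp: \<gamma>_def intro!: continuous_intros)
          then show ?thesis
            unfolding pfrac_def using ne by (intro continuous_intros continuous_prod) (auto simp: less.prems(1))
        qed
        show "pfrac I z (\<gamma> t) = 0" if "t \<notin> {t. s ((z a + z b + \<beta> a + \<beta> b) + 1 * t) = 0}" for t
        proof (rule main)
          have "(\<Sum>i\<in>I. z i + \<gamma> t i) = (\<Sum>i\<in>I. z i + \<beta> i) + (\<Sum>i\<in>I. (if i = a then t else 0) - (if i = c then t else 0))"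
            unfolding sum.distrib[symmetric] by (rule sum.cong) (use c in \<open>auto simp: \<gamma>_def\<close>)
          also have "\<dots> = 0" using less.prems ab c by (simp add: sum_subtractf)
          finally show "(\<Sum>i\<in>I. z i + \<gamma> t i) = 0" .
          show "s (z a + z b + \<gamma> t a + \<gamma> t b) \<noteq> 0" using that c ab by (simp add: \<gamma>_def algebra_simps)
        qed
      qed simp
      then show ?thesis by (simp add: \<gamma>_def)
    qed
  qed
qed


section \<open>Shifted factorials and two expansions in partial fractions\<close>

definition fac :: "complex \<Rightarrow> complex \<Rightarrow> nat \<Rightarrow> complex" where
  "fac h z n = (\<Prod>j<n. s (z + of_nat j * h))"

lemma fac_0 [simp]: "fac h z 0 = 1"
  by (simp add: fac_def)

lemma fac_Suc: "fac h z (Suc n) = fac h z n * s (z + of_nat n * h)"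
  by (simp add: fac_def)

lemma fac_Suc_shift: "fac h z (Suc n) = s z * fac h (z + h) n"
  unfolding fac_def by (simp add: prod.lessThan_Suc_shift algebra_simps del: prod.lessThan_Suc)

lemma fac_shift: "s z * fac h (z + h) n = fac h z n * s (z + of_nat n * h)"
  by (simp flip: fac_Suc_shift add: fac_Suc)

definition vand :: "nat \<Rightarrow> (nat \<Rightarrow> complex) \<Rightarrow> complex" where
  "vand r z = (\<Prod>j=1..r. \<Prod>i=1..<j. s (z i - z j))"

lemma prod_pairs_remove:
  fixes g :: "nat \<Rightarrow> nat \<Rightarrow> complex"
  assumes "i \<in> {1..r}"
  shows "(\<Prod>j=1..r. \<Prod>l=1..<j. g l j) =
    (\<Prod>j\<in>{1..r}-{i}. \<Prod>l\<in>{1..<j}-{i}. g l j) * (\<Prod>l\<in>{1..<i}. g l i) * (\<Prod>j\<in>{i<..r}. g i j)"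
proof -
  have "(\<Prod>l=1..<j. g l j) = (\<Prod>l\<in>{1..<j}-{i}. g l j) * (if i < j then g i j else 1)" for j
    using assms prod.remove[of "{1..<j}" i "\<lambda>l. g l j"] by (cases "i < j") (auto simp: mult.commute)
  then have "(\<Prod>j\<in>{1..r}-{i}. \<Prod>l=1..<j. g l j) =
     (\<Prod>j\<in>{1..r}-{i}. \<Prod>l\<in>{1..<j}-{i}. g l j) * (\<Prod>j\<in>{1..r}-{i}. if i < j then g i j else 1)"
    by (simp add: prod.distrib)
  moreover have "(\<Prod>j\<in>{1..r}-{i}. if i < j then g i j else 1) = (\<Prod>j\<in>{i<..r}. g i j)"
    using assms by (intro prod.mono_neutral_cong_right) auto
  ultimately show ?thesis
    using assms prod.remove[of "{1..r}" i "\<lambda>j. \<Prod>l=1..<j. g l j"] by (simp add: mult_ac)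
qed

text \<open>Only the pairs containing \<open>i\<close> change. Those with \<open>l < i\<close> have
  the reversed order of arguments, but the signs agree on both sides. The multiplied form requires
  no factor to be nonzero.\<close>

lemma vand_upd:
  assumes "i \<in> {1..r}"
  shows "vand r (z(i := w)) * (\<Prod>j\<in>{1..r}-{i}. s (z i - z j)) = vand r z * (\<Prod>j\<in>{1..r}-{i}. s (w - z j))"
proof -
  have split: "(\<Prod>j\<in>{1..r}-{i}. f j) = (\<Prod>j\<in>{1..<i}. f j) * (\<Prod>j\<in>{i<..r}. f j)" for f :: "nat \<Rightarrow> complex"
  proof -
    have "{1..r}-{i} = {1..<i} \<union> {i<..r}" using assms by auto
    moreover have "{1..<i} \<inter> {i<..r} = {}" by auto
    ultimately show ?thesis by (simp only: prod.union_disjoint finite_atLeastLessThan finite_greaterThanAtMost)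
  qed
  have "(\<Prod>l\<in>{1..<i}. s (z l - w)) * (\<Prod>l\<in>{1..<i}. s (z i - z l)) =
        (\<Prod>l\<in>{1..<i}. s (z l - z i)) * (\<Prod>l\<in>{1..<i}. s (w - z l))"
    unfolding prod.distrib[symmetric] by (rule prod.cong) (simp_all add: odd_diff[of _ w] odd_diff[of "z i"])
  then show ?thesis
    unfolding vand_def prod_pairs_remove[OF assms] split by simp
qed

text \<open>The extra point is \<open>- t\<close>, and its numerator parameter \<open>t - m\<close>
  is forced by the balance. Its own term, moved to the other side, is the product by which the
  factors \<open>fac h (t + x i)\<close> differ from \<open>fac h (t + h + x i)\<close> when
  \<open>z i\<close> is \<open>x i + k i * h\<close>.\<close>

lemma partial_fractions_one_pole:
  fixes z x :: "nat \<Rightarrow> complex"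
  assumes ne: "\<And>i j. i \<in> {1..r} \<Longrightarrow> j \<in> {1..r} \<Longrightarrow> i \<noteq> j \<Longrightarrow> s (z i - z j) \<noteq> 0"
    and t: "\<And>i. i \<in> {1..r} \<Longrightarrow> s (t + z i) \<noteq> 0"
    and m: "(\<Sum>i=1..r. z i - x i) = m"
  shows "s m * (\<Prod>j=1..r. s (t + x j) / s (t + z j)) =
    (\<Sum>i=1..r. (\<Prod>j=1..r. s (z i - x j)) * s (z i + t - m) / ((\<Prod>j\<in>{1..r}-{i}. s (z i - z j)) * s (z i + t)))"
proof -
  define Z where "Z i = (if i \<le> r then z i else - t)" for i
  define B where "B i = (if i \<le> r then - x i else t - m)" for i
  let ?I = "insert (Suc r) {1..r}"
  have pf0: "pfrac ?I Z B = 0"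
  proof (rule partial_fractions)
    show "s (Z i - Z j) \<noteq> 0" if "i \<in> ?I" "j \<in> ?I" "i \<noteq> j" for i j
      using ne[of i j] t[of i] t[of j] that odd[of "t + z j"] by (auto simp: Z_def add.commute)
    show "(\<Sum>i\<in>?I. Z i + B i) = 0"
      using m by (simp add: Z_def B_def)
  qed auto
  have e1: "(\<Prod>j\<in>?I. s (Z i + B j)) / (\<Prod>j\<in>?I-{i}. s (Z i - Z j)) =
    (\<Prod>j=1..r. s (z i - x j)) * s (z i + t - m) / ((\<Prod>j\<in>{1..r}-{i}. s (z i - z j)) * s (z i + t))"
    if "i \<in> {1..r}" for i
  proof -
    have "?I - {i} = insert (Suc r) ({1..r}-{i})" using that by auto
    moreover have "(\<Prod>j\<in>{1..r}-{i}. s (Z i - Z j)) = (\<Prod>j\<in>{1..r}-{i}. s (z i - z j))"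
      "(\<Prod>j\<in>{1..r}. s (Z i + B j)) = (\<Prod>j\<in>{1..r}. s (z i - x j))"
      using that by (auto simp: Z_def B_def intro!: prod.cong)
    ultimately show ?thesis using that by (simp add: Z_def B_def algebra_simps)
  qed
  have I: "?I - {Suc r} = {1..r}" by auto
  have "s (- x j - t) = s (- t - x j)" for j
    by (rule arg_cong[of _ _ s]) (rule minus_diff_commute)
  with I have "(\<Prod>j\<in>?I. s (Z (Suc r) + B j)) / (\<Prod>j\<in>?I-{Suc r}. s (Z (Suc r) - Z j)) =
     s (- m) * ((\<Prod>j=1..r. s (- (t + x j))) / (\<Prod>j=1..r. s (- (t + z j))))"
    by (simp add: Z_def B_def)
  also have "\<dots> = - (s m * (\<Prod>j=1..r. s (t + x j) / s (t + z j)))"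
    unfolding prod_dividef[symmetric] odd by simp
  finally have e2: "(\<Prod>j\<in>?I. s (Z (Suc r) + B j)) / (\<Prod>j\<in>?I-{Suc r}. s (Z (Suc r) - Z j)) =
    - (s m * (\<Prod>j=1..r. s (t + x j) / s (t + z j)))" .
  define F where "F i = (\<Prod>j\<in>?I. s (Z i + B j)) / (\<Prod>j\<in>?I-{i}. s (Z i - Z j))" for i
  have "sum F ?I = 0"
    using pf0 unfolding pfrac_def F_def .
  then have "(\<Sum>i=1..r. F i) = - F (Suc r)"
    by (simp add: eq_neg_iff_add_eq_0 add.commute)
  moreover have "(\<Sum>i=1..r. F i) = (\<Sum>i=1..r. (\<Prod>j=1..r. s (z i - x j)) * s (z i + t - m) / ((\<Prod>j\<in>{1..r}-{i}. s (z i - z j)) * s (z i + t)))"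
    unfolding F_def by (rule sum.cong[OF refl]) (rule e1)
  ultimately show ?thesis
    unfolding F_def e2 by simp
qed

text \<open>The extra points are \<open>- g1\<close> and \<open>- g2\<close>, and \<open>u\<close>
  joins the \<open>b j\<close> to give \<open>r + 2\<close> numerator parameters. The terms of the
  two extra points, on the right, are the source of the two-term recursion.\<close>

lemma partial_fractions_two_poles:
  fixes z b :: "nat \<Rightarrow> complex"
  assumes ne: "\<And>i j. i \<in> {1..r} \<Longrightarrow> j \<in> {1..r} \<Longrightarrow> i \<noteq> j \<Longrightarrow> s (z i - z j) \<noteq> 0"
    and g: "\<And>i. i \<in> {1..r} \<Longrightarrow> s (g1 + z i) \<noteq> 0" "\<And>i. i \<in> {1..r} \<Longrightarrow> s (g2 + z i) \<noteq> 0"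
      "s (g1 - g2) \<noteq> 0"
    and bal: "(\<Sum>j=1..r+1. b j) + u + (\<Sum>i=1..r. z i) = g1 + g2"
  shows "(\<Sum>i=1..r. (\<Prod>j=1..r+1. s (b j + z i)) * s (u + z i) /
            ((\<Prod>j\<in>{1..r}-{i}. s (z i - z j)) * s (g1 + z i) * s (g2 + z i))) =
    (\<Prod>j=1..r+1. s (g1 - b j)) * s (g1 - u) / ((\<Prod>j=1..r. s (g1 + z j)) * s (g1 - g2)) +
    (\<Prod>j=1..r+1. s (g2 - b j)) * s (g2 - u) / ((\<Prod>j=1..r. s (g2 + z j)) * s (g2 - g1))"
proof -
  define Z where "Z i = (if i \<le> r then z i else if i = Suc r then - g1 else - g2)" for i
  define B where "B i = (if i \<le> Suc r then b i else u)" for i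
  let ?I = "insert (Suc (Suc r)) (insert (Suc r) {1..r})"
  have g': "s (g2 - g1) \<noteq> 0" using g(3) odd_diff[of g2 g1] by simp
  have pf0: "pfrac ?I Z B = 0"
  proof (rule partial_fractions)
    show "s (Z i - Z j) \<noteq> 0" if "i \<in> ?I" "j \<in> ?I" "i \<noteq> j" for i j
      using ne[of i j] g(1,2)[of i] g(1,2)[of j] g(3) g' that odd[of "g1 + z j"] odd[of "g2 + z j"]
      by (auto simp: Z_def add.commute)
    show "(\<Sum>i\<in>?I. Z i + B i) = 0"
      using bal by (simp add: Z_def B_def sum.distrib algebra_simps)
  qed auto
  have Bp: "(\<Prod>j\<in>?I. s (w + B j)) = (\<Prod>j=1..r+1. s (b j + w)) * s (u + w)" for w
  proof -
    have "(\<Prod>j\<in>{1..r}. s (w + B j)) = (\<Prod>j\<in>{1..r}. s (w + b j))"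
      by (auto simp: B_def intro!: prod.cong)
    then show ?thesis by (simp add: B_def add.commute mult_ac)
  qed
  have e1: "(\<Prod>j\<in>?I. s (Z i + B j)) / (\<Prod>j\<in>?I-{i}. s (Z i - Z j)) =
    (\<Prod>j=1..r+1. s (b j + z i)) * s (u + z i) / ((\<Prod>j\<in>{1..r}-{i}. s (z i - z j)) * s (g1 + z i) * s (g2 + z i))"
    if "i \<in> {1..r}" for i
  proof -
    have "?I - {i} = insert (Suc (Suc r)) (insert (Suc r) ({1..r}-{i}))" using that by auto
    moreover have "(\<Prod>j\<in>{1..r}-{i}. s (Z i - Z j)) = (\<Prod>j\<in>{1..r}-{i}. s (z i - z j))"
      using that by (auto simp: Z_def intro!: prod.cong)
    moreover have "Z i = z i" using that by (simp add: Z_def)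
    ultimately show ?thesis unfolding Bp using that by (simp add: Z_def add.commute mult_ac)
  qed
  have i2: "?I - {Suc r} = insert (Suc (Suc r)) {1..r}" "?I - {Suc (Suc r)} = insert (Suc r) {1..r}" by auto
  \<comment> \<open>Oddness is used \<open>r + 2\<close> times above and \<open>r\<close> times
    below, so these signs cancel; the two minus signs written out serve to turn
    \<open>s (g2 - g1)\<close> into \<open>s (g1 - g2)\<close> and conversely.\<close>
  have sgn: "(\<Prod>j=1..r+1. s (b j - g)) * s (u - g) / ((\<Prod>j=1..r. s (- g - z j)) * w) =
    - ((\<Prod>j=1..r+1. s (g - b j)) * s (g - u) / ((\<Prod>j=1..r. s (g + z j)) * (- w)))" for g w
  proof -
    have "(\<Prod>j=1..r. s (- g - z j)) = (- 1) ^ r * (\<Prod>j=1..r. s (g + z j))"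
    proof -
      have "s (- g - z j) = - s (g + z j)" for j using odd[of "g + z j"] by simp
      then show ?thesis by (simp add: prod_uminus)
    qed
    moreover have "(\<Prod>j=1..r+1. s (b j - g)) = (- 1) ^ (r+1) * (\<Prod>j=1..r+1. s (g - b j))"
      unfolding odd_diff[of "b _" g] by (subst prod_uminus) simp
    moreover have "s (u - g) = - s (g - u)" by (rule odd_diff)
    ultimately show ?thesis by (simp only:) (simp add: field_simps power_add)
  qed
  have e2: "(\<Prod>j\<in>?I. s (Z (Suc r) + B j)) / (\<Prod>j\<in>?I-{Suc r}. s (Z (Suc r) - Z j)) =
    - ((\<Prod>j=1..r+1. s (g1 - b j)) * s (g1 - u) / ((\<Prod>j=1..r. s (g1 + z j)) * s (g1 - g2)))"
    using sgn[of g1 "s (g2 - g1)"] odd_diff[of g2 g1] unfolding Bp i2 by (simp add: Z_def mult_ac)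
  have e3: "(\<Prod>j\<in>?I. s (Z (Suc (Suc r)) + B j)) / (\<Prod>j\<in>?I-{Suc (Suc r)}. s (Z (Suc (Suc r)) - Z j)) =
    - ((\<Prod>j=1..r+1. s (g2 - b j)) * s (g2 - u) / ((\<Prod>j=1..r. s (g2 + z j)) * s (g2 - g1)))"
    using sgn[of g2 "s (g1 - g2)"] odd_diff[of g1 g2] unfolding Bp i2 by (simp add: Z_def mult_ac)
  define F where "F i = (\<Prod>j\<in>?I. s (Z i + B j)) / (\<Prod>j\<in>?I-{i}. s (Z i - Z j))" for i
  have "sum F ?I = 0"
    using pf0 unfolding pfrac_def F_def .
  then have "(\<Sum>i=1..r. F i) = - F (Suc r) - F (Suc (Suc r))"
    by (simp add: algebra_simps eq_neg_iff_add_eq_0)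
  moreover have "(\<Sum>i=1..r. F i) = (\<Sum>i=1..r. (\<Prod>j=1..r+1. s (b j + z i)) * s (u + z i) /
            ((\<Prod>j\<in>{1..r}-{i}. s (z i - z j)) * s (g1 + z i) * s (g2 + z i)))"
    unfolding F_def by (rule sum.cong[OF refl]) (rule e1)
  ultimately show ?thesis
    unfolding F_def e2 e3 by (simp only: minus_minus diff_minus_eq_add)
qed

end

section \<open>A Kajihara-Noumi transformation\<close>

definition compositions :: "nat \<Rightarrow> nat \<Rightarrow> (nat \<Rightarrow> nat) set" where
  "compositions r n = {k \<in> {1..r} \<rightarrow>\<^sub>E UNIV. weight r k = n}"

lemma finite_compositions: "finite (compositions r n)"
  by (rule finite_subset[OF _ finite_multi_indices[of r n]]) (auto simp: compositions_def multi_indices_def)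

lemma weight_upd: "i \<in> {1..r} \<Longrightarrow> weight r (k(i := Suc (k i))) = Suc (weight r k)"
  unfolding weight_def by (subst (1 2) sum.remove[of "{1..r}" i]) auto

lemma compositions_le: "k \<in> compositions r n \<Longrightarrow> i \<in> {1..r} \<Longrightarrow> k i \<le> n"
  using member_le_sum[of i "{1..r}" k] by (auto simp: compositions_def weight_def)

text \<open>Removing one unit from entry \<open>i\<close> is a bijection from the pairs
  \<open>(k, i)\<close> with \<open>k i > 0\<close> onto the pairs with a composition of
  \<open>n\<close>; the hypothesis discards the remaining pairs.\<close>

lemma sum_compositions_Suc:
  fixes G :: "(nat \<Rightarrow> nat) \<Rightarrow> nat \<Rightarrow> complex"
  assumes "\<And>k i. k \<in> compositions r (Suc n) \<Longrightarrow> i \<in> {1..r} \<Longrightarrow> k i = 0 \<Longrightarrow> G k i = 0"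
  shows "(\<Sum>k\<in>compositions r (Suc n). \<Sum>i=1..r. G k i) = (\<Sum>k\<in>compositions r n. \<Sum>i=1..r. G (k(i := Suc (k i))) i)"
proof -
  let ?S = "{(k, i) \<in> compositions r (Suc n) \<times> {1..r}. k i \<noteq> 0}"
  have "(\<Sum>k\<in>compositions r (Suc n). \<Sum>i=1..r. G k i) = (\<Sum>(k, i)\<in>compositions r (Suc n) \<times> {1..r}. G k i)"
    by (rule sum.cartesian_product)
  also have "\<dots> = (\<Sum>(k, i)\<in>?S. G k i)"
    by (intro sum.mono_neutral_right) (auto simp: finite_compositions intro: assms)
  also have "\<dots> = (\<Sum>(k, i)\<in>compositions r n \<times> {1..r}. G (k(i := Suc (k i))) i)"
  proof (rule sum.reindex_bij_witness[where j = "\<lambda>(k, i). (k(i := k i - 1), i)" and i = "\<lambda>(k, i). (k(i := Suc (k i)), i)"])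
    fix p assume "p \<in> ?S"
    then obtain k i where p: "p = (k, i)" "k \<in> compositions r (Suc n)" "i \<in> {1..r}" "k i \<noteq> 0" by auto
    have "weight r (k(i := k i - 1)) = n"
      using weight_upd[of i r "k(i := k i - 1)"] p by (auto simp: compositions_def)
    then show "(case p of (k, i) \<Rightarrow> (k(i := k i - 1), i)) \<in> compositions r n \<times> {1..r}"
      using p by (auto simp: compositions_def PiE_def extensional_def)
  next
    fix p assume "p \<in> compositions r n \<times> {1..r}"
    then obtain k i where p: "p = (k, i)" "k \<in> compositions r n" "i \<in> {1..r}" by auto
    then show "(case p of (k, i) \<Rightarrow> (k(i := Suc (k i)), i)) \<in> ?S"
      using weight_upd[of i r k] by (auto simp: compositions_def PiE_def extensional_def)
  qed auto
  also have "\<dots> = (\<Sum>k\<in>compositions r n. \<Sum>i=1..r. G (k(i := Suc (k i))) i)"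
    by (rule sum.cartesian_product[symmetric])
  finally show ?thesis .
qed

context odd_theta begin

definition shifted :: "complex \<Rightarrow> (nat \<Rightarrow> complex) \<Rightarrow> (nat \<Rightarrow> nat) \<Rightarrow> nat \<Rightarrow> complex" where
  "shifted h x k i = x i + of_nat (k i) * h"

definition root_factor :: "complex \<Rightarrow> nat \<Rightarrow> (nat \<Rightarrow> complex) \<Rightarrow> (nat \<Rightarrow> nat) \<Rightarrow> complex" where
  "root_factor h r x k =
    vand r (shifted h x k) / vand r x / (\<Prod>i=1..r. \<Prod>j=1..r. fac h (h + x i - x j) (k i))"

text \<open>The parameter \<open>t\<close> is kept apart from the \<open>b j\<close> because the
  recursion moves it together with \<open>g1\<close> or \<open>g2\<close>, whereas \<open>b\<close>
  and \<open>x\<close> never change.\<close>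

definition kn_term :: "complex \<Rightarrow> nat \<Rightarrow> (nat \<Rightarrow> complex) \<Rightarrow> (nat \<Rightarrow> complex) \<Rightarrow> complex \<Rightarrow> complex \<Rightarrow> complex \<Rightarrow> (nat \<Rightarrow> nat) \<Rightarrow> complex" where
  "kn_term h r x b t g1 g2 k = root_factor h r x k *
    (\<Prod>i=1..r. (\<Prod>j=1..r+1. fac h (b j + x i) (k i)) * fac h (t + x i) (k i) /
      (fac h (g1 + x i) (k i) * fac h (g2 + x i) (k i)))"

definition kn_sum :: "complex \<Rightarrow> nat \<Rightarrow> (nat \<Rightarrow> complex) \<Rightarrow> (nat \<Rightarrow> complex) \<Rightarrow> complex \<Rightarrow> complex \<Rightarrow> complex \<Rightarrow> nat \<Rightarrow> complex" where
  "kn_sum h r x b t g1 g2 n = (\<Sum>k\<in>compositions r n. kn_term h r x b t g1 g2 k)"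

text \<open>What the term of the pole \<open>- g\<close> contributes once \<open>z j\<close> has
  been traded for \<open>x j\<close>; the coefficients of the recursion contain \<open>b\<close> and
  \<open>x\<close> in no other way.\<close>

definition ratio :: "nat \<Rightarrow> (nat \<Rightarrow> complex) \<Rightarrow> (nat \<Rightarrow> complex) \<Rightarrow> complex \<Rightarrow> complex" where
  "ratio r x b g = (\<Prod>j=1..r+1. s (g - b j)) / (\<Prod>j=1..r. s (g + x j))"

lemma shifted_upd: "shifted h x (k(i := Suc (k i))) = (shifted h x k)(i := shifted h x k i + h)"
  by (auto simp: shifted_def fun_eq_iff algebra_simps)

lemma root_factor_upd:
  assumes i: "i \<in> {1..r}" and z: "z = shifted h x k"
    and ne: "\<And>j. j \<in> {1..r} - {i} \<Longrightarrow> s (z i - z j) \<noteq> 0" "\<And>j. j \<in> {1..r} \<Longrightarrow> s (z i + h - x j) \<noteq> 0"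
  shows "root_factor h r x (k(i := Suc (k i))) =
    root_factor h r x k * (\<Prod>j\<in>{1..r}-{i}. s (z i + h - z j)) /
      ((\<Prod>j\<in>{1..r}-{i}. s (z i - z j)) * (\<Prod>j=1..r. s (z i + h - x j)))"
proof -
  let ?k = "k(i := Suc (k i))"
  have "(\<Prod>l=1..r. \<Prod>j=1..r. fac h (h + x l - x j) (?k l)) =
     (\<Prod>j=1..r. fac h (h + x i - x j) (Suc (k i))) * (\<Prod>l\<in>{1..r}-{i}. \<Prod>j=1..r. fac h (h + x l - x j) (k l))"
    using i by (subst prod.remove[of "{1..r}" i]) auto
  also have "(\<Prod>j=1..r. fac h (h + x i - x j) (Suc (k i))) =
     (\<Prod>j=1..r. fac h (h + x i - x j) (k i)) * (\<Prod>j=1..r. s (z i + h - x j))"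
    unfolding prod.distrib[symmetric] by (rule prod.cong) (simp_all add: fac_Suc z shifted_def algebra_simps)
  finally have den: "(\<Prod>l=1..r. \<Prod>j=1..r. fac h (h + x l - x j) (?k l)) =
     (\<Prod>l=1..r. \<Prod>j=1..r. fac h (h + x l - x j) (k l)) * (\<Prod>j=1..r. s (z i + h - x j))"
    using i prod.remove[of "{1..r}" i "\<lambda>l. \<Prod>j=1..r. fac h (h + x l - x j) (k l)"] by simp
  have nz: "(\<Prod>j\<in>{1..r}-{i}. s (z i - z j)) \<noteq> 0" using ne(1) by auto
  have "vand r (shifted h x ?k) = vand r z * (\<Prod>j\<in>{1..r}-{i}. s (z i + h - z j)) / (\<Prod>j\<in>{1..r}-{i}. s (z i - z j))"
    using vand_upd[OF i, of z "z i + h"] nz unfolding shifted_upd z[symmetric] by (simp add: eq_divide_eq)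
  then show ?thesis unfolding root_factor_def den z by simp
qed

text \<open>
  Partial fractions at the points \<open>z\<^sub>i = x\<^sub>i + k\<^sub>i h\<close> replace \<open>t\<close> by \<open>t + h\<close> and split off one unit from one of the
  \<open>k\<^sub>i\<close>; partial fractions at the shifted points then carry out the sum over \<open>i\<close>.
\<close>

lemma kn_sum_Suc:
  fixes h :: complex
  assumes X: "\<And>i j e::int. i \<in> {1..r} \<Longrightarrow> j \<in> {1..r} \<Longrightarrow> i \<noteq> j \<Longrightarrow> \<bar>e\<bar> \<le> int (Suc n) \<Longrightarrow> s (x i - x j + of_int e * h) \<noteq> 0"
    and H: "\<And>e::int. e \<noteq> 0 \<Longrightarrow> s (of_int e * h) \<noteq> 0"
    and T: "\<And>i (e::int). i \<in> {1..r} \<Longrightarrow> s (t + x i + of_int e * h) \<noteq> 0"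
    and G1: "\<And>i (e::int). i \<in> {1..r} \<Longrightarrow> s (g1 + x i + of_int e * h) \<noteq> 0"
    and G2: "\<And>i (e::int). i \<in> {1..r} \<Longrightarrow> s (g2 + x i + of_int e * h) \<noteq> 0"
    and G: "s (g1 - g2) \<noteq> 0"
    and bal: "(\<Sum>j=1..r+1. b j) + t + (\<Sum>i=1..r. x i) = g1 + g2"
  shows "s (of_nat (Suc n) * h) * kn_sum h r x b t g1 g2 (Suc n) =
     ratio r x b g1 * s (g1 - t + of_nat n * h) / s (g1 - g2) * kn_sum h r x b (t + h) (g1 + h) g2 n +
     ratio r x b g2 * s (g2 - t + of_nat n * h) / s (g2 - g1) * kn_sum h r x b (t + h) g1 (g2 + h) n"
proof -
  define m where "m = of_nat (Suc n) * h"
  \<comment> \<open>The weights of \<open>partial_fractions_one_pole\<close> at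
    \<open>z i = x i + k i * h\<close>, where \<open>m\<close> is the total shift
    \<open>(n + 1) h\<close> of the points.\<close>
  define w where "w k i = (let z = shifted h x k in (\<Prod>j=1..r. s (z i - x j)) * s (z i + t - m) /
     ((\<Prod>j\<in>{1..r}-{i}. s (z i - z j)) * s (z i + t)))" for k i
  have Xz: "s (shifted h x k i - shifted h x k j) \<noteq> 0"
    if "i \<in> {1..r}" "j \<in> {1..r}" "i \<noteq> j" "k \<in> compositions r n'" "n' \<le> Suc n" for i j k n'
  proof -
    have "k i \<le> Suc n" "k j \<le> Suc n" using compositions_le[OF that(4)] that by force+
    then have "s (x i - x j + of_int (int (k i) - int (k j)) * h) \<noteq> 0"
      using that by (intro X) auto
    then show ?thesis by (simp add: shifted_def algebra_simps)
  qed
  have Tz: "s (t + shifted h x k i) \<noteq> 0" "s (g1 + shifted h x k i) \<noteq> 0" "s (g2 + shifted h x k i) \<noteq> 0"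
    if "i \<in> {1..r}" for i k
    using T[OF that, of "int (k i)"] G1[OF that, of "int (k i)"] G2[OF that, of "int (k i)"]
    by (simp_all add: shifted_def add.assoc)
  have sumz: "(\<Sum>i=1..r. shifted h x k i) = (\<Sum>i=1..r. x i) + of_nat n' * h" if "k \<in> compositions r n'" for k n'
    using that by (auto simp: shifted_def sum.distrib sum_distrib_right compositions_def weight_def)
  have step1: "s m * kn_term h r x b t g1 g2 k = (\<Sum>i=1..r. kn_term h r x b (t + h) g1 g2 k * w k i)"
    if k: "k \<in> compositions r (Suc n)" for k
  proof -
    let ?z = "shifted h x k"
    have "fac h (t + x i) (k i) = fac h (t + h + x i) (k i) * (s (t + x i) / s (t + ?z i))" if "i \<in> {1..r}" for i
      using fac_shift[of "t + x i" h "k i"] Tz(1)[OF that, of k] by (simp add: field_simps shifted_def)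
    then have "kn_term h r x b t g1 g2 k = root_factor h r x k *
     (\<Prod>i=1..r. (\<Prod>j=1..r+1. fac h (b j + x i) (k i)) * fac h (t + h + x i) (k i) /
      (fac h (g1 + x i) (k i) * fac h (g2 + x i) (k i)) * (s (t + x i) / s (t + ?z i)))"
      unfolding kn_term_def by (intro arg_cong2[of _ _ _ _ "(*)"] prod.cong) (auto simp: mult_ac)
    also have "\<dots> = kn_term h r x b (t + h) g1 g2 k * (\<Prod>j=1..r. s (t + x j) / s (t + ?z j))"
      unfolding kn_term_def prod.distrib by simp
    finally have "s m * kn_term h r x b t g1 g2 k = kn_term h r x b (t + h) g1 g2 k * (s m * (\<Prod>j=1..r. s (t + x j) / s (t + ?z j)))"
      by simp
    also have "s m * (\<Prod>j=1..r. s (t + x j) / s (t + ?z j)) = (\<Sum>i=1..r. w k i)"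
      unfolding w_def Let_def
    proof (rule partial_fractions_one_pole)
      show "(\<Sum>i = 1..r. ?z i - x i) = m"
        using sumz[OF k] by (simp add: sum_subtractf m_def)
    qed (use Xz k Tz in auto)
    finally show ?thesis by (simp add: sum_distrib_left)
  qed
  have step2: "(\<Sum>i=1..r. kn_term h r x b (t + h) g1 g2 (k(i := Suc (k i))) * w (k(i := Suc (k i))) i) =
      ratio r x b g1 * s (g1 - t + of_nat n * h) / s (g1 - g2) * kn_term h r x b (t + h) (g1 + h) g2 k +
      ratio r x b g2 * s (g2 - t + of_nat n * h) / s (g2 - g1) * kn_term h r x b (t + h) g1 (g2 + h) k"
    if k: "k \<in> compositions r n" for k
  proof -
    define z where "z = shifted h x k"
    \<comment> \<open>When \<open>z i\<close> is replaced by \<open>z i + h\<close>, the factor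
      \<open>s (z i + t - m)\<close> becomes \<open>s (u + z i)\<close>. With this \<open>u\<close>
      the balance of the sum becomes that of \<open>partial_fractions_two_poles\<close>.\<close>
    define u where "u = t + h - m"
    have Xzk: "s (z i - z j) \<noteq> 0" if "i \<in> {1..r}" "j \<in> {1..r}" "i \<noteq> j" for i j
      using Xz[OF that k] by (simp add: z_def)
    \<comment> \<open>The new factors \<open>s (z i + h - x j)\<close> and
      \<open>s (z i + h - z j)\<close> of the root factor cancel against those of \<open>w\<close>,
      and so does the new factor \<open>s (t + h + z i)\<close>.\<close>
    have each: "kn_term h r x b (t + h) g1 g2 (k(i := Suc (k i))) * w (k(i := Suc (k i))) i =
       kn_term h r x b (t + h) g1 g2 k * ((\<Prod>j=1..r+1. s (b j + z i)) * s (u + z i) /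
            ((\<Prod>j\<in>{1..r}-{i}. s (z i - z j)) * s (g1 + z i) * s (g2 + z i)))" if i: "i \<in> {1..r}" for i
    proof -
      let ?k = "k(i := Suc (k i))"
      have k': "?k \<in> compositions r (Suc n)"
        using k i weight_upd[of i r k] by (auto simp: compositions_def PiE_def extensional_def)
      have z': "shifted h x ?k = z(i := z i + h)" unfolding z_def by (rule shifted_upd)
      have nzx: "s (z i + h - x j) \<noteq> 0" if "j \<in> {1..r}" for j
      proof (cases "i = j")
        case True
        then show ?thesis using H[of "int (Suc (k i))"] by (simp add: z_def shifted_def algebra_simps)
      next
        case False
        have "k i \<le> n" using compositions_le[OF k i] .
        then show ?thesis using X[OF i that False, of "int (Suc (k i))"] by (simp add: z_def shifted_def algebra_simps)
      qed
      have nzz: "s (z i + h - z j) \<noteq> 0" if "j \<in> {1..r} - {i}" for j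
        using Xz[of i j ?k "Suc n"] i that k' unfolding z' by auto
      have rf: "root_factor h r x ?k = root_factor h r x k * (\<Prod>j\<in>{1..r}-{i}. s (z i + h - z j)) /
        ((\<Prod>j\<in>{1..r}-{i}. s (z i - z j)) * (\<Prod>j=1..r. s (z i + h - x j)))"
        using root_factor_upd[OF i z_def] Xzk nzx i by auto
      define F where "F k l = (\<Prod>j=1..r+1. fac h (b j + x l) (k l)) * fac h (t + h + x l) (k l) /
         (fac h (g1 + x l) (k l) * fac h (g2 + x l) (k l))" for k l
      have "F ?k i = F k i * ((\<Prod>j=1..r+1. s (b j + z i)) * s (t + h + z i) / (s (g1 + z i) * s (g2 + z i)))"
        unfolding F_def by (simp add: fac_Suc z_def shifted_def add.assoc prod.distrib mult_ac)
      moreover have "(\<Prod>l\<in>{1..r}-{i}. F ?k l) = (\<Prod>l\<in>{1..r}-{i}. F k l)"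
        by (rule prod.cong) (auto simp: F_def)
      ultimately have FF: "(\<Prod>l=1..r. F ?k l) = (\<Prod>l=1..r. F k l) * ((\<Prod>j=1..r+1. s (b j + z i)) * s (t + h + z i) / (s (g1 + z i) * s (g2 + z i)))"
        using prod.remove[of "{1..r}" i "F ?k"] prod.remove[of "{1..r}" i "F k"] i by simp
      have "(\<Prod>j\<in>{1..r}-{i}. s (z i + h - (z(i := z i + h)) j)) = (\<Prod>j\<in>{1..r}-{i}. s (z i + h - z j))"
        by (rule prod.cong) auto
      then have ww: "w ?k i = (\<Prod>j=1..r. s (z i + h - x j)) * s (u + z i) /
         ((\<Prod>j\<in>{1..r}-{i}. s (z i + h - z j)) * s (t + h + z i))"
        unfolding w_def Let_def z' u_def by (simp add: algebra_simps)
      have nz: "(\<Prod>j\<in>{1..r}-{i}. s (z i + h - z j)) \<noteq> 0" "(\<Prod>j=1..r. s (z i + h - x j)) \<noteq> 0"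
         "s (t + h + z i) \<noteq> 0"
        using nzz nzx Tz(1)[OF i, of ?k] unfolding z' by (auto simp: add_ac)
      show ?thesis
        unfolding kn_term_def F_def[symmetric] rf FF ww using nz by (simp add: field_simps)
    qed
    have pf1: "(\<Sum>i=1..r. (\<Prod>j=1..r+1. s (b j + z i)) * s (u + z i) /
            ((\<Prod>j\<in>{1..r}-{i}. s (z i - z j)) * s (g1 + z i) * s (g2 + z i))) =
       (\<Prod>j=1..r+1. s (g1 - b j)) * s (g1 - u) / ((\<Prod>j=1..r. s (g1 + z j)) * s (g1 - g2)) +
       (\<Prod>j=1..r+1. s (g2 - b j)) * s (g2 - u) / ((\<Prod>j=1..r. s (g2 + z j)) * s (g2 - g1))"
    proof (rule partial_fractions_two_poles)
      show "(\<Sum>j=1..r+1. b j) + u + (\<Sum>i=1..r. z i) = g1 + g2"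
        using bal sumz[OF k] by (simp add: z_def u_def m_def algebra_simps)
    qed (use Xzk Tz G in \<open>auto simp: z_def\<close>)
    have pf2: "(\<Sum>i=1..r. kn_term h r x b (t + h) g1 g2 (k(i := Suc (k i))) * w (k(i := Suc (k i))) i) =
       kn_term h r x b (t + h) g1 g2 k *
       ((\<Prod>j=1..r+1. s (g1 - b j)) * s (g1 - u) / ((\<Prod>j=1..r. s (g1 + z j)) * s (g1 - g2)) +
       (\<Prod>j=1..r+1. s (g2 - b j)) * s (g2 - u) / ((\<Prod>j=1..r. s (g2 + z j)) * s (g2 - g1)))"
      unfolding pf1[symmetric] sum_distrib_left by (rule sum.cong[OF refl each])
    have u: "g - u = g - t + of_nat n * h" for g by (simp add: u_def m_def algebra_simps)
    \<comment> \<open>Trading \<open>s (g + z i)\<close> for \<open>s (g + x i)\<close> raises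
      \<open>g\<close> by \<open>h\<close> in the factorial; this is the origin of the shifts of
      \<open>g1\<close> and \<open>g2\<close> in the recursion.\<close>
    have sh: "fac h (g + x i) (k i) * s (g + z i) = fac h (g + h + x i) (k i) * s (g + x i)" for g i
      using fac_shift[of "g + x i" h "k i"] by (simp add: z_def shifted_def add_ac mult_ac)
    have dc: "N / (A * B * c) = N / (A' * B * c')" if "A * c = A' * c'" for N A B c A' c' :: complex
    proof -
      have "A * B * c = A * c * B" by simp
      then show ?thesis unfolding that by simp
    qed
    have r1: "kn_term h r x b (t + h) g1 g2 k / (\<Prod>j=1..r. s (g1 + z j)) =
       kn_term h r x b (t + h) (g1 + h) g2 k / (\<Prod>j=1..r. s (g1 + x j))"
      unfolding kn_term_def times_divide_eq_right[symmetric] prod_dividef[symmetric] divide_divide_eq_left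
      by (intro arg_cong2[of _ _ _ _ "(*)"] refl prod.cong dc sh)
    have r2: "kn_term h r x b (t + h) g1 g2 k / (\<Prod>j=1..r. s (g2 + z j)) =
       kn_term h r x b (t + h) g1 (g2 + h) k / (\<Prod>j=1..r. s (g2 + x j))"
      unfolding kn_term_def times_divide_eq_right[symmetric] prod_dividef[symmetric] divide_divide_eq_left
      by (intro arg_cong2[of _ _ _ _ "(*)"] refl prod.cong) (simp only: mult.assoc sh)
    have A: "T * (P * S / (Z * d) + P' * S' / (Z' * d')) = P * S / d * (T / Z) + P' * S' / d' * (T / Z')"
      for T P S Z d P' S' Z' d' :: complex
      by (simp add: algebra_simps)
    show ?thesis
      unfolding pf2 A r1 r2 u ratio_def by (simp add: mult_ac)
  qed
  have "s m * kn_sum h r x b t g1 g2 (Suc n) =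
     (\<Sum>k\<in>compositions r (Suc n). \<Sum>i=1..r. kn_term h r x b (t + h) g1 g2 k * w k i)"
    unfolding kn_sum_def sum_distrib_left using step1 by (rule sum.cong[OF refl])
  also have "\<dots> = (\<Sum>k\<in>compositions r n. \<Sum>i=1..r. kn_term h r x b (t + h) g1 g2 (k(i := Suc (k i))) * w (k(i := Suc (k i))) i)"
  \<comment> \<open>For \<open>k i = 0\<close> the point \<open>z i\<close> equals
    \<open>x i\<close>, so the weight has a zero factor and no unit is taken from an empty
    entry.\<close>
  proof (rule sum_compositions_Suc)
    fix k :: "nat \<Rightarrow> nat" and i assume "i \<in> {1..r}" "k i = 0"
    then have "(\<Prod>j=1..r. s (shifted h x k i - x j)) = 0"
      by (intro prod_zero) (auto simp: shifted_def intro!: bexI[of _ i])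
    then show "kn_term h r x b (t + h) g1 g2 k * w k i = 0" by (auto simp: w_def Let_def)
  qed
  also have "\<dots> = ratio r x b g1 * s (g1 - t + of_nat n * h) / s (g1 - g2) * kn_sum h r x b (t + h) (g1 + h) g2 n +
     ratio r x b g2 * s (g2 - t + of_nat n * h) / s (g2 - g1) * kn_sum h r x b (t + h) g1 (g2 + h) n"
    unfolding kn_sum_def sum_distrib_left sum.distrib[symmetric] using step2 by (rule sum.cong[OF refl])
  finally show ?thesis unfolding m_def .
qed


section \<open>The dual sum of dimension two\<close>

text \<open>The coefficient of the sum of dimension two in the variables \<open>g1\<close> and
  \<open>g2\<close>: the quotient by \<open>s (g1 - g2)\<close> is the Vandermonde ratio of two
  points, and the four factorials below are the denominators of its
  \<open>root_factor\<close>.\<close>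

definition dual_coeff :: "complex \<Rightarrow> complex \<Rightarrow> complex \<Rightarrow> complex \<Rightarrow> nat \<Rightarrow> nat \<Rightarrow> complex" where
  "dual_coeff h t g1 g2 i j =
     fac h (g1 - t) i * fac h (g2 - t) j * s (g1 - g2 + (of_nat i - of_nat j) * h) /
     (s (g1 - g2) * fac h h i * fac h h j * fac h (h + (g1 - g2)) i * fac h (h - (g1 - g2)) j)"

text \<open>What remains of the recursion for \<open>dual_coeff\<close> when common factors are
  removed, with \<open>I = i h\<close>, \<open>J = j h\<close>, \<open>a = g1 - t\<close> and
  \<open>b = g2 - t\<close>. The half sums below bring it to the three-term relation.\<close>

lemma dual_three_term:
  "s (I + J) * s (a - b) * s (a + I - h) * s (b + J - h) =
    s J * s (I + (a - b)) * s (b + (I + J - h)) * s (a - h)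
    - s I * s (J - (a - b)) * s (a + (I + J - h)) * s (b - h)"
proof -
  define X Y U V where "X = (I + J + a - b) / 2" and "Y = (I + J - a + b) / 2"
    and "U = (a + b + I + J - 2 * h) / 2" and "V = (a - b + I - J) / 2"
  have eqs: "X + Y = I + J" "X - Y = a - b" "U + V = a + I - h" "U - V = b + J - h"
    "X + V = I + (a - b)" "X - V = J" "U + Y = b + (I + J - h)" "U - Y = a - h"
    "Y + V = I" "Y - V = J - (a - b)" "X + U = a + (I + J - h)" "X - U = - (b - h)"
    by (simp_all add: X_def Y_def U_def V_def field_simps)
  show ?thesis
    using weierstrass[of X Y U V] unfolding eqs odd by (simp add: algebra_simps)
qed

lemma fac_mult_last: "n > 0 \<Longrightarrow> fac h z n = fac h z (n - 1) * s (z + of_nat n * h - h)"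
  by (cases n) (simp_all add: fac_Suc algebra_simps)

lemma fac_mult_first: "n > 0 \<Longrightarrow> fac h z n = s z * fac h (z + h) (n - 1)"
  by (cases n) (simp_all add: fac_Suc_shift)

lemma dual_coeff_swap: "dual_coeff h t g2 g1 j i = dual_coeff h t g1 g2 i j"
proof -
  have "s (g2 - g1 + (of_nat j - of_nat i) * h) = - s (g1 - g2 + (of_nat i - of_nat j) * h)"
    using odd[of "g1 - g2 + (of_nat i - of_nat j) * h"] by (simp add: algebra_simps)
  moreover have "s (g2 - g1) = - s (g1 - g2)" by (rule odd_diff)
  ultimately show ?thesis
    by (simp add: dual_coeff_def mult_ac add_diff_eq diff_diff_eq2)
qed

text \<open>The shift leaves \<open>g1 - t\<close> and \<open>g1 - g2 + (i - j) h\<close> fixed,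
  lowers \<open>g2 - t\<close> by \<open>h\<close> and raises \<open>g1 - g2\<close> by
  \<open>h\<close>, so each factorial changes by end factors only.\<close>

lemma dual_coeff_step:
  assumes H: "\<And>e::int. e \<noteq> 0 \<Longrightarrow> s (of_int e * h) \<noteq> 0"
    and G: "\<And>e::int. s (g1 - g2 + of_int e * h) \<noteq> 0"
    and A: "\<And>e::int. s (g1 - t + of_int e * h) \<noteq> 0" and B: "\<And>e::int. s (g2 - t + of_int e * h) \<noteq> 0"
    and i: "i > 0"
  shows "dual_coeff h (t + h) (g1 + h) g2 (i - 1) j =
    - dual_coeff h t g1 g2 i j * (s (of_nat i * h) * s (of_nat j * h - (g1 - g2)) * s (g2 - t - h)) /
      (s (g1 - t + of_nat i * h - h) * s (g2 - t + of_nat j * h - h))"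
proof -
  define a b g I J where "a = g1 - t" and "b = g2 - t" and "g = g1 - g2" and "I = of_nat i * h" and "J = of_nat j * h"
  have nz: "s (a + I - h) \<noteq> 0" "s (b + J - h) \<noteq> 0" "s I \<noteq> 0" "s (J - g) \<noteq> 0" "s g \<noteq> 0" "s (- g) \<noteq> 0"
    using A[of "int i - 1"] B[of "int j - 1"] H[of "int i"] G[of "- int j"] G[of 0] i odd_diff[of g J] odd[of g]
    by (simp_all add: a_def b_def g_def I_def J_def algebra_simps)
  have f: "fac h a i = fac h a (i - 1) * s (a + I - h)"
     "fac h h i = fac h h (i - 1) * s I"
     "fac h (h + g) i = s (h + g) * fac h (h + g + h) (i - 1)"
    using fac_mult_last[OF i, of h a] fac_mult_last[OF i, of h h] fac_mult_first[OF i, of h "h + g"]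
    by (simp_all add: I_def)
  have f2: "fac h (b - h) j = s (b - h) * fac h b j / s (b + J - h)"
    using fac_shift[of "b - h" h j] nz by (simp add: eq_divide_eq J_def algebra_simps)
  have f3: "fac h (- g) j = s (- g) * fac h (h - g) j / s (J - g)"
    using fac_shift[of "- g" h j] nz by (simp add: eq_divide_eq J_def algebra_simps)
  have nf: "fac h (h - g) j \<noteq> 0"
  proof -
    have "s (h - g + of_nat l * h) \<noteq> 0" for l
      using G[of "- int l - 1"] odd_diff[of "h + of_nat l * h" g] by (simp add: g_def algebra_simps)
    then show ?thesis by (simp add: fac_def)
  qed
  have e: "g1 + h - (t + h) = a" "g2 - (t + h) = b - h" "g1 + h - g2 = g + h" "h + (g + h) = h + g + h"
      "h - (g + h) = - g" "g + h + (of_nat (i - 1) - of_nat j) * h = g + (of_nat i - of_nat j) * h"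
    using i by (simp_all add: a_def b_def g_def algebra_simps of_nat_diff)
  show ?thesis
    unfolding dual_coeff_def e a_def[symmetric] b_def[symmetric] g_def[symmetric] I_def[symmetric] J_def[symmetric] f f2 f3
    using nz nf by (simp add: odd add.commute divide_simps)
qed

text \<open>This is the recursion of \<open>kn_sum_Suc\<close> stripped of the ratios. Both
  neighbours are multiples of \<open>dual_coeff h t g1 g2 i j\<close>, which leaves
  \<open>dual_three_term\<close>; for \<open>i = 0\<close> or \<open>j = 0\<close> the omitted
  neighbour would carry the zero factor \<open>s I\<close> or \<open>s J\<close>.\<close>

lemma dual_coeff_rec:
  assumes H: "\<And>e::int. e \<noteq> 0 \<Longrightarrow> s (of_int e * h) \<noteq> 0"
    and G: "\<And>e::int. s (g1 - g2 + of_int e * h) \<noteq> 0"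
    and A: "\<And>e::int. s (g1 - t + of_int e * h) \<noteq> 0" and B: "\<And>e::int. s (g2 - t + of_int e * h) \<noteq> 0"
    and n: "i + j = Suc n"
  shows "s (of_nat (Suc n) * h) * dual_coeff h t g1 g2 i j =
    (if i = 0 then 0 else s (g1 - t + of_nat n * h) / s (g1 - g2) * dual_coeff h (t + h) (g1 + h) g2 (i - 1) j) +
    (if j = 0 then 0 else s (g2 - t + of_nat n * h) / s (g2 - g1) * dual_coeff h (t + h) g1 (g2 + h) i (j - 1))"
proof -
  define a b g I J where "a = g1 - t" and "b = g2 - t" and "g = g1 - g2" and "I = of_nat i * h" and "J = of_nat j * h"
  define D where "D = dual_coeff h t g1 g2 i j"
  have g: "g = a - b" by (simp add: a_def b_def g_def)
  have nz: "s (a + I - h) \<noteq> 0" "s (b + J - h) \<noteq> 0" "s g \<noteq> 0"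
    using A[of "int i - 1"] B[of "int j - 1"] G[of 0]
    by (simp_all add: a_def b_def g_def I_def J_def algebra_simps)
  have nh: "of_nat n * h = I + J - h" "of_nat (Suc n) * h = I + J"
    using arg_cong[OF n, of "\<lambda>k. of_nat k * h"] by (simp_all add: I_def J_def algebra_simps)
  have gg: "s (g2 - g1) = - s g" unfolding g_def by (rule odd_diff)
  have G': "s (g2 - g1 + of_int e * h) \<noteq> 0" for e :: int
    using G[of "- e"] odd[of "g1 - g2 + of_int (- e) * h"] by (simp add: algebra_simps)
  have t1: "(if i = 0 then 0 else s (g1 - t + of_nat n * h) / s (g1 - g2) * dual_coeff h (t + h) (g1 + h) g2 (i - 1) j)
     = s (a + (I + J - h)) / s g * (- D * (s I * s (J - g) * s (b - h)) / (s (a + I - h) * s (b + J - h)))"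
    using dual_coeff_step[OF H G A B, of i j]
    by (cases "i = 0") (simp_all add: nh a_def b_def g_def D_def I_def J_def)
  have t2: "(if j = 0 then 0 else s (g2 - t + of_nat n * h) / s (g2 - g1) * dual_coeff h (t + h) g1 (g2 + h) i (j - 1))
     = s (b + (I + J - h)) / - s g * (- D * (s J * s (I + g) * s (a - h)) / (s (a + I - h) * s (b + J - h)))"
    using dual_coeff_step[OF H G' B A, of j i]
    unfolding gg nh dual_coeff_swap[of h "t + h" "g2 + h" g1 "j - 1" i] dual_coeff_swap[of h t g2 g1 j i]
      D_def[symmetric] I_def[symmetric] J_def[symmetric] a_def[symmetric] b_def[symmetric]
    by (cases "j = 0") (simp_all add: g_def J_def mult.commute diff_diff_eq2 add_diff_eq flip: b_def)
  have "s (I + J) * s g * s (a + I - h) * s (b + J - h) =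
    s J * s (I + g) * s (b + (I + J - h)) * s (a - h) - s I * s (J - g) * s (a + (I + J - h)) * s (b - h)"
    unfolding g by (rule dual_three_term)
  from arg_cong[OF this, of "(*) D"] show ?thesis
    unfolding t1 t2 unfolding nh D_def[symmetric] using nz by (simp add: field_simps)
qed

text \<open>Both sides obey the same recursion, and the induction generalises the parameters
  \<open>t\<close>, \<open>g1\<close>, \<open>g2\<close> that it shifts. Their nonvanishing
  conditions range over all integer translates and so survive the shift; the condition on
  \<open>x i - x j\<close> has the fixed bound \<open>N\<close>.\<close>

lemma kn_sum_eq:
  fixes h :: complex
  assumes X: "\<And>i j e::int. i \<in> {1..r} \<Longrightarrow> j \<in> {1..r} \<Longrightarrow> i \<noteq> j \<Longrightarrow> \<bar>e\<bar> \<le> int N \<Longrightarrow> s (x i - x j + of_int e * h) \<noteq> 0"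
    and H: "\<And>e::int. e \<noteq> 0 \<Longrightarrow> s (of_int e * h) \<noteq> 0"
    and T: "\<And>i (e::int). i \<in> {1..r} \<Longrightarrow> s (t + x i + of_int e * h) \<noteq> 0"
    and G1: "\<And>i (e::int). i \<in> {1..r} \<Longrightarrow> s (g1 + x i + of_int e * h) \<noteq> 0"
    and G2: "\<And>i (e::int). i \<in> {1..r} \<Longrightarrow> s (g2 + x i + of_int e * h) \<noteq> 0"
    and G: "\<And>e::int. s (g1 - g2 + of_int e * h) \<noteq> 0"
    and A: "\<And>e::int. s (g1 - t + of_int e * h) \<noteq> 0" and B: "\<And>e::int. s (g2 - t + of_int e * h) \<noteq> 0"
    and bal: "(\<Sum>j=1..r+1. b j) + t + (\<Sum>i=1..r. x i) = g1 + g2"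
    and n: "n \<le> N"
  shows "kn_sum h r x b t g1 g2 n = (\<Sum>i\<le>n. (\<Prod>l<i. ratio r x b (g1 + of_nat l * h)) *
     (\<Prod>l<n-i. ratio r x b (g2 + of_nat l * h)) * dual_coeff h t g1 g2 i (n - i))"
  using T G1 G2 G A B bal n
proof (induction n arbitrary: t g1 g2)
  case 0
  define k0 :: "nat \<Rightarrow> nat" where "k0 i = (if i \<in> {1..r} then 0 else undefined)" for i
  have "compositions r 0 = {k0}"
    by (auto simp: compositions_def weight_def PiE_def extensional_def fun_eq_iff k0_def)
  moreover have k0: "k0 i = 0" if "i \<in> {1..r}" for i
    using that by (simp add: k0_def)
  moreover have "vand r x \<noteq> 0"
    using X[of _ _ 0] by (auto simp: vand_def)
  moreover have "s (g1 - g2) \<noteq> 0" using "0.prems"(4)[of 0] by simp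
  moreover have "vand r (shifted h x k0) = vand r x"
    unfolding vand_def by (intro prod.cong refl) (auto simp: shifted_def k0)
  moreover have "(\<Prod>i=1..r. \<Prod>j=1..r. fac h (h + x i - x j) (k0 i)) = 1"
    by (intro prod.neutral ballI) (simp add: k0)
  moreover have "(\<Prod>i=1..r. (\<Prod>j=1..r+1. fac h (b j + x i) (k0 i)) * fac h (t + x i) (k0 i) /
      (fac h (g1 + x i) (k0 i) * fac h (g2 + x i) (k0 i))) = 1"
    by (intro prod.neutral ballI) (simp add: k0)
  ultimately show ?case
    unfolding kn_sum_def kn_term_def root_factor_def by (simp add: dual_coeff_def)
next
  case (Suc n)
  let ?R = "ratio r x b"
  note prems = Suc.prems
  have sh: "g + h + y + of_int e * h = g + y + of_int (e + 1) * h" "g + h - y + of_int e * h = g - y + of_int (e + 1) * h"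
      "y - (g + h) + of_int e * h = y - g + of_int (e - 1) * h"
      "g + h - (y + h) = g - y" for g y and e :: int
    by (simp_all add: algebra_simps)
  have IH1: "kn_sum h r x b (t + h) (g1 + h) g2 n = (\<Sum>i\<le>n. (\<Prod>l<i. ?R (g1 + h + of_nat l * h)) *
     (\<Prod>l<n-i. ?R (g2 + of_nat l * h)) * dual_coeff h (t + h) (g1 + h) g2 i (n - i))"
  proof (rule Suc.IH)
    show "(\<Sum>j=1..r+1. b j) + (t + h) + (\<Sum>i=1..r. x i) = g1 + h + g2" using prems(7) by (simp add: algebra_simps)
  qed (use prems in \<open>simp_all only: sh, auto\<close>)
  have IH2: "kn_sum h r x b (t + h) g1 (g2 + h) n = (\<Sum>i\<le>n. (\<Prod>l<i. ?R (g1 + of_nat l * h)) *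
     (\<Prod>l<n-i. ?R (g2 + h + of_nat l * h)) * dual_coeff h (t + h) g1 (g2 + h) i (n - i))"
  proof (rule Suc.IH)
    show "(\<Sum>j=1..r+1. b j) + (t + h) + (\<Sum>i=1..r. x i) = g1 + (g2 + h)" using prems(7) by (simp add: algebra_simps)
  qed (use prems in \<open>simp_all only: sh, auto\<close>)
  define c1 where "c1 = s (g1 - t + of_nat n * h) / s (g1 - g2)"
  define c2 where "c2 = s (g2 - t + of_nat n * h) / s (g2 - g1)"
  define Q where "Q i j = (\<Prod>l<i. ?R (g1 + of_nat l * h)) * (\<Prod>l<j. ?R (g2 + of_nat l * h))" for i j
  define m where "m = s (of_nat (Suc n) * h)"
  have m: "m \<noteq> 0" using H[of "int (Suc n)"] unfolding m_def by simp
  \<comment> \<open>The coefficient \<open>?R g1\<close> of the recursion is the factor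
    \<open>l = 0\<close> that the product shifted by \<open>h\<close> lacks.\<close>
  have Q1: "?R g1 * ((\<Prod>l<i. ?R (g1 + h + of_nat l * h)) * (\<Prod>l<j. ?R (g2 + of_nat l * h))) = Q (Suc i) j" for i j
    unfolding Q_def by (simp add: prod.lessThan_Suc_shift algebra_simps del: prod.lessThan_Suc)
  have Q2: "?R g2 * ((\<Prod>l<i. ?R (g1 + of_nat l * h)) * (\<Prod>l<j. ?R (g2 + h + of_nat l * h))) = Q i (Suc j)" for i j
    unfolding Q_def by (simp add: prod.lessThan_Suc_shift algebra_simps del: prod.lessThan_Suc)
  have "m * (\<Sum>i\<le>Suc n. Q i (Suc n - i) * dual_coeff h t g1 g2 i (Suc n - i)) =
     (\<Sum>i\<le>Suc n. (if i = 0 then 0 else c1 * (Q i (Suc n - i) * dual_coeff h (t + h) (g1 + h) g2 (i - 1) (Suc n - i))) +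
        (if Suc n - i = 0 then 0 else c2 * (Q i (Suc n - i) * dual_coeff h (t + h) g1 (g2 + h) i (Suc n - i - 1))))"
    unfolding sum_distrib_left
  proof (rule sum.cong[OF refl])
    fix i assume "i \<in> {..Suc n}"
    then have ij: "i + (Suc n - i) = Suc n" by simp
    have d: "m * dual_coeff h t g1 g2 i (Suc n - i) =
      (if i = 0 then 0 else c1 * dual_coeff h (t + h) (g1 + h) g2 (i - 1) (Suc n - i)) +
      (if Suc n - i = 0 then 0 else c2 * dual_coeff h (t + h) g1 (g2 + h) i (Suc n - i - 1))"
      unfolding m_def c1_def c2_def by (rule dual_coeff_rec[OF H _ _ _ ij]) (use prems in auto)
    have "m * (Q i (Suc n - i) * dual_coeff h t g1 g2 i (Suc n - i)) = Q i (Suc n - i) * (m * dual_coeff h t g1 g2 i (Suc n - i))"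
      by simp
    then show "m * (Q i (Suc n - i) * dual_coeff h t g1 g2 i (Suc n - i)) =
      (if i = 0 then 0 else c1 * (Q i (Suc n - i) * dual_coeff h (t + h) (g1 + h) g2 (i - 1) (Suc n - i))) +
        (if Suc n - i = 0 then 0 else c2 * (Q i (Suc n - i) * dual_coeff h (t + h) g1 (g2 + h) i (Suc n - i - 1)))"
      unfolding d by (auto simp: algebra_simps)
  qed
  also have "\<dots> = (\<Sum>i\<le>n. c1 * (Q (Suc i) (n - i) * dual_coeff h (t + h) (g1 + h) g2 i (n - i))) +
     (\<Sum>i\<le>n. c2 * (Q i (Suc (n - i)) * dual_coeff h (t + h) g1 (g2 + h) i (n - i)))"
    unfolding sum.distrib
  proof (rule arg_cong2[of _ _ _ _ "(+)"])
    show "(\<Sum>i\<le>Suc n. if i = 0 then 0 else c1 * (Q i (Suc n - i) * dual_coeff h (t + h) (g1 + h) g2 (i - 1) (Suc n - i))) =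
       (\<Sum>i\<le>n. c1 * (Q (Suc i) (n - i) * dual_coeff h (t + h) (g1 + h) g2 i (n - i)))"
      by (subst sum.atMost_Suc_shift) simp
    show "(\<Sum>i\<le>Suc n. if Suc n - i = 0 then 0 else c2 * (Q i (Suc n - i) * dual_coeff h (t + h) g1 (g2 + h) i (Suc n - i - 1))) =
       (\<Sum>i\<le>n. c2 * (Q i (Suc (n - i)) * dual_coeff h (t + h) g1 (g2 + h) i (n - i)))"
      by (subst sum.atMost_Suc) (auto intro!: sum.cong simp: Suc_diff_le)
  qed
  also have "\<dots> = ?R g1 * c1 * kn_sum h r x b (t + h) (g1 + h) g2 n + ?R g2 * c2 * kn_sum h r x b (t + h) g1 (g2 + h) n"
    unfolding IH1 IH2 sum_distrib_left Q1[symmetric] Q2[symmetric] by (simp add: mult_ac)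
  also have "\<dots> = m * kn_sum h r x b t g1 g2 (Suc n)"
    unfolding m_def
  proof (subst kn_sum_Suc)
    show "s (g1 - g2) \<noteq> 0" using prems(4)[of 0] by simp
  qed (use X H prems in \<open>auto simp: c1_def c2_def\<close>)
  finally show ?case using m unfolding Q_def by simp
qed

end

section \<open>Inversion of the quadratic kernel\<close>

text \<open>The product of \<open>F j / F (1 - j)\<close> over \<open>0 < j \<le> N\<close> with
  \<open>j\<close> of the parity of \<open>N\<close>. In both cases the right-hand side of the
  theorem is such a product for \<open>s\<close> at \<open>a\<close> times one for the parameter
  ratio at \<open>a - c\<close>.\<close>

fun alt_ratio :: "(int \<Rightarrow> complex) \<Rightarrow> nat \<Rightarrow> complex" where
  "alt_ratio F 0 = 1"
| "alt_ratio F (Suc 0) = F 1 / F 0"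
| "alt_ratio F (Suc (Suc n)) = alt_ratio F n * F (int n + 2) / F (- 1 - int n)"

definition idx :: "nat \<Rightarrow> nat \<Rightarrow> nat" where
  "idx n d = (if even (n - d) then (n - d) div 2 else (n + d + 1) div 2)"

text \<open>
  The index \<open>i = idx n d\<close> is the solution of \<open>|2 (n - 2 i) + 1| = 2 d + 1\<close> in \<open>{0..n}\<close>.
\<close>

lemma idx_even: "idx (2 * i + d) d = i"
  by (simp add: idx_def)

lemma idx_odd: "idx (2 * j + d + 1) d = j + d + 1"
  by (simp add: idx_def)

lemma idx_cases:
  fixes n d :: nat
  assumes "d \<le> n"
  obtains (even) i where "n = 2 * i + d" | (odd) j where "n = 2 * j + d + 1"
proof -
  have "n = 2 * ((n - d) div 2) + d \<or> n = 2 * ((n - d) div 2) + d + 1"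
    using assms by presburger
  then show ?thesis using that by blast
qed

lemma sum_idx:
  fixes f :: "nat \<Rightarrow> complex"
  shows "(\<Sum>i\<le>n. f i) = (\<Sum>d\<le>n. f (idx n d))"
proof (rule sum.reindex_bij_witness[where i = "idx n" and j = "\<lambda>i. if 2 * i \<le> n then n - 2 * i else 2 * i - n - 1"])
  fix d assume "d \<in> {..n}"
  then have "d \<le> n" by simp
  then show "(if 2 * idx n d \<le> n then n - 2 * idx n d else 2 * idx n d - n - 1) = d" "idx n d \<in> {..n}"
    by (cases rule: idx_cases; simp add: idx_even idx_odd[simplified])+
next
  fix i assume "i \<in> {..n}"
  then have i: "i \<le> n" by simp
  show inv: "idx n (if 2 * i \<le> n then n - 2 * i else 2 * i - n - 1) = i"
  proof (cases "2 * i \<le> n")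
    case True
    then show ?thesis using idx_even[of i "n - 2 * i"] by simp
  next
    case False
    then have "n = 2 * (n - i) + (2 * i - n - 1) + 1" using i by simp
    then have "idx n (2 * i - n - 1) = n - i + (2 * i - n - 1) + 1" using idx_odd by metis
    then show ?thesis using False i by simp
  qed
  show "(if 2 * i \<le> n then n - 2 * i else 2 * i - n - 1) \<in> {..n}"
    using i by auto
  show "f (idx n (if 2 * i \<le> n then n - 2 * i else 2 * i - n - 1)) = f i"
    unfolding inv ..
qed

text \<open>The dual term of index \<open>i\<close>, together with the factors of the summand that
  depend on \<open>n\<close> alone and not on \<open>N\<close>, is sorted into \<open>P_part\<close>
  (parameter ratios), \<open>A_part\<close> (arguments containing \<open>a\<close>) and
  \<open>E_part\<close> (multiples of the step).\<close>

definition P_part :: "(int \<Rightarrow> complex) \<Rightarrow> nat \<Rightarrow> nat \<Rightarrow> complex" where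
  "P_part P n i = (\<Prod>l<i. P (1 - int n + 2 * int l)) * (\<Prod>l<n-i. P (2 - int n + 2 * int l)) / (\<Prod>l<n. P (- int l))"

definition A_part :: "(int \<Rightarrow> complex) \<Rightarrow> nat \<Rightarrow> nat \<Rightarrow> complex" where
  "A_part A n i = (\<Prod>l<n. A (int l)) * ((\<Prod>l<i. A (int n - 1 + 2 * int l)) * (\<Prod>l<n-i. A (int n + 2 * int l)))"

definition E_part :: "(int \<Rightarrow> complex) \<Rightarrow> nat \<Rightarrow> nat \<Rightarrow> complex" where
  "E_part E n i = E (2 * (int n - 2 * int i) + 1) / ((\<Prod>l<2*i. E (1 + int l)) * (\<Prod>l<2*(n-i)+1. E (1 + int l)))"

definition quad_kernel :: "(int \<Rightarrow> complex) \<Rightarrow> (int \<Rightarrow> complex) \<Rightarrow> nat \<Rightarrow> nat \<Rightarrow> complex" where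
  "quad_kernel A E N n = (\<Prod>l<n. E (int l - int N) * E (int N + 1 + int l) / (A (int N + 2 + 2 * int l) * A (1 - int N + 2 * int l)))"

text \<open>The numerator arguments are \<open>2 - d, 4 - d, ..., d\<close> and the denominator
  arguments \<open>0, -1, ..., 1 - d\<close>. The nonpositive numerators cancel and leave the
  denominator \<open>1 - d, 3 - d, ...\<close> of \<open>alt_ratio\<close>.\<close>

lemma alt_ratio_prod:
  assumes P: "\<And>e. P e \<noteq> 0"
  shows "alt_ratio P d = (\<Prod>l<d. P (2 - int d + 2 * int l)) / (\<Prod>l<d. P (- int l))"
  using P
proof (induction P d rule: alt_ratio.induct)
  case (3 P d)
  have "(\<Prod>l<Suc (Suc d). P (2 - int (Suc (Suc d)) + 2 * int l)) =
      P (- int d) * ((\<Prod>l<d. P (2 - int d + 2 * int l)) * P (int d + 2))"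
    by (subst prod.lessThan_Suc_shift) (simp add: algebra_simps)
  with 3 show ?case using P[of "- int d"] by (simp add: field_simps)
qed auto

text \<open>Raising \<open>i\<close> by one at fixed \<open>d\<close> raises \<open>n\<close> by two
  and adds \<open>P (- n)\<close> and \<open>P (- 1 - n)\<close>, with the old \<open>n\<close>,
  above and below; so the value at \<open>i = 0\<close> persists.\<close>

lemma P_part_even:
  assumes P: "\<And>e. P e \<noteq> 0"
  shows "P_part P (2 * i + d) i = alt_ratio P d"
proof (induction i)
  case 0
  then show ?case using alt_ratio_prod[of P d] P by (simp add: P_part_def)
next
  case (Suc i)
  have "(\<Prod>l<Suc i. P (1 - int (2 * Suc i + d) + 2 * int l)) = P (- 1 - int (2 * i + d)) * (\<Prod>l<i. P (1 - int (2 * i + d) + 2 * int l))"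
    by (subst prod.lessThan_Suc_shift) (simp add: algebra_simps)
  moreover have "(\<Prod>l<Suc (i + d). P (2 - int (2 * Suc i + d) + 2 * int l)) = P (- int (2 * i + d)) * (\<Prod>l<i+d. P (2 - int (2 * i + d) + 2 * int l))"
    by (subst prod.lessThan_Suc_shift) (simp add: algebra_simps)
  moreover have "2 * Suc i + d - Suc i = Suc (i + d)" "2 * i + d - i = i + d" "2 * Suc i + d = Suc (Suc (2 * i + d))" by auto
  ultimately show ?case using Suc P unfolding P_part_def
    by (simp add: algebra_simps)
qed

text \<open>Compared with \<open>n = 2 * j + d\<close> and index \<open>j\<close>, the two
  progressions exchange their roles up to one new factor, which the denominator cancels.\<close>

lemma P_part_odd:
  assumes P: "\<And>e. P e \<noteq> 0"
  shows "P_part P (2 * j + d + 1) (j + d + 1) = alt_ratio P d"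
proof -
  have "(\<Prod>l<Suc (j + d). P (1 - int (2 * j + d + 1) + 2 * int l)) = P (- int (2 * j + d)) * (\<Prod>l<j+d. P (2 - int (2 * j + d) + 2 * int l))"
    by (subst prod.lessThan_Suc_shift) (simp add: algebra_simps)
  moreover have "(\<Prod>l<j. P (2 - int (2 * j + d + 1) + 2 * int l)) = (\<Prod>l<j. P (1 - int (2 * j + d) + 2 * int l))"
    by (simp add: algebra_simps)
  moreover have "2 * j + d + 1 - (j + d + 1) = j" "2 * j + d - j = j + d" by auto
  ultimately have "P_part P (2 * j + d + 1) (j + d + 1) = P_part P (2 * j + d) j"
    using P unfolding P_part_def by (simp add: algebra_simps)
  then show ?thesis using P_part_even[OF P] by simp
qed

lemma P_part_idx:
  assumes P: "\<And>e. P e \<noteq> 0" and "d \<le> n"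
  shows "P_part P n (idx n d) = alt_ratio P d"
  using assms(2)
proof (cases rule: idx_cases)
  case (even i)
  then show ?thesis using P_part_even[of P, OF P] by (simp add: idx_even)
next
  case (odd j)
  then show ?thesis using P_part_odd[of P, OF P] unfolding odd idx_odd by simp
qed

text \<open>If \<open>n - d\<close> is even, then \<open>2 i = n - d\<close> and
  \<open>2 (n - i) + 1 = n + d + 1\<close>. Otherwise these two lengths are exchanged and the
  argument of the numerator changes sign, whence \<open>(- 1) ^ (n - d)\<close>.\<close>

lemma E_part_idx:
  assumes E: "\<And>e. E (- e) = - E e" and "d \<le> n"
  shows "E_part E n (idx n d) = (- 1) ^ (n - d) * E (2 * int d + 1) / ((\<Prod>l<n-d. E (1 + int l)) * (\<Prod>l<n+d+1. E (1 + int l)))"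
  using assms(2)
proof (cases rule: idx_cases)
  case (even i)
  have "2 * (int n - 2 * int i) + 1 = 2 * int d + 1" "2 * i = n - d" "2 * (n - i) + 1 = n + d + 1" "even (n - d)"
    using even by auto
  moreover have "idx n d = i" unfolding even by (rule idx_even)
  ultimately show ?thesis unfolding E_part_def by simp
next
  case (odd j)
  have e: "2 * (int n - 2 * int (j + d + 1)) + 1 = - (2 * int d + 1)"
    "2 * (j + d + 1) = n + d + 1" "2 * (n - (j + d + 1)) + 1 = n - d"
    using odd by auto
  have s: "(- 1 :: complex) ^ (n - d) = - 1" using odd by simp
  have i: "idx n d = j + d + 1" unfolding odd by (rule idx_odd)
  show ?thesis unfolding E_part_def i e s E by (simp add: mult.commute del: prod.lessThan_Suc)
qed

text \<open>For fixed \<open>d\<close> the two cases of \<open>idx\<close> alternate as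
  \<open>n\<close> grows, and the progressions exchange their roles; still both cases gain the same
  factors. This uniformity is what permits a telescoping sum over \<open>n\<close>.\<close>

lemma A_part_rec:
  assumes "d \<le> n"
  shows "A_part A (Suc n) (idx (Suc n) d) * A (int n - 1) =
    A_part A n (idx n d) * A (int n) * A (2 * int n + int d) * A (2 * int n - int d - 1)"
proof -
  have arith: "L * a * (X1 * X2) * a1 = L * (Y1 * Y2) * a * w * y" if "X2 * a1 = Y1 * y" "X1 = Y2 * w"
    for L a X1 X2 a1 Y1 Y2 y w :: complex
  proof -
    have "L * a * (X1 * X2) * a1 = L * a * X1 * (X2 * a1)" by simp
    then show ?thesis unfolding that by simp
  qed
  from assms show ?thesis
  proof (cases rule: idx_cases)
    case (even i)
    have i: "idx n d = i" "n - i = i + d" unfolding even by (simp_all add: idx_even)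
    have i': "idx (Suc n) d = i + d + 1" "Suc n - (i + d + 1) = i" using idx_odd[of i d] even by simp_all
    have "(\<Prod>l<i. A (int (Suc n) + 2 * int l)) * A (int n - 1) = (\<Prod>l<Suc i. A (int n - 1 + 2 * int l))"
      by (subst prod.lessThan_Suc_shift) (simp add: algebra_simps)
    also have "\<dots> = (\<Prod>l<i. A (int n - 1 + 2 * int l)) * A (2 * int n - int d - 1)"
      using even by (simp add: algebra_simps)
    finally have 1: "(\<Prod>l<i. A (int (Suc n) + 2 * int l)) * A (int n - 1) = (\<Prod>l<i. A (int n - 1 + 2 * int l)) * A (2 * int n - int d - 1)" .
    have "(\<Prod>l<i+d+1. A (int (Suc n) - 1 + 2 * int l)) = (\<Prod>l<i+d. A (int n + 2 * int l)) * A (2 * int n + int d)"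
      using even by (simp add: algebra_simps)
    from arith[OF 1 this] show ?thesis
      unfolding A_part_def i i' prod.lessThan_Suc[of _ n] .
  next
    case (odd j)
    have i: "idx n d = j + d + 1" "n - (j + d + 1) = j" using odd idx_odd[of j d] by simp_all
    have i': "idx (Suc n) d = j + 1" "Suc n - (j + 1) = j + d + 1" using idx_even[of "j + 1" d] odd by simp_all
    have "(\<Prod>l<j+d+1. A (int (Suc n) + 2 * int l)) * A (int n - 1) = (\<Prod>l<Suc (j+d+1). A (int n - 1 + 2 * int l))"
      by (subst prod.lessThan_Suc_shift) (simp add: algebra_simps)
    also have "\<dots> = (\<Prod>l<j+d+1. A (int n - 1 + 2 * int l)) * A (2 * int n + int d)"
      using odd by (simp add: algebra_simps)
    finally have 1: "(\<Prod>l<j+d+1. A (int (Suc n) + 2 * int l)) * A (int n - 1) = (\<Prod>l<j+d+1. A (int n - 1 + 2 * int l)) * A (2 * int n + int d)" .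
    have "(\<Prod>l<j+1. A (int (Suc n) - 1 + 2 * int l)) = (\<Prod>l<j. A (int n + 2 * int l)) * A (2 * int n - int d - 1)"
      using odd by (simp add: algebra_simps)
    from arith[OF 1 this, of "\<Prod>l<n. A (int l)" "A (int n)"] show ?thesis
      unfolding A_part_def i i' prod.lessThan_Suc[of _ n] by (simp only: mult_ac)
  qed
qed

section \<open>Orthogonality by telescoping\<close>

text \<open>Up to a factor free of \<open>n\<close>, the coefficient of \<open>alt_ratio P d\<close>
  in the term of index \<open>n\<close> of the outer sum.\<close>

definition tele :: "(int \<Rightarrow> complex) \<Rightarrow> (int \<Rightarrow> complex) \<Rightarrow> nat \<Rightarrow> nat \<Rightarrow> nat \<Rightarrow> complex" where
  "tele A E N d n = A (3 * int n) * A_part A n (idx n d) * quad_kernel A E N n /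
     ((\<Prod>l<n-d. E (1 + int l)) * (\<Prod>l<n+d+1. E (1 + int l)))"

text \<open>The three-term relation splits 1 as \<open>F1 / F2 - F3 / F2\<close>, and the ratio of
  consecutive terms turns the first part at \<open>m\<close> into the second part at
  \<open>m + 1\<close>. The lower end vanishes because \<open>F3 d\<close> contains
  \<open>E 0\<close>, the upper end because \<open>F1 N\<close> does.\<close>

lemma tele_sum:
  fixes N d :: nat
  assumes A: "\<And>e. A e \<noteq> 0" and E: "\<And>e. e \<noteq> 0 \<Longrightarrow> E e \<noteq> 0" "E 0 = 0"
    and id: "\<And>m N d :: int. E (m - N) * E (m + N + 1) * A (2 * m + d) * A (2 * m - d - 1)
       - E (m - d) * E (m + d + 1) * A (2 * m + N) * A (2 * m - 1 - N) = - (E (N - d) * E (N + d + 1) * A (3 * m) * A (m - 1))"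
    and d: "d < N"
  shows "(\<Sum>n=d..N. tele A E N d n) = 0"
proof -
  define F1 where "F1 m = E (int m - int N) * E (int m + int N + 1) * A (2 * int m + int d) * A (2 * int m - int d - 1)" for m
  define F2 where "F2 m = - (E (int N - int d) * E (int N + int d + 1) * A (3 * int m) * A (int m - 1))" for m
  define F3 where "F3 m = E (int m - int d) * E (int m + int d + 1) * A (2 * int m + int N) * A (2 * int m - 1 - int N)" for m
  have F: "F1 m - F3 m = F2 m" for m unfolding F1_def F2_def F3_def by (rule id)
  have F2: "F2 m \<noteq> 0" for m using d A E(1) by (auto simp: F2_def)
  have tstep: "tele A E N d m * (F1 m / F2 m) = tele A E N d (Suc m) * (F3 (Suc m) / F2 (Suc m))" if "d \<le> m" for m
  proof -
    have k: "quad_kernel A E N (Suc m) = quad_kernel A E N m * (E (int m - int N) * E (int m + int N + 1) / (A (2 * int (Suc m) + int N) * A (2 * int (Suc m) - 1 - int N)))"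
      unfolding quad_kernel_def by (simp add: algebra_simps)
    have e1: "(\<Prod>l<Suc m-d. E (1 + int l)) = (\<Prod>l<m-d. E (1 + int l)) * E (int (Suc m) - int d)"
      using that by (simp add: Suc_diff_le of_nat_diff algebra_simps)
    have e2: "(\<Prod>l<Suc m+d+1. E (1 + int l)) = (\<Prod>l<m+d+1. E (1 + int l)) * E (int (Suc m) + int d + 1)"
      by (simp add: algebra_simps)
    have nz: "(\<Prod>l<m-d. E (1 + int l)) \<noteq> 0" "(\<Prod>l<m+d+1. E (1 + int l)) \<noteq> 0"
       "E (int (Suc m) - int d) \<noteq> 0" "E (int (Suc m) + int d + 1) \<noteq> 0" "E (int N - int d) \<noteq> 0" "E (int N + int d + 1) \<noteq> 0"
      using E(1) that d by (auto simp del: prod.lessThan_Suc)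
    have a: "A_part A (Suc m) (idx (Suc m) d) = A_part A m (idx m d) * A (int m) * A (2 * int m + int d) * A (2 * int m - int d - 1) / A (int m - 1)"
      using A_part_rec[OF that, of A] A by (simp add: eq_divide_eq)
    have arith: "a3 * U * K / (e1 * e2) * (E1 * E2 * w * y / - (c * c' * a3 * a1)) =
       a3' * (U * a * w * y / a1) * (K * (E1 * E2 / (B1 * B2))) / (e1 * x1 * (e2 * x2)) * (x1 * x2 * B1 * B2 / - (c * c' * a3' * a))"
      if "e1 \<noteq> 0" "e2 \<noteq> 0" "x1 \<noteq> 0" "x2 \<noteq> 0" "c \<noteq> 0" "c' \<noteq> 0" "a3 \<noteq> 0" "a3' \<noteq> 0" "a \<noteq> 0" "a1 \<noteq> 0" "B1 \<noteq> 0" "B2 \<noteq> 0"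
      for a3 U K e1 e2 E1 E2 w y c c' a1 a3' a B1 B2 x1 x2 :: complex
      using that by (simp add: field_simps)
    have e3: "int (Suc m) - 1 = int m" by simp
    show ?thesis
      unfolding tele_def k e1 e2 a F1_def F2_def F3_def e3 by (rule arith) (fact nz A)+
  qed
  have "(\<Sum>n=d..m. tele A E N d n) = tele A E N d m * (F1 m / F2 m)" if "d \<le> m" for m
    using that
  proof (induction m rule: dec_induct)
    case base
    have "F3 d = 0" by (simp add: F3_def E)
    then show ?case using F[of d] F2[of d] by simp
  next
    case (step m)
    have "(\<Sum>n=d..Suc m. tele A E N d n) = tele A E N d m * (F1 m / F2 m) + tele A E N d (Suc m)"
      using step by simp
    also have "\<dots> = tele A E N d (Suc m) * (F3 (Suc m) / F2 (Suc m) + 1)"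
      using tstep[OF \<open>d \<le> m\<close>] by (simp add: algebra_simps)
    also have "F3 (Suc m) / F2 (Suc m) + 1 = F1 (Suc m) / F2 (Suc m)"
      using F[of "Suc m"] F2[of "Suc m"] by (simp add: field_simps)
    finally show ?case .
  qed
  from this[of N] d show ?thesis by (simp add: F1_def E)
qed

text \<open>The normalisation: for \<open>d = N\<close> the sum over \<open>n\<close> has the single
  term \<open>n = N\<close>.\<close>

lemma tele_diag:
  assumes A: "\<And>e. A e \<noteq> 0" and E: "\<And>e. e \<noteq> 0 \<Longrightarrow> E e \<noteq> 0" "\<And>e. E (- e) = - E e"
  shows "(- 1) ^ N * E (2 * int N + 1) * tele A E N N N / A 0 = alt_ratio A N"
proof -
  \<comment> \<open>The positive arguments \<open>n - 1, n - 3, ...\<close> of the product and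
    \<open>n, n - 2, ...\<close> of \<open>alt_ratio\<close> together fill \<open>{1..n}\<close>;
    the nonpositive ones cancel.\<close>
  have dn: "(\<Prod>l<n. A (1 - int n + 2 * int l)) * alt_ratio A n * A 0 = (\<Prod>l<Suc n. A (int l))" for n
    using A
  proof (induction A n rule: alt_ratio.induct)
    case (3 A n)
    have "(\<Prod>l<Suc (Suc n). A (1 - int (Suc (Suc n)) + 2 * int l)) = A (- 1 - int n) * ((\<Prod>l<n. A (1 - int n + 2 * int l)) * A (int n + 1))"
      by (subst prod.lessThan_Suc_shift) (simp add: algebra_simps)
    then have "(\<Prod>l<Suc (Suc n). A (1 - int (Suc (Suc n)) + 2 * int l)) * alt_ratio A (Suc (Suc n)) * A 0 =
        (\<Prod>l<n. A (1 - int n + 2 * int l)) * alt_ratio A n * A 0 * A (int (Suc n)) * A (int (Suc (Suc n)))"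
      using 3(2)[of "- 1 - int n"] by (simp add: mult_ac add_ac del: prod.lessThan_Suc)
    then show ?case unfolding 3(1)[OF 3(2)] by (simp only: prod.lessThan_Suc)
  qed auto
  have i: "idx N N = 0" using idx_even[of 0 N] by simp
  have refl: "(\<Prod>l<N. E (int l - int N)) = (- 1) ^ N * (\<Prod>l<N. E (1 + int l))"
  proof -
    have "(\<Prod>l<N. E (int l - int N)) = (\<Prod>l<N. - E (1 + int (N - Suc l)))"
      by (intro prod.cong refl) (simp add: of_nat_diff flip: E(2))
    also have "\<dots> = (\<Prod>l<N. - E (1 + int l))"
      by (rule prod.nat_diff_reindex)
    finally show ?thesis by (simp add: prod_uminus)
  qed
  have "(\<Prod>l<N+M. E (1 + int l)) = (\<Prod>l<N. E (1 + int l)) * (\<Prod>l<M. E (int N + 1 + int l))" for M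
    by (induction M) (simp_all add: mult_ac add_ac)
  from this[of N] have s: "(\<Prod>l<N+N+1. E (1 + int l)) = (\<Prod>l<N. E (1 + int l)) * (\<Prod>l<N. E (int N + 1 + int l)) * E (2 * int N + 1)"
    by (simp add: add_ac)
  have a: "(\<Prod>l<N. A (int N + 2 * int l)) * A (3 * int N) = A (int N) * (\<Prod>l<N. A (int N + 2 + 2 * int l))"
  proof -
    have "(\<Prod>l<N. A (int N + 2 * int l)) * A (3 * int N) = (\<Prod>l<Suc N. A (int N + 2 * int l))" by simp
    also have "\<dots> = A (int N) * (\<Prod>l<N. A (int N + 2 + 2 * int l))"
      by (subst prod.lessThan_Suc_shift) (simp add: algebra_simps)
    finally show ?thesis .
  qed
  have k: "quad_kernel A E N N = (- 1) ^ N * (\<Prod>l<N. E (1 + int l)) * (\<Prod>l<N. E (int N + 1 + int l)) /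
      ((\<Prod>l<N. A (int N + 2 + 2 * int l)) * (\<Prod>l<N. A (1 - int N + 2 * int l)))"
    unfolding quad_kernel_def prod_dividef prod.distrib refl ..
  have nz: "(\<Prod>l<N. E (1 + int l)) \<noteq> 0" "(\<Prod>l<N. E (int N + 1 + int l)) \<noteq> 0" "E (2 * int N + 1) \<noteq> 0"
    "(\<Prod>l<N. A (int N + 2 + 2 * int l)) \<noteq> 0" "(\<Prod>l<N. A (1 - int N + 2 * int l)) \<noteq> 0"
    using A E(1) by auto
  have "(- 1) ^ N * E (2 * int N + 1) * tele A E N N N / A 0 =
    ((- 1) ^ N * (- 1) ^ N) * (\<Prod>l<N. A (int l)) * ((\<Prod>l<N. A (int N + 2 * int l)) * A (3 * int N)) /
      ((\<Prod>l<N. A (int N + 2 + 2 * int l)) * (\<Prod>l<N. A (1 - int N + 2 * int l)) * A 0)"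
    unfolding tele_def k i s A_part_def using nz by (simp add: field_simps)
  also have "(- 1) ^ N * (- 1) ^ N = (1::complex)" by (simp flip: power_mult_distrib)
  also have "1 * (\<Prod>l<N. A (int l)) * ((\<Prod>l<N. A (int N + 2 * int l)) * A (3 * int N)) /
      ((\<Prod>l<N. A (int N + 2 + 2 * int l)) * (\<Prod>l<N. A (1 - int N + 2 * int l)) * A 0) =
      (\<Prod>l<Suc N. A (int l)) / ((\<Prod>l<N. A (1 - int N + 2 * int l)) * A 0)"
    unfolding a using nz by simp
  also have "\<dots> = alt_ratio A N"
    unfolding dn[of N, symmetric] using nz A[of 0] by simp
  finally show ?thesis .
qed

text \<open>
  Here \<open>A m\<close>, \<open>E m\<close> and \<open>P m\<close> stand for \<open>s (a + m e)\<close>, \<open>s (m e)\<close> and the value of the parameter ratio at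
  \<open>a - c + m e\<close>; the last assumption is the three-term relation.
\<close>

theorem alternating_inversion:
  assumes A: "\<And>e. A e \<noteq> 0" and P: "\<And>e. P e \<noteq> 0"
    and E: "\<And>e. e \<noteq> 0 \<Longrightarrow> E e \<noteq> 0" "\<And>e. E (- e) = - E e"
    and id: "\<And>m N d :: int. E (m - N) * E (m + N + 1) * A (2 * m + d) * A (2 * m - d - 1)
       - E (m - d) * E (m + d + 1) * A (2 * m + N) * A (2 * m - 1 - N) = - (E (N - d) * E (N + d + 1) * A (3 * m) * A (m - 1))"
  shows "(\<Sum>n\<le>N. A (3 * int n) / A 0 * quad_kernel A E N n * (- 1) ^ n * (\<Sum>i\<le>n. P_part P n i * A_part A n i * E_part E n i))
    = alt_ratio A N * alt_ratio P N"
proof -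
  have E0: "E 0 = 0" using E(2)[of 0] by simp
  \<comment> \<open>All factors free of \<open>n\<close>. Interchanging the summations leaves one
    telescoping sum for each \<open>d\<close>, nonzero only for \<open>d = N\<close>.\<close>
  define c where "c d = (- 1) ^ d * E (2 * int d + 1) / A 0 * alt_ratio P d" for d
  have "(\<Sum>n\<le>N. A (3 * int n) / A 0 * quad_kernel A E N n * (- 1) ^ n * (\<Sum>i\<le>n. P_part P n i * A_part A n i * E_part E n i)) =
    (\<Sum>n\<le>N. \<Sum>d\<le>n. c d * tele A E N d n)"
  proof (rule sum.cong[OF refl])
    fix n
    have "P_part P n (idx n d) * A_part A n (idx n d) * E_part E n (idx n d) * (- 1) ^ n * (A (3 * int n) / A 0 * quad_kernel A E N n)
       = c d * tele A E N d n" if "d \<le> n" for d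
    proof -
      have "(- 1 :: complex) ^ n = (- 1) ^ (n - d) * (- 1) ^ d"
        using that by (simp flip: power_add)
      then have sg: "(- 1 :: complex) ^ (n - d) * (- 1) ^ n = (- 1) ^ d"
        by (simp flip: power_mult_distrib mult.assoc)
      have "P_part P n (idx n d) * A_part A n (idx n d) * E_part E n (idx n d) * (- 1) ^ n * (A (3 * int n) / A 0 * quad_kernel A E N n)
        = ((- 1) ^ (n - d) * (- 1) ^ n) * E (2 * int d + 1) / A 0 * alt_ratio P d * tele A E N d n"
        unfolding P_part_idx[of P, OF P that] E_part_idx[of E, OF E(2) that] tele_def
        by (simp add: mult_ac del: prod.lessThan_Suc)
      then show ?thesis unfolding sg c_def .
    qed
    then show "A (3 * int n) / A 0 * quad_kernel A E N n * (- 1) ^ n * (\<Sum>i\<le>n. P_part P n i * A_part A n i * E_part E n i) =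
       (\<Sum>d\<le>n. c d * tele A E N d n)"
      unfolding sum_idx[of "\<lambda>i. P_part P n i * A_part A n i * E_part E n i"] sum_distrib_left
      by (intro sum.cong) (auto simp: mult_ac)
  qed
  also have "\<dots> = (\<Sum>d\<le>N. \<Sum>n=d..N. c d * tele A E N d n)"
    unfolding sum.Sigma[OF finite_atMost ballI[OF finite_atMost]] sum.Sigma[OF finite_atMost ballI[OF finite_atLeastAtMost]]
    by (rule sum.reindex_bij_witness[where i = "\<lambda>(d, n). (n, d)" and j = "\<lambda>(n, d). (d, n)"]) auto
  also have "\<dots> = (\<Sum>d\<le>N. if d = N then alt_ratio A N * alt_ratio P N else 0)"
  proof (rule sum.cong[OF refl])
    fix d assume "d \<in> {..N}"
    have "c N * tele A E N N N = (- 1) ^ N * E (2 * int N + 1) * tele A E N N N / A 0 * alt_ratio P N"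
      by (simp add: c_def)
    also have "\<dots> = alt_ratio A N * alt_ratio P N"
      by (rule arg_cong[OF tele_diag, where f = "\<lambda>y. y * alt_ratio P N"]) (use A E in auto)
    finally show "(\<Sum>n=d..N. c d * tele A E N d n) = (if d = N then alt_ratio A N * alt_ratio P N else 0)"
      unfolding sum_distrib_left[symmetric]
      using tele_sum[of A E d N, OF A E(1) E0 id] \<open>d \<in> {..N}\<close> by auto
  qed
  also have "\<dots> = alt_ratio A N * alt_ratio P N" by simp
  finally show ?thesis .
qed

section \<open>The summation in additive form\<close>

context odd_theta begin

lemma fac_add: "fac h z (m + n) = fac h z m * fac h (z + of_nat m * h) n"
  by (induction n) (simp_all add: fac_Suc algebra_simps)

lemma fac_reflect: "fac h z n = (- 1) ^ n * fac h (- z + (1 - of_nat n) * h) n"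
proof -
  have "fac h (- z + (1 - of_nat n) * h) n = (\<Prod>j<n. - s (z + of_nat (n - Suc j) * h))"
    unfolding fac_def by (intro prod.cong refl) (simp add: of_nat_diff algebra_simps flip: odd)
  also have "\<dots> = (\<Prod>j<n. - s (z + of_nat j * h))"
    by (rule prod.nat_diff_reindex)
  also have "\<dots> = (- 1) ^ n * fac h z n"
    by (simp add: fac_def prod_uminus)
  finally show ?thesis by (simp flip: power_mult_distrib mult.assoc)
qed

lemma fac_double: "fac h z (2 * n) = fac (2 * h) z n * fac (2 * h) (z + h) n"
  by (induction n) (simp_all add: fac_Suc algebra_simps)

text \<open>The power of \<open>q\<close> in \<open>summand\<close> has no counterpart: it is
  consumed by the factors \<open>exp z\<close> in
  \<open>theta (exp (2 * z)) p = exp z * stheta p z\<close>. The balance has turned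
  \<open>a * b i * q / (B * X)\<close> into \<open>b i + c - a\<close>.\<close>

definition additive_summand where
  "additive_summand r N e a b c x k = (let n = weight r k in
     vand r (shifted (2 * e) x k) / vand r x
     * (s (a + 3 * of_nat n * e) / s a)
     * ((fac e a n * fac e (- of_nat N * e) n * fac e ((of_nat N + 1) * e) n)
        / (fac (2 * e) (a + (of_nat N + 2) * e) n * fac (2 * e) (a + (1 - of_nat N) * e) n
           * (\<Prod>i=1..r+1. fac e (b i + c - a) n)))
     * (\<Prod>i=1..r. (fac (2 * e) (c - x i) n * fac e (c - a - x i) (n - k i) * (\<Prod>j=1..r+1. fac (2 * e) (b j + x i) (k i)))
        / (fac (2 * e) (c - x i) (n - k i) * fac e (a + x i - c + (of_nat (k i) - of_nat n + 1) * e) (k i)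
            * (\<Prod>j=1..r. fac (2 * e) (2 * e + x i - x j) (k i)))))"

text \<open>
  The factor of index \<open>i\<close> in the summand, rewritten with the parameters of the inner sum
  \<open>t = - c + (2 - 2 n) e\<close>, \<open>g1 = a - c + (1 - n) e\<close>, \<open>g2 = g1 + e\<close> in step \<open>2 e\<close>.
\<close>

lemma row_factor:
  fixes e :: complex
  assumes k: "k \<le> n"
    and C: "\<And>m::int. s (a + x - c + of_int m * e) \<noteq> 0" and D: "\<And>m::int. s (c - x + of_int m * e) \<noteq> 0"
  shows "fac (2 * e) (c - x) n * fac e (c - a - x) (n - k) /
      (fac (2 * e) (c - x) (n - k) * fac e (a + x - c + (of_nat k - of_nat n + 1) * e) k) =
    fac e (c - a - x) n * (fac (2 * e) (- c + (2 - 2 * of_nat n) * e + x) k /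
      (fac (2 * e) (a - c + (1 - of_nat n) * e + x) k * fac (2 * e) (a - c + (2 - of_nat n) * e + x) k))"
proof -
  define y where "y = a + x - c"
  have nz1: "fac e (y + of_int m * e) l \<noteq> 0" for m l
    using C[of "m + int _"] by (auto simp: fac_def y_def algebra_simps)
  have nz2: "fac (2 * e) (c - x) l \<noteq> 0" for l
    using D[of "2 * int _"] by (auto simp: fac_def algebra_simps)
  have 1: "fac (2 * e) (c - x) n = fac (2 * e) (c - x) (n - k) * ((- 1) ^ k * fac (2 * e) (- c + (2 - 2 * of_nat n) * e + x) k)"
  proof -
    have "fac (2 * e) (c - x) n = fac (2 * e) (c - x) (n - k) * fac (2 * e) (c - x + of_nat (n - k) * (2 * e)) k"
      using fac_add[of "2 * e" "c - x" "n - k" k] k by simp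
    also have "fac (2 * e) (c - x + of_nat (n - k) * (2 * e)) k = (- 1) ^ k * fac (2 * e) (- c + (2 - 2 * of_nat n) * e + x) k"
      by (subst fac_reflect) (use k in \<open>simp add: of_nat_diff algebra_simps\<close>)
    finally show ?thesis .
  qed
  have 2: "fac e (c - a - x) n = fac e (c - a - x) (n - k) * ((- 1) ^ k * fac e (y + (1 - of_nat n) * e) k)"
  proof -
    have "fac e (c - a - x) n = fac e (c - a - x) (n - k) * fac e (c - a - x + of_nat (n - k) * e) k"
      using fac_add[of e "c - a - x" "n - k" k] k by simp
    also have "fac e (c - a - x + of_nat (n - k) * e) k = (- 1) ^ k * fac e (y + (1 - of_nat n) * e) k"
      by (subst fac_reflect) (use k in \<open>simp add: of_nat_diff y_def algebra_simps\<close>)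
    finally show ?thesis .
  qed
  \<comment> \<open>Since \<open>g2 = g1 + e\<close>, the two factorials of step \<open>2 e\<close>
    interleave to one of step \<open>e\<close> and length \<open>2 k\<close>, which is cut in the
    middle.\<close>
  have 3: "fac (2 * e) (a - c + (1 - of_nat n) * e + x) k * fac (2 * e) (a - c + (2 - of_nat n) * e + x) k =
    fac e (y + (1 - of_nat n) * e) k * fac e (y + (of_nat k - of_nat n + 1) * e) k"
    using fac_double[of e "y + (1 - of_nat n) * e" k] fac_add[of e "y + (1 - of_nat n) * e" k k, unfolded mult_2[symmetric]]
    by (simp add: y_def algebra_simps)
  have "fac e (y + (1 - of_nat n) * e) k \<noteq> 0"
    using nz1[of "1 - int n" k] by simp
  then show ?thesis
    unfolding 1 2 3 y_def[symmetric] using nz2[of "n - k"] by simp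
qed

text \<open>Each \<open>l\<close> reverses \<open>r\<close> signs above and \<open>r + 1\<close>
  below, hence the factor \<open>(- 1) ^ n\<close>. The product of ratios becomes the denominator of
  \<open>P_part\<close>.\<close>

lemma prefactor:
  "(\<Prod>i=1..r. fac e (c - a - x i) n) / (\<Prod>i=1..r+1. fac e (b i + c - a) n) =
    (- 1) ^ n / (\<Prod>l<n. ratio r x b (a - c + of_int (- int l) * e))"
proof -
  have "(\<Prod>i=1..r. fac e (c - a - x i) n) = (\<Prod>l<n. \<Prod>i=1..r. s (c - a - x i + of_nat l * e))"
    "(\<Prod>i=1..r+1. fac e (b i + c - a) n) = (\<Prod>l<n. \<Prod>i=1..r+1. s (b i + c - a + of_nat l * e))"
    unfolding fac_def by (rule prod.swap)+
  moreover have "(\<Prod>i=1..r. s (c - a - x i + of_nat l * e)) = (- 1) ^ r * (\<Prod>i=1..r. s (a - c + of_int (- int l) * e + x i))" for l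
  proof -
    have "s (c - a - x i + of_nat l * e) = - s (a - c + of_int (- int l) * e + x i)" for i
      by (simp add: algebra_simps flip: odd)
    then show ?thesis by (simp add: prod_uminus)
  qed
  moreover have "(\<Prod>i=1..r+1. s (b i + c - a + of_nat l * e)) = (- 1) ^ (r + 1) * (\<Prod>i=1..r+1. s (a - c + of_int (- int l) * e - b i))" for l
  proof -
    have "s (b i + c - a + of_nat l * e) = - s (a - c + of_int (- int l) * e - b i)" for i
      by (simp add: algebra_simps flip: odd)
    then show ?thesis by (simp only: prod_uminus) simp
  qed
  ultimately have "(\<Prod>i=1..r. fac e (c - a - x i) n) / (\<Prod>i=1..r+1. fac e (b i + c - a) n) =
     (\<Prod>l<n. ((- 1) ^ r * (\<Prod>i=1..r. s (a - c + of_int (- int l) * e + x i))) / ((- 1) ^ (r + 1) * (\<Prod>i=1..r+1. s (a - c + of_int (- int l) * e - b i))))"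
    by (simp only: prod_dividef)
  also have "\<dots> = (\<Prod>l<n. - 1 / ratio r x b (a - c + of_int (- int l) * e))"
    unfolding ratio_def by (intro prod.cong refl) (simp add: power_add)
  also have "\<dots> = (- 1) ^ n / (\<Prod>l<n. ratio r x b (a - c + of_int (- int l) * e))"
    unfolding prod_dividef by simp
  finally show ?thesis .
qed

lemma quad_kernel_eq:
  "fac e a n * fac e (- of_nat N * e) n * fac e ((of_nat N + 1) * e) n
        / (fac (2 * e) (a + (of_nat N + 2) * e) n * fac (2 * e) (a + (1 - of_nat N) * e) n) =
   (\<Prod>l<n. s (a + of_int (int l) * e)) * quad_kernel (\<lambda>m. s (a + of_int m * e)) (\<lambda>m. s (of_int m * e)) N n"
  unfolding quad_kernel_def fac_def prod_dividef prod.distrib by (simp add: algebra_simps)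

text \<open>Since \<open>g1 - g2 = - e\<close>, the four factorials of step \<open>2 e\<close> pair
  up to factorials of step \<open>e\<close>: one of length \<open>2 i\<close>, and one of length
  \<open>2 (n - i) + 1\<close> whose first factor comes from \<open>s (g1 - g2)\<close>.\<close>

lemma dual_coeff_eq:
  assumes "i \<le> n" and H: "\<And>m::int. m \<noteq> 0 \<Longrightarrow> s (of_int m * e) \<noteq> 0"
  shows "(\<Prod>l<n. s (a + of_int (int l) * e)) *
     dual_coeff (2 * e) (- c + (2 - 2 * of_nat n) * e) (a - c + (1 - of_nat n) * e) (a - c + (2 - of_nat n) * e) i (n - i) =
    A_part (\<lambda>m. s (a + of_int m * e)) n i * E_part (\<lambda>m. s (of_int m * e)) n i"
proof -
  define g1 g2 t where "g1 = a - c + (1 - of_nat n) * e" and "g2 = a - c + (2 - of_nat n) * e" and "t = - c + (2 - 2 * of_nat n) * e"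
  have e: "g1 - t = a + (of_nat n - 1) * e" "g2 - t = a + of_nat n * e" "g1 - g2 = - e"
    by (simp_all add: g1_def g2_def t_def algebra_simps)
  have 1: "fac (2 * e) (2 * e) i * fac (2 * e) (2 * e + - e) i = (\<Prod>l<2*i. s (of_int (1 + int l) * e))"
    using fac_double[of e e i] by (simp add: fac_def algebra_simps)
  have 2: "s e * (fac (2 * e) (2 * e) (n - i) * fac (2 * e) (2 * e - - e) (n - i)) = (\<Prod>l<2*(n-i)+1. s (of_int (1 + int l) * e))"
  proof -
    have "s e * (fac (2 * e) (2 * e) (n - i) * fac (2 * e) (2 * e - - e) (n - i)) = s e * fac e (e + e) (2 * (n - i))"
      unfolding fac_double by (simp add: algebra_simps)
    also have "\<dots> = fac e e (2 * (n - i) + 1)"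
      using fac_Suc_shift[of e e "2 * (n - i)"] by simp
    finally show ?thesis by (simp add: fac_def algebra_simps)
  qed
  have 3: "s (- e + (of_nat i - of_nat (n - i)) * (2 * e)) = - s (of_int (2 * (int n - 2 * int i) + 1) * e)"
    unfolding odd[symmetric] using assms by (simp add: of_nat_diff algebra_simps)
  have 4: "fac (2 * e) (a + (of_nat n - 1) * e) i = (\<Prod>l<i. s (a + of_int (int n - 1 + 2 * int l) * e))"
    "fac (2 * e) (a + of_nat n * e) (n - i) = (\<Prod>l<n-i. s (a + of_int (int n + 2 * int l) * e))"
    unfolding fac_def by (simp_all add: algebra_simps)
  have se: "s e \<noteq> 0" using H[of 1] by simp
  have arith: "p * (f1 * f2 * - w / (- z * q1 * q2 * q3 * q4)) = p * (f1 * f2) * (w / ((q1 * q3) * (z * (q2 * q4))))"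
    for p f1 f2 w z q1 q2 q3 q4 :: complex by (simp add: mult_ac)
  show ?thesis
    unfolding dual_coeff_def g1_def[symmetric] g2_def[symmetric] t_def[symmetric] e 3 odd[of e] arith 1 2
      4 A_part_def E_part_def ..
qed

text \<open>Nonvanishing at all integer translates makes every intermediate division legitimate;
  \<open>sum_additive\<close> weakens these assumptions. The row of weight \<open>n\<close> is
  evaluated by \<open>kn_sum_eq\<close>, and the rows are combined by
  \<open>alternating_inversion\<close>.\<close>

theorem sum_generic:
  fixes a c e :: complex and x b :: "nat \<Rightarrow> complex"
  assumes X: "\<And>i j m::int. i \<in> {1..r} \<Longrightarrow> j \<in> {1..r} \<Longrightarrow> i \<noteq> j \<Longrightarrow> \<bar>m\<bar> \<le> int N \<Longrightarrow> s (x i - x j + of_int m * (2 * e)) \<noteq> 0"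
    and H: "\<And>m::int. m \<noteq> 0 \<Longrightarrow> s (of_int m * e) \<noteq> 0"
    and A: "\<And>m::int. s (a + of_int m * e) \<noteq> 0"
    and C: "\<And>i (m::int). i \<in> {1..r} \<Longrightarrow> s (a + x i - c + of_int m * e) \<noteq> 0"
    and D: "\<And>i (m::int). i \<in> {1..r} \<Longrightarrow> s (c - x i + of_int m * e) \<noteq> 0"
    and F: "\<And>i (m::int). i \<in> {1..r+1} \<Longrightarrow> s (a - c - b i + of_int m * e) \<noteq> 0"
    and bal: "2 * a + e = (\<Sum>i=1..r+1. b i) + c + (\<Sum>i=1..r. x i)"
  shows "(\<Sum>k\<in>multi_indices r N. additive_summand r N e a b c x k) =
    alt_ratio (\<lambda>m. s (a + of_int m * e)) N * alt_ratio (\<lambda>m. ratio r x b (a - c + of_int m * e)) N"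
proof -
  define A' where "A' m = s (a + of_int m * e)" for m :: int
  define E' where "E' m = s (of_int m * e)" for m :: int
  define P where "P m = ratio r x b (a - c + of_int m * e)" for m :: int
  have Pnz: "P m \<noteq> 0" for m
    using F[of _ m] C[of _ m] by (auto simp: P_def ratio_def algebra_simps)
  have row: "(\<Sum>k\<in>compositions r n. additive_summand r N e a b c x k) =
     A' (3 * int n) / A' 0 * quad_kernel A' E' N n * (- 1) ^ n * (\<Sum>i\<le>n. P_part P n i * A_part A' n i * E_part E' n i)"
    if n: "n \<le> N" for n
  proof -
    define g1 g2 t where "g1 = a - c + (1 - of_nat n) * e" and "g2 = a - c + (2 - of_nat n) * e" and "t = - c + (2 - 2 * of_nat n) * e"
    define L where "L = (\<Prod>l<n. A' (int l))"
    have term_eq: "additive_summand r N e a b c x k = A' (3 * int n) / A' 0 * (L * quad_kernel A' E' N n) * ((- 1) ^ n / (\<Prod>l<n. P (- int l))) * kn_term (2 * e) r x b t g1 g2 k"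
      if k: "k \<in> compositions r n" for k
    proof -
      have w: "weight r k = n" using k by (simp add: compositions_def)
      have each: "(fac (2 * e) (c - x i) n * fac e (c - a - x i) (n - k i) * (\<Prod>j=1..r+1. fac (2 * e) (b j + x i) (k i)))
        / (fac (2 * e) (c - x i) (n - k i) * fac e (a + x i - c + (of_nat (k i) - of_nat n + 1) * e) (k i)
            * (\<Prod>j=1..r. fac (2 * e) (2 * e + x i - x j) (k i))) =
        fac e (c - a - x i) n * ((\<Prod>j=1..r+1. fac (2 * e) (b j + x i) (k i)) * fac (2 * e) (t + x i) (k i) /
           (fac (2 * e) (g1 + x i) (k i) * fac (2 * e) (g2 + x i) (k i))) / (\<Prod>j=1..r. fac (2 * e) (2 * e + x i - x j) (k i))"
        if i: "i \<in> {1..r}" for i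
      proof -
        have arith: "u * v * B / (p * q * d) = f * (B * f1 / (f2 * f3)) / d" if "u * v / (p * q) = f * (f1 / (f2 * f3))"
          for u v B p q d f f1 f2 f3 :: complex
          using arg_cong[OF that, of "\<lambda>z. z * B / d"] by (simp add: mult_ac)
        show ?thesis
          by (rule arith, unfold g1_def g2_def t_def, rule row_factor[OF compositions_le[OF k i] C[OF i] D[OF i]])
      qed
      have "additive_summand r N e a b c x k = vand r (shifted (2 * e) x k) / vand r x * (A' (3 * int n) / A' 0) *
         ((fac e a n * fac e (- of_nat N * e) n * fac e ((of_nat N + 1) * e) n)
           / (fac (2 * e) (a + (of_nat N + 2) * e) n * fac (2 * e) (a + (1 - of_nat N) * e) n
           * (\<Prod>i=1..r+1. fac e (b i + c - a) n))) *
         (\<Prod>i=1..r. fac e (c - a - x i) n * ((\<Prod>j=1..r+1. fac (2 * e) (b j + x i) (k i)) * fac (2 * e) (t + x i) (k i) /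
           (fac (2 * e) (g1 + x i) (k i) * fac (2 * e) (g2 + x i) (k i))) / (\<Prod>j=1..r. fac (2 * e) (2 * e + x i - x j) (k i)))"
      proof -
        have A0: "A' (3 * int n) = s (a + 3 * of_nat n * e)" "A' 0 = s a" by (simp_all add: A'_def)
        show ?thesis unfolding additive_summand_def Let_def w A0
          by (intro arg_cong2[of _ _ _ _ "(*)"] prod.cong each refl)
      qed
      also have "\<dots> = A' (3 * int n) / A' 0 *
         (fac e a n * fac e (- of_nat N * e) n * fac e ((of_nat N + 1) * e) n
           / (fac (2 * e) (a + (of_nat N + 2) * e) n * fac (2 * e) (a + (1 - of_nat N) * e) n)) *
         ((\<Prod>i=1..r. fac e (c - a - x i) n) / (\<Prod>i=1..r+1. fac e (b i + c - a) n)) *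
         kn_term (2 * e) r x b t g1 g2 k"
        unfolding kn_term_def root_factor_def prod_dividef[of _ "\<lambda>i. \<Prod>j=1..r. fac (2 * e) (2 * e + x i - x j) (k i)"]
          prod.distrib[of "\<lambda>i. fac e (c - a - x i) n"]
        by (simp add: mult_ac del: prod.cl_ivl_Suc)
      finally show ?thesis
        unfolding quad_kernel_eq prefactor L_def P_def E'_def A'_def .
    qed
    have "kn_sum (2 * e) r x b t g1 g2 n = (\<Sum>i\<le>n. (\<Prod>l<i. ratio r x b (g1 + of_nat l * (2 * e))) *
     (\<Prod>l<n-i. ratio r x b (g2 + of_nat l * (2 * e))) * dual_coeff (2 * e) t g1 g2 i (n - i))"
    proof (rule kn_sum_eq[OF X])
      show "(\<Sum>j=1..r+1. b j) + t + (\<Sum>i=1..r. x i) = g1 + g2"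
        using bal by (simp add: g1_def g2_def t_def algebra_simps)
      fix m :: int
      show "s (of_int m * (2 * e)) \<noteq> 0" if "m \<noteq> 0" using H[of "2 * m"] that by (simp add: mult_ac)
      show "s (g1 - g2 + of_int m * (2 * e)) \<noteq> 0"
      proof -
        have "2 * m - 1 \<noteq> 0" by presburger
        from H[OF this] show ?thesis by (simp add: g1_def g2_def algebra_simps)
      qed
      show "s (g1 - t + of_int m * (2 * e)) \<noteq> 0"
        using A[of "int n - 1 + 2 * m"] by (simp add: g1_def t_def algebra_simps)
      show "s (g2 - t + of_int m * (2 * e)) \<noteq> 0"
        using A[of "int n + 2 * m"] by (simp add: g2_def t_def algebra_simps)
      fix i assume i: "i \<in> {1..r}"
      show "s (t + x i + of_int m * (2 * e)) \<noteq> 0"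
        using D[OF i, of "2 * int n - 2 - 2 * m"] odd[of "t + x i + of_int m * (2 * e)"] by (simp add: t_def algebra_simps)
      show "s (g1 + x i + of_int m * (2 * e)) \<noteq> 0"
        using C[OF i, of "1 - int n + 2 * m"] by (simp add: g1_def algebra_simps)
      show "s (g2 + x i + of_int m * (2 * e)) \<noteq> 0"
        using C[OF i, of "2 - int n + 2 * m"] by (simp add: g2_def algebra_simps)
    qed (use n in auto)
    also have "\<dots> = (\<Sum>i\<le>n. (\<Prod>l<i. P (1 - int n + 2 * int l)) *
     (\<Prod>l<n-i. P (2 - int n + 2 * int l)) * dual_coeff (2 * e) t g1 g2 i (n - i))"
      unfolding P_def g1_def g2_def by (simp add: algebra_simps)
    finally have kn: "L / (\<Prod>l<n. P (- int l)) * kn_sum (2 * e) r x b t g1 g2 n = (\<Sum>i\<le>n. P_part P n i * (L * dual_coeff (2 * e) t g1 g2 i (n - i)))"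
      unfolding P_part_def by (simp add: sum_distrib_left mult_ac)
    also have "\<dots> = (\<Sum>i\<le>n. P_part P n i * (A_part A' n i * E_part E' n i))"
    proof (rule sum.cong[OF refl])
      fix i assume "i \<in> {..n}"
      then have "L * dual_coeff (2 * e) t g1 g2 i (n - i) = A_part A' n i * E_part E' n i"
        using dual_coeff_eq[OF _ H, of i n] unfolding L_def A'_def E'_def g1_def g2_def t_def by simp
      then show "P_part P n i * (L * dual_coeff (2 * e) t g1 g2 i (n - i)) = P_part P n i * (A_part A' n i * E_part E' n i)"
        by simp
    qed
    finally have "L / (\<Prod>l<n. P (- int l)) * kn_sum (2 * e) r x b t g1 g2 n = (\<Sum>i\<le>n. P_part P n i * A_part A' n i * E_part E' n i)"
      by (simp add: mult_ac)
    moreover have "(\<Sum>k\<in>compositions r n. additive_summand r N e a b c x k) =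
       A' (3 * int n) / A' 0 * (L * quad_kernel A' E' N n) * ((- 1) ^ n / (\<Prod>l<n. P (- int l))) * kn_sum (2 * e) r x b t g1 g2 n"
      unfolding kn_sum_def sum_distrib_left by (rule sum.cong[OF refl term_eq])
    moreover have "\<dots> = A' (3 * int n) / A' 0 * quad_kernel A' E' N n * (- 1) ^ n * (L / (\<Prod>l<n. P (- int l)) * kn_sum (2 * e) r x b t g1 g2 n)"
      by simp
    ultimately show ?thesis by simp
  qed
  have "multi_indices r N = (\<Union>n\<le>N. compositions r n)"
    by (auto simp: multi_indices_def compositions_def)
  then have "(\<Sum>k\<in>multi_indices r N. additive_summand r N e a b c x k) = (\<Sum>n\<le>N. \<Sum>k\<in>compositions r n. additive_summand r N e a b c x k)"
    by (simp only:) (rule sum.UNION_disjoint, simp, simp add: finite_compositions, auto simp: compositions_def)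
  also have "\<dots> = (\<Sum>n\<le>N. A' (3 * int n) / A' 0 * quad_kernel A' E' N n * (- 1) ^ n * (\<Sum>i\<le>n. P_part P n i * A_part A' n i * E_part E' n i))"
    by (rule sum.cong) (simp_all add: row)
  also have "\<dots> = alt_ratio A' N * alt_ratio P N"
  proof (rule alternating_inversion)
    show "E' (- m) = - E' m" for m using odd[of "of_int m * e"] by (simp add: E'_def)
    fix m M d :: int
    \<comment> \<open>Half sums that turn the arguments of the telescoping identity into those of
      the three-term relation.\<close>
    define X Y U V where "X = (2 * of_int m + 1) * e / 2" and "Y = (2 * of_int M + 1) * e / 2"
      and "U = a + (4 * of_int m - 1) * e / 2" and "V = (2 * of_int d + 1) * e / 2"
    have eqs: "X + Y = of_int (m + M + 1) * e" "X - Y = of_int (m - M) * e"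
      "U + V = a + of_int (2 * m + d) * e" "U - V = a + of_int (2 * m - d - 1) * e"
      "X + V = of_int (m + d + 1) * e" "X - V = of_int (m - d) * e"
      "U + Y = a + of_int (2 * m + M) * e" "U - Y = a + of_int (2 * m - 1 - M) * e"
      "Y + V = of_int (M + d + 1) * e" "Y - V = of_int (M - d) * e"
      "X + U = a + of_int (3 * m) * e" "X - U = - (a + of_int (m - 1) * e)"
      by (simp_all add: X_def Y_def U_def V_def field_simps)
    show "E' (m - M) * E' (m + M + 1) * A' (2 * m + d) * A' (2 * m - d - 1)
       - E' (m - d) * E' (m + d + 1) * A' (2 * m + M) * A' (2 * m - 1 - M) = - (E' (M - d) * E' (M + d + 1) * A' (3 * m) * A' (m - 1))"
      using weierstrass[of X Y U V] unfolding eqs odd A'_def E'_def by (simp only: mult_ac) simp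
  qed (use A H Pnz in \<open>auto simp: A'_def E'_def\<close>)
  finally show ?thesis unfolding A'_def P_def .
qed


section \<open>Closed form and perturbation of the parameters\<close>

text \<open>One formula for both parities: \<open>\<sigma> = e\<close> for \<open>N = 2 m\<close>
  and \<open>\<sigma> = 0\<close> for \<open>N = 2 m - 1\<close>.\<close>

definition additive_rhs where
  "additive_rhs r \<sigma> m e a b c x =
     fac (2 * e) (a + e + \<sigma>) m / fac (2 * e) (\<sigma> - a) m
     * (\<Prod>i=1..r. fac (2 * e) (c + \<sigma> - a - x i) m / fac (2 * e) (a + x i + e + \<sigma> - c) m)
     * (\<Prod>i=1..r+1. fac (2 * e) (a + e + \<sigma> - b i - c) m / fac (2 * e) (b i + c + \<sigma> - a) m)"

lemma alt_ratio_even: "alt_ratio F (2 * m) = (\<Prod>l<m. F (2 + 2 * int l) / F (- 1 - 2 * int l))"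
  by (induction m) (simp_all add: algebra_simps)

lemma alt_ratio_odd: "alt_ratio F (2 * m + 1) = (\<Prod>l<m+1. F (1 + 2 * int l) / F (- 2 * int l))"
  by (induction m) (simp_all add: algebra_simps)

lemma alt_ratio_parity:
  assumes "N + 1 = 2 * m + d" "d \<le> 1"
  shows "alt_ratio F N = (\<Prod>l<m. F (1 + int d + 2 * int l) / F (- int d - 2 * int l))"
proof (cases "d = 0")
  case True
  then obtain m' where "m = Suc m'" "N = 2 * m' + 1" using assms by (cases m) auto
  then show ?thesis using True alt_ratio_odd[of F m'] by simp
next
  case False
  then have "d = 1" "N = 2 * m" using assms by auto
  then show ?thesis using alt_ratio_even[of F m] by simp
qed

text \<open>The factors of \<open>alt_ratio\<close> at nonpositive integers appear with negated
  arguments; for each \<open>l\<close> this costs one sign for \<open>a\<close>, \<open>r\<close>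
  signs for the \<open>x i\<close> and \<open>r + 1\<close> for the \<open>b i\<close>, an even
  number in all.\<close>

lemma additive_rhs_eq:
  assumes "N + 1 = 2 * m + d" "d \<le> 1"
  shows "alt_ratio (\<lambda>j. s (a + of_int j * e)) N * alt_ratio (\<lambda>j. ratio r x b (a - c + of_int j * e)) N
    = additive_rhs r (of_nat d * e) m e a b c x"
proof -
  have "s (a + of_int (1 + int d + 2 * int l) * e) / s (a + of_int (- int d - 2 * int l) * e)
      * (ratio r x b (a - c + of_int (1 + int d + 2 * int l) * e) / ratio r x b (a - c + of_int (- int d - 2 * int l) * e))
    = s (a + e + of_nat d * e + of_nat l * (2 * e)) / s (of_nat d * e - a + of_nat l * (2 * e))
      * ((\<Prod>i=1..r. s (c + of_nat d * e - a - x i + of_nat l * (2 * e))) / (\<Prod>i=1..r. s (a + x i + e + of_nat d * e - c + of_nat l * (2 * e))))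
      * ((\<Prod>i=1..r+1. s (a + e + of_nat d * e - b i - c + of_nat l * (2 * e))) / (\<Prod>i=1..r+1. s (b i + c + of_nat d * e - a + of_nat l * (2 * e))))" for l
  proof -
    define u where "u = of_nat d * e + of_nat l * (2 * e)"
    have u: "of_int (1 + int d + 2 * int l) * e = e + u" "of_int (- int d - 2 * int l) * e = - u"
      by (simp_all add: u_def algebra_simps)
    have v: "a + e + of_nat d * e + of_nat l * (2 * e) = a + (e + u)" "of_nat d * e - a + of_nat l * (2 * e) = - (a - u)"
      "c + of_nat d * e - a - x i + of_nat l * (2 * e) = - (a - c + - u + x i)"
      "a + x i + e + of_nat d * e - c + of_nat l * (2 * e) = a - c + (e + u) + x i"
      "a + e + of_nat d * e - b i - c + of_nat l * (2 * e) = a - c + (e + u) - b i"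
      "b i + c + of_nat d * e - a + of_nat l * (2 * e) = - (a - c + - u - b i)" for i
      by (simp_all add: u_def algebra_simps)
    have p: "(\<Prod>i=1..r. s (- (a - c + - u + x i))) = (- 1) ^ r * (\<Prod>i=1..r. s (a - c + - u + x i))"
      "(\<Prod>i=1..r+1. s (- (a - c + - u - b i))) = (- 1) ^ (r + 1) * (\<Prod>i=1..r+1. s (a - c + - u - b i))"
      unfolding odd prod_uminus by simp_all
    have arith: "A / A' * (B1 / B2 / (B1' / B2')) = A / - A' * ((- 1) ^ r * B2' / B2) * (B1 / ((- 1) ^ (r + 1) * B1'))"
      for A A' B1 B2 B1' B2' :: complex by (simp add: power_add)
    show ?thesis unfolding u v ratio_def p unfolding odd[of "a - u"] unfolding diff_conv_add_uminus[of a u] by (rule arith)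
  qed
  note key = this
  have sw: "(\<Prod>l<m. \<Prod>i\<in>I. G l i) = (\<Prod>i\<in>I. \<Prod>l<m. G l i)" for G :: "nat \<Rightarrow> nat \<Rightarrow> complex" and I
    by (rule prod.swap)
  show ?thesis
    unfolding alt_ratio_parity[OF assms] prod.distrib[symmetric] key
    unfolding additive_rhs_def fac_def prod_dividef[symmetric]
    unfolding prod.distrib sw ..
qed

lemma isCont_fac: "isCont f z \<Longrightarrow> isCont (\<lambda>t. fac h (f t) n) z"
  unfolding fac_def by (intro continuous_intros)

text \<open>
  The parameters are moved along the line \<open>(a, b\<^sub>i, c) + t (2 r + 3, 4, 2)\<close>, which respects the
  balancing condition and meets every excluded hyperplane transversally.
\<close>

theorem sum_additive:
  fixes a c e :: complex and x b :: "nat \<Rightarrow> complex"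
  assumes X: "\<And>i j m::int. i \<in> {1..r} \<Longrightarrow> j \<in> {1..r} \<Longrightarrow> i \<noteq> j \<Longrightarrow> \<bar>m\<bar> \<le> int N \<Longrightarrow> s (x i - x j + of_int m * (2 * e)) \<noteq> 0"
    and H: "\<And>m::int. m \<noteq> 0 \<Longrightarrow> s (of_int m * e) \<noteq> 0"
    and bal: "2 * a + e = (\<Sum>i=1..r+1. b i) + c + (\<Sum>i=1..r. x i)"
    and N: "N + 1 = 2 * m + d" "d \<le> 1"
    and a0: "s a \<noteq> 0"
    and den: "\<And>k n. k \<in> multi_indices r N \<Longrightarrow> n = weight r k \<Longrightarrow>
        fac (2 * e) (a + (of_nat N + 2) * e) n \<noteq> 0 \<and> fac (2 * e) (a + (1 - of_nat N) * e) n \<noteq> 0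
        \<and> (\<forall>i\<in>{1..r+1}. fac e (b i + c - a) n \<noteq> 0)
        \<and> (\<forall>i\<in>{1..r}. fac (2 * e) (c - x i) (n - k i) \<noteq> 0
            \<and> fac e (a + x i - c + (of_nat (k i) - of_nat n + 1) * e) (k i) \<noteq> 0
            \<and> (\<forall>j\<in>{1..r}. fac (2 * e) (2 * e + x i - x j) (k i) \<noteq> 0))"
    and rhs: "fac (2 * e) (of_nat d * e - a) m \<noteq> 0"
       "\<And>i. i \<in> {1..r} \<Longrightarrow> fac (2 * e) (a + x i + e + of_nat d * e - c) m \<noteq> 0"
       "\<And>i. i \<in> {1..r+1} \<Longrightarrow> fac (2 * e) (b i + c + of_nat d * e - a) m \<noteq> 0"
  shows "(\<Sum>k\<in>multi_indices r N. additive_summand r N e a b c x k) = additive_rhs r (of_nat d * e) m e a b c x"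
proof -
  \<comment> \<open>The balance is kept because \<open>2 (2 r + 3) = 4 (r + 1) + 2\<close>. The
    combinations \<open>a\<close>, \<open>a - c\<close>, \<open>a - c - b i\<close> move with the
    odd speeds \<open>2 r + 3\<close>, \<open>2 r + 1\<close>, \<open>2 r - 3\<close> and
    \<open>c\<close> with speed 2, so none stands still, whatever \<open>r\<close> is.\<close>
  define a' b' c' where "a' t = a + (2 * of_nat r + 3) * t" and "b' t i = b i + 4 * t" and "c' t = c + 2 * t" for t and i :: nat
  define f where "f t = (\<Sum>k\<in>multi_indices r N. additive_summand r N e (a' t) (b' t) (c' t) x k)" for t
  define g where "g t = additive_rhs r (of_nat d * e) m e (a' t) (b' t) (c' t) x" for t
  define B where "B = (\<Union>j::int. {t. s (a + of_int j * e + (2 * of_nat r + 3) * t) = 0}) \<union>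
     (\<Union>i. \<Union>j::int. {t. s (a + x i - c + of_int j * e + (2 * of_nat r + 1) * t) = 0}) \<union>
     (\<Union>i. \<Union>j::int. {t. s (c - x i + of_int j * e + 2 * t) = 0}) \<union>
     (\<Union>i. \<Union>j::int. {t. s (a - c - b i + of_int j * e + (2 * of_nat r - 3) * t) = 0})"
  have nz: "(2 * of_nat r + 3 :: complex) \<noteq> 0" "(2 * of_nat r + 1 :: complex) \<noteq> 0" "(2 * of_nat r - 3 :: complex) \<noteq> 0"
  proof -
    have "of_int (2 * int r + 3) \<noteq> (0::complex)" "of_int (2 * int r + 1) \<noteq> (0::complex)" "of_int (2 * int r - 3) \<noteq> (0::complex)"
      unfolding of_int_eq_0_iff by presburger+
    then show "(2 * of_nat r + 3 :: complex) \<noteq> 0" "(2 * of_nat r + 1 :: complex) \<noteq> 0" "(2 * of_nat r - 3 :: complex) \<noteq> 0" by simp_all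
  qed
  have "f 0 = g 0"
  proof (rule eq_at_0_of_eq_off_countable)
    show "countable B"
      unfolding B_def using nz by (intro countable_Un countable_UN countable_zeros_affine) auto
    have c0: "isCont a' 0" "isCont (\<lambda>t. b' t i) 0" "isCont c' 0" for i
      unfolding a'_def b'_def c'_def by (intro continuous_intros)+
    have z: "a' 0 = a" "b' 0 = b" "c' 0 = c" by (auto simp: a'_def b'_def c'_def)
    show "isCont f 0"
      unfolding f_def
    proof (intro continuous_sum)
      fix k assume k: "k \<in> multi_indices r N"
      show "isCont (\<lambda>t. additive_summand r N e (a' t) (b' t) (c' t) x k) 0"
        unfolding additive_summand_def Let_def
        using den[OF k refl] a0
        by (intro continuous_intros continuous_prod isCont_fac c0) (auto simp: z)
    qed
    show "isCont g 0"
      unfolding g_def additive_rhs_def using rhs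
      by (intro continuous_intros continuous_prod isCont_fac c0) (auto simp: z)
    show "f t = g t" if t: "t \<notin> B" for t
    proof -
      have t': "s (a + of_int j * e + (2 * of_nat r + 3) * t) \<noteq> 0" "s (a + x i - c + of_int j * e + (2 * of_nat r + 1) * t) \<noteq> 0"
         "s (c - x i + of_int j * e + 2 * t) \<noteq> 0" "s (a - c - b i + of_int j * e + (2 * of_nat r - 3) * t) \<noteq> 0" for i and j :: int
        using t by (auto simp: B_def)
      show ?thesis unfolding f_def g_def
      proof (subst sum_generic)
        show "2 * a' t + e = (\<Sum>i = 1..r + 1. b' t i) + c' t + (\<Sum>i = 1..r. x i)"
          using bal by (simp add: a'_def b'_def c'_def sum.distrib algebra_simps)
        show "alt_ratio (\<lambda>j. s (a' t + of_int j * e)) N * alt_ratio (\<lambda>j. ratio r x (b' t) (a' t - c' t + of_int j * e)) N =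
          additive_rhs r (of_nat d * e) m e (a' t) (b' t) (c' t) x"
          by (rule additive_rhs_eq[OF N])
        fix i and j :: int
        show "s (a' t + of_int j * e) \<noteq> 0" "s (a' t + x i - c' t + of_int j * e) \<noteq> 0"
          "s (c' t - x i + of_int j * e) \<noteq> 0" "s (a' t - c' t - b' t i + of_int j * e) \<noteq> 0"
          using t'(1)[of j] t'(2-4)[of i j] by (simp_all add: a'_def b'_def c'_def algebra_simps)
      qed (use X H in auto)
    qed
  qed
  moreover have "b' 0 = b" by (simp add: b'_def fun_eq_iff)
  ultimately show ?thesis by (simp add: f_def g_def a'_def c'_def)
qed

end

section \<open>The Jacobi triple product\<close>

definition pfac :: "complex \<Rightarrow> nat \<Rightarrow> complex" where
  "pfac p n = (\<Prod>j<n. 1 - p ^ (j + 1))"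

text \<open>Gaussian binomial coefficients. The Pascal recursion avoids quotients of
  \<open>pfac\<close>, which is the product \<open>(p; p)_n\<close> and vanishes at roots of
  unity.\<close>

fun gauss :: "complex \<Rightarrow> nat \<Rightarrow> nat \<Rightarrow> complex" where
  "gauss p m 0 = 1"
| "gauss p 0 (Suc i) = 0"
| "gauss p (Suc m) (Suc i) = gauss p m (Suc i) + p ^ (m - i) * gauss p m i"

lemma gauss_eq_0: "m < i \<Longrightarrow> gauss p m i = 0"
  by (induction p m i rule: gauss.induct) auto

lemma gauss_pfac: "i \<le> m \<Longrightarrow> gauss p m i * (pfac p i * pfac p (m - i)) = pfac p m"
proof (induction m arbitrary: i)
  case 0
  then show ?case by (simp add: pfac_def)
next
  case (Suc m)
  show ?case
  proof (cases i)
    case 0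
    then show ?thesis by (simp add: pfac_def)
  next
    case (Suc j)
    then have j: "j \<le> m" using Suc.prems by simp
    have 1: "gauss p m (Suc j) * (pfac p (Suc j) * pfac p (m - j)) = pfac p m * (1 - p ^ (m - j))"
    proof (cases "j = m")
      case True
      then show ?thesis by (simp add: gauss_eq_0)
    next
      case False
      then have "m - j = Suc (m - Suc j)" using j by simp
      then have "pfac p (m - j) = pfac p (m - Suc j) * (1 - p ^ (m - j))" by (simp add: pfac_def)
      then have "gauss p m (Suc j) * (pfac p (Suc j) * pfac p (m - j)) =
          gauss p m (Suc j) * (pfac p (Suc j) * pfac p (m - Suc j)) * (1 - p ^ (m - j))"
        by (simp only: mult.assoc)
      then show ?thesis using Suc.IH[of "Suc j"] False j by simp
    qed
    have 2: "gauss p m j * (pfac p (Suc j) * pfac p (m - j)) = pfac p m * (1 - p ^ Suc j)"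
      using Suc.IH[OF j] by (simp add: pfac_def algebra_simps)
    have 3: "p ^ (m - j) * p ^ Suc j = p ^ Suc m" using j by (simp flip: power_add)
    have "gauss p (Suc m) i * (pfac p i * pfac p (Suc m - i)) =
       gauss p m (Suc j) * (pfac p (Suc j) * pfac p (m - j)) + p ^ (m - j) * (gauss p m j * (pfac p (Suc j) * pfac p (m - j)))"
      unfolding Suc by (simp add: algebra_simps)
    also have "\<dots> = pfac p m * (1 - p ^ (m - j) + p ^ (m - j) * (1 - p ^ Suc j))"
      unfolding 1 2 by (simp add: algebra_simps)
    also have "\<dots> = pfac p m * (1 - p ^ Suc m)"
    proof -
      have "1 - p ^ (m - j) + p ^ (m - j) * (1 - p ^ Suc j) = 1 - p ^ (m - j) * p ^ Suc j"
        by (simp only: right_diff_distrib) simp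
      then show ?thesis unfolding 3 by simp
    qed
    also have "\<dots> = pfac p (Suc m)" by (simp add: pfac_def)
    finally show ?thesis .
  qed
qed

text \<open>Rothe's q-binomial theorem in base \<open>p\<close>. The Pascal recursion fits because
  \<open>Suc i choose 2\<close> exceeds \<open>i choose 2\<close> by \<open>i\<close>.\<close>

lemma gauss_binomial: "(\<Prod>j<m. 1 + x * p ^ j) = (\<Sum>i\<le>m. p ^ (i choose 2) * gauss p m i * x ^ i)"
proof (induction m)
  case 0
  then show ?case by (simp add: numeral_2_eq_2)
next
  case (Suc m)
  let ?f = "\<lambda>i. p ^ (i choose 2) * gauss p m i * x ^ i"
  have "(\<Sum>i\<le>Suc m. p ^ (i choose 2) * gauss p (Suc m) i * x ^ i) =
     1 + (\<Sum>i\<le>m. p ^ (Suc i choose 2) * gauss p (Suc m) (Suc i) * x ^ Suc i)"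
    by (subst sum.atMost_Suc_shift) (simp add: numeral_2_eq_2)
  also have "(\<Sum>i\<le>m. p ^ (Suc i choose 2) * gauss p (Suc m) (Suc i) * x ^ Suc i) =
     (\<Sum>i\<le>m. ?f (Suc i)) + x * p ^ m * (\<Sum>i\<le>m. ?f i)"
    unfolding sum_distrib_left sum.distrib[symmetric]
  proof (rule sum.cong[OF refl])
    fix i assume "i \<in> {..m}"
    then have "p ^ (Suc i choose 2) * p ^ (m - i) = p ^ m * p ^ (i choose 2)"
      by (simp add: numeral_2_eq_2 add.commute flip: power_add)
    then show "p ^ (Suc i choose 2) * gauss p (Suc m) (Suc i) * x ^ Suc i = ?f (Suc i) + x * p ^ m * ?f i"
      by (simp add: algebra_simps)
  qed
  also have "1 + ((\<Sum>i\<le>m. ?f (Suc i)) + x * p ^ m * (\<Sum>i\<le>m. ?f i)) = (\<Sum>i\<le>Suc m. ?f i) + x * p ^ m * (\<Sum>i\<le>m. ?f i)"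
    by (subst sum.atMost_Suc_shift) (simp add: numeral_2_eq_2)
  also have "(\<Sum>i\<le>Suc m. ?f i) = (\<Sum>i\<le>m. ?f i)" by (simp add: gauss_eq_0)
  finally show ?case using Suc by (simp add: algebra_simps)
qed

definition jacobi_term :: "complex \<Rightarrow> complex \<Rightarrow> int \<Rightarrow> complex" where
  "jacobi_term p z k = (- z) powi k * p powi (k * (k - 1) div 2)"

lemma choose_two_int: "int (i choose 2) = int i * (int i - 1) div 2"
  by (cases i) (simp_all add: choose_two zdiv_int of_nat_diff algebra_simps)

text \<open>Rothe's product with \<open>2 n\<close> factors at \<open>x = - z / p ^ n\<close>: the
  upper half gives \<open>1 - p ^ j * z\<close> directly; the lower half, read backwards, gives
  \<open>1 - p ^ (j + 1) / z\<close> up to a monomial that \<open>c\<close> compensates.\<close>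

lemma finite_jacobi:
  assumes p: "p \<noteq> 0" and z: "z \<noteq> 0"
  shows "(\<Prod>j<n. (1 - p ^ j * z) * (1 - p ^ (j + 1) / z)) = (\<Sum>i\<le>2*n. gauss p (2 * n) i * jacobi_term p z (int i - int n))"
proof -
  define x where "x = - z / p ^ n"
  define c where "c = (- z) powi (- int n) * p powi (int n * (int n + 1) div 2)"
  have c0: "(\<Prod>j<n. 1 + x * p ^ j) * c = (\<Prod>j<n. 1 - p ^ (j + 1) / z)"
  proof -
    have "(\<Prod>j<n. 1 + x * p ^ j) = (\<Prod>j<n. 1 + x * p ^ (n - Suc j))"
      by (rule prod.nat_diff_reindex[symmetric])
    also have "\<dots> = (\<Prod>j<n. (1 - p ^ (j + 1) / z) * (- z / p ^ (j + 1)))"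
    proof (rule prod.cong[OF refl])
      fix j assume "j \<in> {..<n}"
      then have "p ^ n = p ^ (n - Suc j) * p ^ (j + 1)" using power_add[of p "n - Suc j" "j + 1"] by simp
      then show "1 + x * p ^ (n - Suc j) = (1 - p ^ (j + 1) / z) * (- z / p ^ (j + 1))"
        using p z unfolding x_def by (simp add: field_simps)
    qed
    also have "\<dots> = (\<Prod>j<n. 1 - p ^ (j + 1) / z) * (\<Prod>j<n. - z / p ^ (j + 1))"
      by (rule prod.distrib)
    also have "(\<Prod>j<n. - z / p ^ (j + 1)) = (- z) powi (int n) * p powi (- (int n * (int n + 1) div 2))" for n
    proof (induction n)
      case (Suc n)
      have "int (Suc n) * (int (Suc n) + 1) div 2 = int n * (int n + 1) div 2 + int (n + 1)"
      proof -
        have "int (Suc n) * (int (Suc n) + 1) = int n * (int n + 1) + 2 * int (n + 1)" by (simp add: algebra_simps)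
        then show ?thesis by simp
      qed
      then have "p powi (- (int (Suc n) * (int (Suc n) + 1) div 2)) = p powi (- (int n * (int n + 1) div 2)) / p ^ (n + 1)"
        using p by (simp add: power_int_diff power_int_minus power_int_add divide_simps)
      then show ?case using Suc z by (simp add: power_int_add)
    qed simp
    finally have "(\<Prod>j<n. 1 + x * p ^ j) * c = (\<Prod>j<n. 1 - p ^ (j + 1) / z) * (((- z) powi (int n) * (- z) powi (- int n)) *
        (p powi (- (int n * (int n + 1) div 2)) * p powi (int n * (int n + 1) div 2)))"
      unfolding c_def by (simp add: mult_ac)
    moreover have "(- z) powi (int n) * (- z) powi (- int n) = 1" "p powi (- (int n * (int n + 1) div 2)) * p powi (int n * (int n + 1) div 2) = 1"
      using p z by (simp_all add: power_int_minus)
    ultimately show ?thesis by (simp only: mult_1_right)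
  qed
  have "(\<Prod>j<2*n. 1 + x * p ^ j) = (\<Prod>j<n. 1 + x * p ^ j) * (\<Prod>j<n. 1 - p ^ j * z)"
  proof -
    have "(\<Prod>j<n+m. 1 + x * p ^ j) = (\<Prod>j<n. 1 + x * p ^ j) * (\<Prod>j<m. 1 - p ^ j * z)" for m
      by (induction m) (use p in \<open>simp_all add: x_def power_add mult_ac\<close>)
    from this[of n] show ?thesis by (simp add: mult_2)
  qed
  then have "(\<Prod>j<n. (1 - p ^ j * z) * (1 - p ^ (j + 1) / z)) = c * (\<Prod>j<2*n. 1 + x * p ^ j)"
    unfolding prod.distrib c0[symmetric] by (simp add: mult_ac)
  also have "\<dots> = (\<Sum>i\<le>2*n. gauss p (2 * n) i * jacobi_term p z (int i - int n))"
    unfolding gauss_binomial sum_distrib_left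
  proof (rule sum.cong[OF refl])
    fix i
    have e: "int n * (int n + 1) div 2 + int (i choose 2) - int n * int i = (int i - int n) * (int i - int n - 1) div 2"
    proof -
      have "even (int n * (int n + 1))" "even (int i * (int i - 1))" by simp_all
      then obtain u v where uv: "int n * (int n + 1) = 2 * u" "int i * (int i - 1) = 2 * v" by (elim evenE)
      have "(int i - int n) * (int i - int n - 1) = 2 * (u + v - int n * int i)"
        using uv by (simp add: algebra_simps)
      then show ?thesis unfolding choose_two_int uv by simp
    qed
    have x: "x ^ i = (- z) powi int i * p powi (- (int n * int i))"
    proof -
      have "p powi (- (int n * int i)) = inverse ((p ^ n) ^ i)"
        unfolding of_nat_mult[symmetric] power_int_minus power_int_of_nat power_mult ..
      then show ?thesis unfolding x_def power_divide by (simp add: divide_inverse)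
    qed
    have "c * (p ^ (i choose 2) * x ^ i) = ((- z) powi (- int n) * (- z) powi int i) *
        (p powi (int n * (int n + 1) div 2) * p powi int (i choose 2) * p powi (- (int n * int i)))"
      unfolding x c_def by (simp add: mult_ac)
    also have "\<dots> = jacobi_term p z (int i - int n)"
    proof -
      have "(- z) powi (int i - int n) = (- z) powi (- int n) * (- z) powi int i"
        using power_int_add[of "- z" "- int n" "int i"] z by simp
      moreover have "p powi (int n * (int n + 1) div 2 + int (i choose 2) - int n * int i) =
          p powi (int n * (int n + 1) div 2) * p powi int (i choose 2) * p powi (- (int n * int i))"
        using p by (simp only: diff_conv_add_uminus power_int_add disj_not1 simp_thms)
      ultimately show ?thesis unfolding jacobi_term_def e[symmetric] by (simp only:)
    qed
    finally show "c * (p ^ (i choose 2) * gauss p (2 * n) i * x ^ i) = gauss p (2 * n) i * jacobi_term p z (int i - int n)"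
      by (simp add: mult_ac)
  qed
  finally show ?thesis .
qed

lemma one_minus_power_nonzero:
  fixes p :: complex
  assumes "norm p < 1"
  shows "1 - p ^ (j + 1) \<noteq> 0"
proof
  assume "1 - p ^ (j + 1) = 0"
  then have "norm p ^ (j + 1) = 1" by (metis norm_power norm_one eq_iff_diff_eq_0)
  moreover have "norm p ^ (j + 1) < 1" using power_Suc_less_one[of "norm p" j] assms by (cases "p = 0") auto
  ultimately show False by simp
qed

lemma pfac_nonzero: "norm p < 1 \<Longrightarrow> pfac p n \<noteq> 0"
  using one_minus_power_nonzero[of p] by (auto simp: pfac_def)

lemma pfac_tendsto:
  assumes "norm p < 1"
  obtains L where "L \<noteq> 0" "pfac p \<longlonglongrightarrow> L"
proof -
  have "summable (\<lambda>j. norm (p ^ (j + 1)))"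
    using assms by (simp add: norm_mult norm_power summable_mult summable_geometric)
  then have conv: "convergent_prod (\<lambda>j. 1 - p ^ (j + 1))"
    by (intro abs_convergent_prod_imp_convergent_prod) (simp add: abs_convergent_prod_conv_summable)
  have "prodinf (\<lambda>j. 1 - p ^ (j + 1)) \<noteq> 0" using conv one_minus_power_nonzero[OF assms] by (rule prodinf_nonzero)
  moreover have "pfac p \<longlonglongrightarrow> prodinf (\<lambda>j. 1 - p ^ (j + 1))"
    unfolding pfac_def using has_prod_imp_tendsto'[OF convergent_prod_has_prod[OF conv]] .
  ultimately show ?thesis using that by blast
qed

lemma gauss_eq:
  assumes "norm p < 1" "i \<le> m"
  shows "gauss p m i = pfac p m / (pfac p i * pfac p (m - i))"
  using gauss_pfac[OF assms(2), of p] pfac_nonzero[OF assms(1)] by (simp add: eq_divide_eq)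

text \<open>Both \<open>pfac p\<close> and its reciprocal are bounded because the limit of
  \<open>pfac p\<close> is not zero. This supplies the majorant for Tannery's theorem.\<close>

lemma gauss_bounded:
  assumes "norm p < 1"
  obtains K where "\<And>m i. norm (gauss p m i) \<le> K"
proof -
  obtain L where L: "L \<noteq> 0" "pfac p \<longlonglongrightarrow> L" using pfac_tendsto[OF assms] .
  have "Bseq (pfac p)" using L(2) by (intro convergent_imp_Bseq convergentI)
  then obtain C where C: "\<And>n. norm (pfac p n) \<le> C" "C > 0" by (auto simp: Bseq_def)
  have "(\<lambda>n. inverse (pfac p n)) \<longlonglongrightarrow> inverse L" using L by (intro tendsto_inverse)
  then have "Bseq (\<lambda>n. inverse (pfac p n))" by (intro convergent_imp_Bseq convergentI)
  then obtain D where D: "\<And>n. norm (inverse (pfac p n)) \<le> D" "D > 0" by (auto simp: Bseq_def)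
  have "norm (gauss p m i) \<le> C * (D * D)" for m i
  proof (cases "i \<le> m")
    case True
    have "norm (gauss p m i) = norm (pfac p m) * (norm (inverse (pfac p i)) * norm (inverse (pfac p (m - i))))"
      unfolding gauss_eq[OF assms True] by (simp add: norm_divide norm_mult norm_inverse divide_inverse)
    also have "\<dots> \<le> C * (D * D)"
      using C D by (intro mult_mono) (auto intro: less_imp_le)
    finally show ?thesis .
  next
    case False
    then show ?thesis using C D by (simp add: gauss_eq_0)
  qed
  then show ?thesis using that by blast
qed

lemma gauss_tendsto:
  assumes "norm p < 1" "L \<noteq> 0" "pfac p \<longlonglongrightarrow> L"
  shows "(\<lambda>n. gauss p (2 * n) (n + k)) \<longlonglongrightarrow> 1 / L" "(\<lambda>n. gauss p (2 * n) (n - k)) \<longlonglongrightarrow> 1 / L"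
proof -
  have f1: "filterlim (\<lambda>n. 2 * n :: nat) at_top sequentially" "filterlim (\<lambda>n. n + k :: nat) at_top sequentially"
    "filterlim (\<lambda>n. n - k :: nat) at_top sequentially"
    by (rule filterlim_at_top_mono[OF filterlim_ident]; simp)
       (simp_all add: filterlim_add_const_nat_at_top filterlim_minus_const_nat_at_top)
  have "(\<lambda>n. pfac p (2 * n) / (pfac p (n + k) * pfac p (n - k))) \<longlonglongrightarrow> L / (L * L)"
    by (intro tendsto_intros filterlim_compose[OF assms(3)] f1) (use assms in auto)
  then have l: "(\<lambda>n. pfac p (2 * n) / (pfac p (n + k) * pfac p (n - k))) \<longlonglongrightarrow> 1 / L" using assms(2) by simp
  have ev: "\<forall>\<^sub>F n in sequentially. pfac p (2 * n) / (pfac p (n + k) * pfac p (n - k)) = gauss p (2 * n) (n + k)"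
    "\<forall>\<^sub>F n in sequentially. pfac p (2 * n) / (pfac p (n + k) * pfac p (n - k)) = gauss p (2 * n) (n - k)"
    using eventually_ge_at_top[of k]
    by (eventually_elim; simp add: gauss_eq[OF assms(1)] mult_2 mult.commute)+
  show "(\<lambda>n. gauss p (2 * n) (n + k)) \<longlonglongrightarrow> 1 / L" "(\<lambda>n. gauss p (2 * n) (n - k)) \<longlonglongrightarrow> 1 / L"
    using l tendsto_cong[OF ev(1)] tendsto_cong[OF ev(2)] by simp_all
qed

lemma jacobi_term_Suc:
  assumes "p \<noteq> 0" "z \<noteq> 0"
  shows "jacobi_term p z (k + 1) = - z * p powi k * jacobi_term p z k"
proof -
  have "(k + 1) * (k + 1 - 1) = k * (k - 1) + 2 * k" by (simp add: algebra_simps)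
  then have "(k + 1) * (k + 1 - 1) div 2 = k * (k - 1) div 2 + k" by simp
  then show ?thesis using assms unfolding jacobi_term_def by (simp add: power_int_add)
qed

lemma jacobi_term_reflect:
  assumes "p \<noteq> 0" "z \<noteq> 0"
  shows "jacobi_term p z (1 - k) = - z * jacobi_term p (1 / z) k"
proof -
  have "(1 - k) * (1 - k - 1) div 2 = k * (k - 1) div 2" by (simp add: algebra_simps)
  moreover have "(- z) powi (1 - k) = - z * (- (1 / z)) powi k"
    using assms by (simp add: power_int_diff power_int_divide_distrib minus_divide_right del: minus_divide_left minus_divide_right)
      (simp add: field_simps power_int_minus_left)
  ultimately show ?thesis unfolding jacobi_term_def by simp
qed

lemma summable_jacobi:
  assumes p: "p \<noteq> 0" "norm p < 1" and z: "z \<noteq> 0"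
  shows "summable (\<lambda>k. norm (jacobi_term p z (int k)))" "summable (\<lambda>k. norm (jacobi_term p z (- 1 - int k)))"
proof -
  have 1: "summable (\<lambda>k. norm (jacobi_term p z (int k)))" if "z \<noteq> 0" for z
  proof -
    have "(\<lambda>n. norm z * norm p ^ n) \<longlonglongrightarrow> norm z * 0"
      using p by (intro tendsto_intros) auto
    then have "\<forall>\<^sub>F n in sequentially. norm z * norm p ^ n < 1 / 2"
      by (rule order_tendstoD) simp
    then obtain N where N: "\<And>n. n \<ge> N \<Longrightarrow> norm z * norm p ^ n < 1 / 2"
      by (auto simp: eventually_sequentially)
    show ?thesis
    proof (rule summable_ratio_test[of "1 / 2" N])
      fix n assume "n \<ge> N"
      have "norm (jacobi_term p z (int (Suc n))) = norm z * norm p ^ n * norm (jacobi_term p z (int n))"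
        using jacobi_term_Suc[OF p(1) that, of "int n"] by (simp add: norm_mult norm_power add.commute)
      also have "\<dots> \<le> 1 / 2 * norm (jacobi_term p z (int n))"
        using N[OF \<open>n \<ge> N\<close>] by (intro mult_right_mono) auto
      finally show "norm (norm (jacobi_term p z (int (Suc n)))) \<le> 1 / 2 * norm (norm (jacobi_term p z (int n)))" by simp
    qed simp
  qed
  show "summable (\<lambda>k. norm (jacobi_term p z (int k)))" using 1[OF z] .
  have "jacobi_term p z (- 1 - int k) = - z * jacobi_term p (1 / z) (int (k + 2))" for k
    using jacobi_term_reflect[OF p(1) z, of "int (k + 2)"] by simp
  moreover have "summable (\<lambda>k. norm (jacobi_term p (1 / z) (int (k + 2))))"
    using 1[of "1 / z"] z by (simp only: summable_iff_shift[of "\<lambda>k. norm (jacobi_term p (1 / z) (int k))"]) simp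
  ultimately show "summable (\<lambda>k. norm (jacobi_term p z (- 1 - int k)))"
    by (simp add: norm_mult summable_mult)
qed

lemma tannery_finite:
  fixes G :: "nat \<Rightarrow> nat \<Rightarrow> complex"
  assumes "\<And>k. (\<lambda>n. G n k) \<longlonglongrightarrow> l" "\<And>n k. norm (G n k) \<le> K" "summable (\<lambda>k. norm (u k))"
    and h: "filterlim h at_top sequentially"
  shows "(\<lambda>n. \<Sum>k<h n. G n k * u k) \<longlonglongrightarrow> l * (\<Sum>k. u k)"
proof -
  have "K \<ge> 0" using assms(2)[of 0 0] norm_ge_zero order_trans by blast
  have "(\<lambda>n. suminf (\<lambda>k. if k < h n then G n k * u k else 0)) \<longlonglongrightarrow> (\<Sum>k. l * u k)"
  proof (rule tannerys_theorem[THEN conjunct2, THEN conjunct2])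
    fix k
    have "\<forall>\<^sub>F n in sequentially. k < h n" using eventually_compose_filterlim[OF eventually_gt_at_top h] .
    then have "\<forall>\<^sub>F n in sequentially. G n k * u k = (if k < h n then G n k * u k else 0)"
      by eventually_elim simp
    moreover have "(\<lambda>n. G n k * u k) \<longlonglongrightarrow> l * u k" by (intro tendsto_intros assms)
    ultimately show "(\<lambda>n. if k < h n then G n k * u k else 0) \<longlonglongrightarrow> l * u k"
      by (rule Lim_transform_eventually[rotated])
  next
    show "\<forall>\<^sub>F (k, n) in sequentially \<times>\<^sub>F sequentially. norm (if k < h n then G n k * u k else 0) \<le> K * norm (u k)"
      using assms(2) \<open>K \<ge> 0\<close> by (intro always_eventually) (auto simp: norm_mult intro!: mult_right_mono)
    show "summable (\<lambda>k. K * norm (u k))" by (intro summable_mult assms)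
  qed simp
  moreover have "suminf (\<lambda>k. if k < h n then G n k * u k else 0) = (\<Sum>k<h n. G n k * u k)" for n
    by (subst suminf_finite[of "{..<h n}"]) auto
  moreover have "(\<Sum>k. l * u k) = l * (\<Sum>k. u k)"
    by (rule suminf_mult[OF summable_norm_cancel[OF assms(3)]])
  ultimately show ?thesis by simp
qed

text \<open>\<open>L\<close> is the limit of \<open>(p; p)_n\<close>. The limit in
  \<open>finite_jacobi\<close> is taken separately over the indices \<open>k \<ge> 0\<close> and
  \<open>k < 0\<close>, each half being a dominated series over the naturals.\<close>

lemma jacobi_triple:
  assumes p: "p \<noteq> 0" "norm p < 1" and L: "L \<noteq> 0" "pfac p \<longlonglongrightarrow> L" and z: "z \<noteq> 0"
  shows "(jacobi_term p z has_sum L * theta z p) UNIV" "(\<lambda>k. norm (jacobi_term p z k)) summable_on UNIV"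
proof -
  obtain K where K: "\<And>m i. norm (gauss p m i) \<le> K" using gauss_bounded[OF p(2)] by blast
  let ?u = "\<lambda>k. jacobi_term p z (int k)" and ?v = "\<lambda>k. jacobi_term p z (- 1 - int k)"
  note sm = summable_jacobi[OF p z]
  have "(\<lambda>n. \<Sum>k<Suc n. gauss p (2 * n) (n + k) * ?u k) \<longlonglongrightarrow> 1 / L * (\<Sum>k. ?u k)"
    by (rule tannery_finite[OF gauss_tendsto(1)[OF p(2) L] K sm(1)]) (rule filterlim_Suc)
  moreover have "(\<lambda>n. \<Sum>k<n. gauss p (2 * n) (n - (k + 1)) * ?v k) \<longlonglongrightarrow> 1 / L * (\<Sum>k. ?v k)"
    by (rule tannery_finite[OF gauss_tendsto(2)[OF p(2) L] K sm(2)]) (rule filterlim_ident)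
  ultimately have "(\<lambda>n. (\<Sum>k<Suc n. gauss p (2 * n) (n + k) * ?u k) + (\<Sum>k<n. gauss p (2 * n) (n - (k + 1)) * ?v k))
     \<longlonglongrightarrow> 1 / L * (\<Sum>k. ?u k) + 1 / L * (\<Sum>k. ?v k)"
    by (rule tendsto_add)
  moreover have "(\<Sum>k<Suc n. gauss p (2 * n) (n + k) * ?u k) + (\<Sum>k<n. gauss p (2 * n) (n - (k + 1)) * ?v k) =
     (\<Prod>j<n. (1 - p ^ j * z) * (1 - p ^ (j + 1) / z))" for n
  proof -
    let ?g = "\<lambda>i. gauss p (2 * n) i * jacobi_term p z (int i - int n)"
    have "(\<Sum>i<n + m. ?g i) = (\<Sum>i<n. ?g i) + (\<Sum>k<m. ?g (n + k))" for m
      by (induction m) simp_all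
    from this[of "Suc n"] have "(\<Sum>i\<le>2*n. ?g i) = (\<Sum>i<n. ?g i) + (\<Sum>k<Suc n. ?g (n + k))"
      by (simp only: add_Suc_right lessThan_Suc_atMost mult_2)
    moreover have "(\<Sum>i<n. ?g i) = (\<Sum>i<n. ?g (n - Suc i))" by (rule sum.nat_diff_reindex[symmetric])
    moreover have "(\<Sum>i<n. ?g (n - Suc i)) = (\<Sum>k<n. gauss p (2 * n) (n - (k + 1)) * ?v k)"
      by (intro sum.cong refl) (simp add: of_nat_diff)
    ultimately show ?thesis unfolding finite_jacobi[OF p(1) z] by simp
  qed
  moreover have "(\<lambda>n. \<Prod>j<n. (1 - p ^ j * z) * (1 - p ^ (j + 1) / z)) \<longlonglongrightarrow> theta z p"
    by (rule has_prod_imp_tendsto'[OF theta_has_prod[OF p(2)]])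
  ultimately have "theta z p = 1 / L * (\<Sum>k. ?u k) + 1 / L * (\<Sum>k. ?v k)"
    using LIMSEQ_unique by simp
  then have th: "L * theta z p = (\<Sum>k. ?u k) + (\<Sum>k. ?v k)" using L(1) by (simp add: field_simps)
  have b1: "bij_betw int UNIV {0..}" by (rule bij_betwI[where g = nat]) auto
  have b2: "bij_betw (\<lambda>k. - 1 - int k) UNIV {..<0}" by (rule bij_betwI[where g = "\<lambda>k. nat (- 1 - k)"]) auto
  have un: "{0..} \<union> {..<0} = (UNIV :: int set)" by auto
  have "(jacobi_term p z has_sum (\<Sum>k. ?u k)) {0..}"
    unfolding has_sum_reindex_bij_betw[OF b1, of "jacobi_term p z", symmetric]
    by (rule norm_summable_imp_has_sum[OF sm(1) summable_sums[OF summable_norm_cancel[OF sm(1)]]])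
  moreover have "(jacobi_term p z has_sum (\<Sum>k. ?v k)) {..<0}"
    unfolding has_sum_reindex_bij_betw[OF b2, of "jacobi_term p z", symmetric]
    by (rule norm_summable_imp_has_sum[OF sm(2) summable_sums[OF summable_norm_cancel[OF sm(2)]]])
  ultimately have "(jacobi_term p z has_sum (L * theta z p)) ({0..} \<union> {..<0})"
    unfolding th by (rule has_sum_Un_disjoint) auto
  then show "(jacobi_term p z has_sum L * theta z p) UNIV" by (simp only: un)
  then show "(\<lambda>k. norm (jacobi_term p z k)) summable_on UNIV"
    using summable_on_iff_abs_summable_on_complex summable_on_def by blast
qed

section \<open>Rank two of the theta product\<close>

lemma has_sum_times:
  fixes f :: "'a \<Rightarrow> complex" and g :: "'b \<Rightarrow> complex"
  assumes "(f has_sum a) A" "(\<lambda>x. norm (f x)) summable_on A" "(g has_sum b) B" "(\<lambda>x. norm (g x)) summable_on B"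
  shows "((\<lambda>(x, y). f x * g y) has_sum a * b) (A \<times> B)"
proof (rule has_sum_SigmaI[where g = "\<lambda>x. f x * b"])
  show "((\<lambda>y. case (x, y) of (x, y) \<Rightarrow> f x * g y) has_sum f x * b) B" for x
    using has_sum_cmult_right[OF assms(3), of "f x"] by simp
  show "((\<lambda>x. f x * b) has_sum a * b) A"
    using has_sum_cmult_left[OF assms(1), of b] by simp
  have "(\<lambda>p. norm (case p of (x, y) \<Rightarrow> f x * g y)) summable_on A \<times> B"
  proof (rule Infinite_Sum.abs_summable_on_Sigma_iff[THEN iffD2], intro conjI ballI)
    fix x
    show "(\<lambda>y. norm (case (x, y) of (x, y) \<Rightarrow> f x * g y)) summable_on B"
      using summable_on_cmult_right[OF assms(4), of "norm (f x)"] by (simp add: norm_mult)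
    show "(\<lambda>x. norm (\<Sum>\<^sub>\<infinity>y\<in>B. norm (case (x, y) of (x, y) \<Rightarrow> f x * g y))) summable_on A"
      using summable_on_cmult_left[OF assms(2), of "\<Sum>\<^sub>\<infinity>y\<in>B. norm (g y)"]
      by (simp add: norm_mult infsum_cmult_right' abs_mult infsum_nonneg)
  qed
  then show "(\<lambda>(x, y). f x * g y) summable_on A \<times> B"
    by (rule abs_summable_summable)
qed

text \<open>Makes a product of terms a single exponential, so that the rearrangement in
  \<open>theta_product\<close> is an identity between quadratic polynomials.\<close>

lemma jacobi_term_exp:
  assumes "- z = exp a"
  shows "jacobi_term (exp c) z k = exp (of_int k * a + c * (of_int k * (of_int k - 1) / 2))"
proof -
  have "even (k * (k - 1))" by simp
  then obtain m where m: "k * (k - 1) = 2 * m" by (elim evenE)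
  have "of_int k * (of_int k - 1) = (of_int (k * (k - 1)) :: complex)" by simp
  then have "of_int (k * (k - 1) div 2) = (of_int k * (of_int k - 1) / 2 :: complex)"
    unfolding m by simp
  then show ?thesis unfolding jacobi_term_def assms exp_power_int exp_add mult.commute[of c] by (simp only:)
qed

lemma exp_two_pi_int: "exp (of_int u * (2 * of_real pi * \<i>)) = 1"
  using exp_integer_2pi[of "of_int u"] by (simp add: mult_ac)

text \<open>The double series is split by the parity of \<open>m + n\<close>. With
  \<open>n = u - v\<close> and \<open>m = u + v\<close> or \<open>m = u + v + 1\<close> the
  quadratic exponent separates into \<open>u\<close> and \<open>v\<close>, and each half is a
  product of two theta series in base \<open>p * p\<close>.\<close>

lemma theta_product:
  assumes p: "p \<noteq> 0" "norm p < 1" and L: "L \<noteq> 0" "pfac p \<longlonglongrightarrow> L" and z: "z \<noteq> 0" and y: "y \<noteq> 0"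
  defines "\<alpha> \<equiv> \<lambda>w. infsum (jacobi_term (p * p) (- w * w)) UNIV"
    and "\<beta> \<equiv> \<lambda>w. infsum (jacobi_term (p * p) (- p * w * w)) UNIV"
  shows "L * theta (z * y) p * (L * theta (z / y) p) = \<alpha> z * \<beta> y - z / y * (\<beta> z * \<alpha> y)"
proof -
  obtain a b c where e: "z = exp a" "y = exp b" "p = exp c" using z y p(1) by (metis exp_Ln)
  let ?pi = "of_real pi * \<i> :: complex"
  have pp: "p * p \<noteq> 0" "norm (p * p) < 1"
    using p mult_strict_mono'[of "norm p" 1 "norm p" 1] by (simp_all add: norm_mult)
  obtain L2 where L2: "L2 \<noteq> 0" "pfac (p * p) \<longlonglongrightarrow> L2" using pfac_tendsto[OF pp(2)] .
  have pp_exp: "p * p = exp (2 * c)" by (simp add: e exp_double power2_eq_square)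
  have ja: "(jacobi_term (p * p) (- w * w) has_sum \<alpha> w) UNIV" "(\<lambda>k. norm (jacobi_term (p * p) (- w * w) k)) summable_on UNIV"
    and jb: "(jacobi_term (p * p) (- p * w * w) has_sum \<beta> w) UNIV" "(\<lambda>k. norm (jacobi_term (p * p) (- p * w * w) k)) summable_on UNIV"
    if "w \<noteq> 0" for w
  proof -
    have "- w * w \<noteq> 0" "- p * w * w \<noteq> 0" using that p(1) by simp_all
    note J = jacobi_triple[OF pp L2 this(1)] jacobi_triple[OF pp L2 this(2)]
    show "(jacobi_term (p * p) (- w * w) has_sum \<alpha> w) UNIV" "(jacobi_term (p * p) (- p * w * w) has_sum \<beta> w) UNIV"
      unfolding \<alpha>_def \<beta>_def by (rule has_sum_infsum[OF has_sum_imp_summable[OF J(1)]] has_sum_infsum[OF has_sum_imp_summable[OF J(3)]])+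
    show "(\<lambda>k. norm (jacobi_term (p * p) (- w * w) k)) summable_on UNIV" "(\<lambda>k. norm (jacobi_term (p * p) (- p * w * w) k)) summable_on UNIV"
      by (rule J)+
  qed
  have t1: "jacobi_term (exp c) (z * y) k = exp (of_int k * (a + b + ?pi) + c * (of_int k * (of_int k - 1) / 2))"
    and t2: "jacobi_term (exp c) (z / y) k = exp (of_int k * (a - b + ?pi) + c * (of_int k * (of_int k - 1) / 2))"
    and t3: "jacobi_term (exp (2 * c)) (- z * z) k = exp (of_int k * (2 * a) + 2 * c * (of_int k * (of_int k - 1) / 2))"
    and t4: "jacobi_term (exp (2 * c)) (- y * y) k = exp (of_int k * (2 * b) + 2 * c * (of_int k * (of_int k - 1) / 2))"
    and t5: "jacobi_term (exp (2 * c)) (- exp c * z * z) k = exp (of_int k * (c + 2 * a) + 2 * c * (of_int k * (of_int k - 1) / 2))"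
    and t6: "jacobi_term (exp (2 * c)) (- exp c * y * y) k = exp (of_int k * (c + 2 * b) + 2 * c * (of_int k * (of_int k - 1) / 2))" for k
    by (rule jacobi_term_exp; simp add: e exp_add exp_diff exp_double power2_eq_square)+
  define F where "F = (\<lambda>(m, n). jacobi_term p (z * y) m * jacobi_term p (z / y) n)"
  have tot: "(F has_sum (L * theta (z * y) p * (L * theta (z / y) p))) UNIV"
    unfolding F_def using has_sum_times[OF jacobi_triple[OF p L, of "z * y"] jacobi_triple[OF p L, of "z / y"]] z y by simp
  let ?E = "{(m :: int, n). even (m + n)}" and ?O = "{(m :: int, n). odd (m + n)}"
  have h: "even (m + n) \<Longrightarrow> (m + n) div 2 + (m - n) div 2 = m" "even (m + n) \<Longrightarrow> (m + n) div 2 - (m - n) div 2 = n"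
    "odd (m + n) \<Longrightarrow> (m + n) div 2 + (m - n) div 2 + 1 = m" "odd (m + n) \<Longrightarrow> (m + n) div 2 - (m - n) div 2 = n"
    for m n :: int by presburger+
  have bE: "bij_betw (\<lambda>(u, v). (u + v, u - v)) UNIV ?E"
    by (rule bij_betwI[where g = "\<lambda>(m, n). ((m + n) div 2, (m - n) div 2)"]) (auto simp: h)
  have bO: "bij_betw (\<lambda>(u, v). (u + v + 1, u - v)) UNIV ?O"
    by (rule bij_betwI[where g = "\<lambda>(m, n). ((m + n) div 2, (m - n) div 2)"]) (auto simp: h)
  \<comment> \<open>The minus sign in each of the two terms is written as
    \<open>exp (pi * \<i>)\<close>; it occurs \<open>(u + v) + (u - v) = 2 u\<close> times in all
    and gives a trivial factor.\<close>
  have FE: "F (u + v, u - v) = jacobi_term (p * p) (- z * z) u * jacobi_term (p * p) (- p * y * y) v" for u v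
  proof -
    have "F (u + v, u - v) = exp (of_int u * (2 * of_real pi * \<i>)) * (jacobi_term (p * p) (- z * z) u * jacobi_term (p * p) (- p * y * y) v)"
      unfolding F_def prod.case unfolding pp_exp unfolding e(3) t1 t2 t3 t4 t5 t6 unfolding exp_add[symmetric]
      by (rule arg_cong[of _ _ exp]) (simp add: field_simps)
    then show ?thesis by (simp only: exp_two_pi_int mult_1_left)
  qed
  \<comment> \<open>Here one minus sign is left over, and the index \<open>v + 1\<close> makes the
    same two series appear with the roles of \<open>z\<close> and \<open>y\<close>
    exchanged.\<close>
  have FO: "F (u + v + 1, u - v) = - (z / y) * (jacobi_term (p * p) (- p * z * z) u * jacobi_term (p * p) (- y * y) (v + 1))" for u v
  proof -
    have "F (u + v + 1, u - v) = exp (of_int u * (2 * of_real pi * \<i>)) * (exp ?pi * (exp (a - b) * (jacobi_term (p * p) (- p * z * z) u * jacobi_term (p * p) (- y * y) (v + 1))))"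
      unfolding F_def prod.case unfolding pp_exp unfolding e(3) t1 t2 t3 t4 t5 t6 unfolding exp_add[symmetric]
      by (rule arg_cong[of _ _ exp]) (simp add: field_simps)
    then show ?thesis unfolding exp_two_pi_int by (simp add: e exp_diff)
  qed
  have "((\<lambda>(u, v). jacobi_term (p * p) (- z * z) u * jacobi_term (p * p) (- p * y * y) v) has_sum (\<alpha> z * \<beta> y)) (UNIV \<times> UNIV)"
    by (rule has_sum_times) (use ja jb z y in auto)
  then have "((\<lambda>x. F ((\<lambda>(u, v). (u + v, u - v)) x)) has_sum (\<alpha> z * \<beta> y)) UNIV"
    by (simp add: FE case_prod_unfold)
  then have E: "(F has_sum (\<alpha> z * \<beta> y)) ?E"
    unfolding has_sum_reindex_bij_betw[OF bE] .
  have bs: "bij_betw (\<lambda>v. v + 1) UNIV (UNIV :: int set)"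
    by (rule bij_betwI[where g = "\<lambda>v. v - 1"]) auto
  have "((\<lambda>(u, v). jacobi_term (p * p) (- p * z * z) u * jacobi_term (p * p) (- y * y) (v + 1)) has_sum (\<beta> z * \<alpha> y)) (UNIV \<times> UNIV)"
  proof (rule has_sum_times)
    show "((\<lambda>v. jacobi_term (p * p) (- y * y) (v + 1)) has_sum \<alpha> y) UNIV"
      unfolding has_sum_reindex_bij_betw[OF bs] by (rule ja[OF y])
    show "(\<lambda>v. norm (jacobi_term (p * p) (- y * y) (v + 1))) summable_on UNIV"
      using summable_on_reindex_bij_betw[OF bs, of "\<lambda>v. norm (jacobi_term (p * p) (- y * y) v)"] ja(2)[OF y] by simp
  qed (use jb z in auto)
  from has_sum_cmult_right[OF this, of "- (z / y)"]
  have "((\<lambda>x. F ((\<lambda>(u, v). (u + v + 1, u - v)) x)) has_sum (- (z / y) * (\<beta> z * \<alpha> y))) UNIV"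
    by (simp add: FO case_prod_unfold)
  then have O: "(F has_sum (- (z / y) * (\<beta> z * \<alpha> y))) ?O"
    unfolding has_sum_reindex_bij_betw[OF bO] .
  have "(F has_sum (\<alpha> z * \<beta> y + - (z / y) * (\<beta> z * \<alpha> y))) (?E \<union> ?O)"
    by (rule has_sum_Un_disjoint[OF E O]) auto
  moreover have "?E \<union> ?O = UNIV" by auto
  ultimately have "(F has_sum (\<alpha> z * \<beta> y + - (z / y) * (\<beta> z * \<alpha> y))) UNIV" by simp
  from has_sum_unique[OF tot this] show ?thesis by simp
qed

text \<open>By \<open>theta (1 / x) p = - theta x p / x\<close>, multiplying by \<open>x\<close> to
  the power \<open>-1/2\<close> gives an odd function of \<open>log x\<close>; the argument
  \<open>exp (2 * z)\<close> makes the square root single-valued.\<close>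

definition stheta :: "complex \<Rightarrow> complex \<Rightarrow> complex" where
  "stheta p z = theta (exp (2 * z)) p * exp (- z)"

text \<open>Dividing \<open>theta_product\<close> by \<open>exp (2 * x)\<close> makes its right-hand
  side antisymmetric. The case \<open>p = 0\<close>, which the triple product excludes, is
  elementary because \<open>stheta 0 z\<close> is \<open>exp (- z) - exp z\<close>.\<close>

lemma stheta_rank_two:
  assumes "norm p < 1"
  obtains A B where "\<And>x y. stheta p (x + y) * stheta p (x - y) = A x * B y - A y * B x"
proof (cases "p = 0")
  case True
  have "stheta p (x + y) * stheta p (x - y) = (exp (2 * x) + exp (- 2 * x)) * 1 - (exp (2 * y) + exp (- 2 * y)) * 1" for x y
    unfolding stheta_def True theta_0 by (simp add: algebra_simps flip: exp_add)
  then show ?thesis using that[of "\<lambda>x. exp (2 * x) + exp (- 2 * x)" "\<lambda>_. 1"] by blast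
next
  case False
  obtain L where L: "L \<noteq> 0" "pfac p \<longlonglongrightarrow> L" using pfac_tendsto[OF assms] .
  define \<alpha> where "\<alpha> w = infsum (jacobi_term (p * p) (- w * w)) UNIV" for w
  define \<beta> where "\<beta> w = infsum (jacobi_term (p * p) (- p * w * w)) UNIV" for w
  define A where "A x = \<alpha> (exp (2 * x)) / exp (2 * x) / L" for x
  define B where "B x = \<beta> (exp (2 * x)) / L" for x
  have "stheta p (x + y) * stheta p (x - y) = A x * B y - A y * B x" for x y
  proof -
    let ?X = "exp (2 * x)" and ?Y = "exp (2 * y)"
    have arg: "- (x + y) + - (x - y) = - (2 * x)" by simp
    have e: "exp (2 * (x + y)) = ?X * ?Y" "exp (2 * (x - y)) = ?X / ?Y" "exp (- (x + y)) * exp (- (x - y)) = 1 / ?X"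
      unfolding exp_add[symmetric] arg exp_diff[symmetric] by (simp_all add: distrib_left right_diff_distrib exp_minus inverse_eq_divide)
    have "L * L * ?X * (stheta p (x + y) * stheta p (x - y)) = L * theta (?X * ?Y) p * (L * theta (?X / ?Y) p) * (?X * (exp (- (x + y)) * exp (- (x - y))))"
      unfolding stheta_def e(1,2) by (simp only: mult_ac)
    also have "\<dots> = \<alpha> ?X * \<beta> ?Y - ?X / ?Y * (\<beta> ?X * \<alpha> ?Y)"
      unfolding e(3) \<alpha>_def \<beta>_def theta_product[OF False assms L exp_not_eq_zero exp_not_eq_zero] by simp
    also have "\<dots> = L * L * ?X * (A x * B y - A y * B x)"
      using L(1) by (simp add: A_def B_def field_simps)
    finally show ?thesis using L(1) by simp
  qed
  then show ?thesis using that by blast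
qed

section \<open>Continuity and zeros of theta\<close>

text \<open>The product converges uniformly on the closed disc of radius \<open>norm x / 2\<close>,
  which stays away from the singularity at 0.\<close>

lemma isCont_theta:
  assumes p: "norm p < 1" and x: "x \<noteq> 0"
  shows "isCont (\<lambda>x. theta x p) x"
proof -
  define A where "A = cball x (norm x / 2)"
  define f where "f j w = (1 - p ^ j * w) * (1 - p ^ (j + 1) / w)" for j w
  have nz: "norm w \<ge> norm x / 2" "norm w \<le> 2 * norm x" "w \<noteq> 0" if "w \<in> A" for w
  proof -
    have "norm (x - w) \<le> norm x / 2" using that by (simp add: A_def dist_norm)
    then show "norm w \<ge> norm x / 2" "norm w \<le> 2 * norm x"
      using norm_triangle_ineq2[of x w] norm_triangle_ineq2[of w x] norm_minus_commute[of w x] by linarith+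
    then show "w \<noteq> 0" using x by auto
  qed
  define C where "C = 1 + 2 * norm x + 2 / norm x"
  have bound: "norm (f j w - 1) \<le> C * norm p ^ j" if "w \<in> A" for j w
  proof -
    note w = nz[OF that]
    have "f j w - 1 = p ^ j * (p ^ (j + 1) - w - p / w)"
      using w by (simp add: f_def field_simps)
    then have "norm (f j w - 1) = norm p ^ j * norm (p ^ (j + 1) - w - p / w)"
      by (simp add: norm_mult norm_power)
    moreover have "norm (p ^ (j + 1) - w - p / w) \<le> C"
    proof -
      have "norm (p ^ (j + 1) - w - p / w) \<le> norm (p ^ (j + 1)) + norm w + norm (p / w)"
        by (intro order_trans[OF norm_triangle_ineq4] add_mono order_refl norm_triangle_ineq4)
      also have "\<dots> \<le> C"
      proof -
        have "norm (p ^ (j + 1)) \<le> 1" unfolding norm_power using p by (intro power_le_one) auto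
        moreover have "norm (p / w) \<le> 1 / (norm x / 2)"
          unfolding norm_divide using p w x by (intro frac_le) auto
        ultimately show ?thesis using w(2) by (simp add: C_def)
      qed
      finally show ?thesis .
    qed
    ultimately show ?thesis
      using mult_left_mono[of "norm (p ^ (j + 1) - w - p / w)" C "norm p ^ j"] by (simp add: mult.commute)
  qed
  have "uniformly_convergent_on A (\<lambda>N w. \<Prod>j<N. f j w)"
  proof (rule uniformly_convergent_on_prod')
    show "continuous_on A (f n)" for n
      unfolding f_def using nz by (intro continuous_intros) auto
    show "compact A" by (simp add: A_def)
    show "uniformly_convergent_on A (\<lambda>N w. \<Sum>n<N. norm (f n w - 1))"
    proof (rule uniformly_convergentI[OF Weierstrass_m_test])
      show "norm (norm (f n w - 1)) \<le> C * norm p ^ n" if "w \<in> A" for n w using bound[OF that] by simp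
      show "summable (\<lambda>n. C * norm p ^ n)" using p by (intro summable_mult summable_geometric) auto
    qed
  qed
  then obtain l where l: "uniform_limit A (\<lambda>N w. \<Prod>j<N. f j w) l sequentially"
    by (auto simp: uniformly_convergent_on_def)
  have "continuous_on A l"
  proof (rule uniform_limit_theorem[OF _ l])
    show "\<forall>\<^sub>F n in sequentially. continuous_on A (\<lambda>w. \<Prod>j<n. f j w)"
      unfolding f_def using nz by (intro always_eventually allI continuous_intros) auto
  qed simp
  moreover have "l w = theta w p" if "w \<in> A" for w
    using tendsto_uniform_limitI[OF l that] has_prod_imp_tendsto'[OF theta_has_prod[OF p, of w]]
    unfolding f_def by (rule LIMSEQ_unique)
  ultimately have "continuous_on A (\<lambda>w. theta w p)" by (simp cong: continuous_on_cong)
  moreover have "x \<in> interior A" using x by (simp add: A_def)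
  ultimately show ?thesis by (rule continuous_on_interior)
qed

lemma theta_zero:
  assumes "norm p < 1" "theta x p = 0"
  obtains j where "p ^ j * x = 1 \<or> p ^ (j + 1) / x = 1"
proof -
  have "0 \<in> range (\<lambda>j. (1 - p ^ j * x) * (1 - p ^ (j + 1) / x))"
    using has_prod_eq_0_iff[OF theta_has_prod[OF assms(1), of x]] assms(2) by simp
  then obtain j where "(1 - p ^ j * x) * (1 - p ^ (j + 1) / x) = 0" by auto
  then have "p ^ j * x = 1 \<or> p ^ (j + 1) / x = 1" by auto
  then show ?thesis using that by blast
qed

lemma countable_exp_eq: "countable {z. exp (2 * z) = (w :: complex)}"
proof (cases "{z. exp (2 * z) = w} = {}")
  case False
  then obtain u where u: "exp (2 * u) = w" by auto
  have "{z. exp (2 * z) = w} \<subseteq> range (\<lambda>n::int. u + of_int n * of_real pi * \<i>)"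
  proof
    fix z assume "z \<in> {z. exp (2 * z) = w}"
    then have "exp (2 * z) = exp (2 * u)" using u by simp
    then obtain n :: int where "2 * z = 2 * u + of_int (2 * n) * pi * \<i>" unfolding exp_eq by auto
    then have "2 * z = 2 * (u + of_int n * of_real pi * \<i>)" by (simp add: algebra_simps)
    then have "z = u + of_int n * of_real pi * \<i>" by (simp only: mult_cancel_left) simp
    then show "z \<in> range (\<lambda>n::int. u + of_int n * of_real pi * \<i>)" by blast
  qed
  then show ?thesis by (rule countable_subset) simp
qed simp

lemma countable_stheta_zeros:
  assumes "norm p < 1"
  shows "countable {z. stheta p z = 0}"
proof (rule countable_subset)
  show "{z. stheta p z = 0} \<subseteq> (\<Union>j. {z. exp (2 * z) = 1 / p ^ j}) \<union> (\<Union>j. {z. exp (2 * z) = p ^ (j + 1)})"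
  proof
    fix z assume "z \<in> {z. stheta p z = 0}"
    then have "theta (exp (2 * z)) p = 0" by (simp add: stheta_def)
    then obtain j where "p ^ j * exp (2 * z) = 1 \<or> p ^ (j + 1) / exp (2 * z) = 1"
      by (rule theta_zero[OF assms])
    then have "exp (2 * z) = 1 / p ^ j \<or> exp (2 * z) = p ^ (j + 1)"
      by (cases "p ^ j = 0") (auto simp: field_simps)
    then show "z \<in> (\<Union>j. {z. exp (2 * z) = 1 / p ^ j}) \<union> (\<Union>j. {z. exp (2 * z) = p ^ (j + 1)})"
      by blast
  qed
  show "countable ((\<Union>j. {z. exp (2 * z) = 1 / p ^ j}) \<union> (\<Union>j. {z. exp (2 * z) = p ^ (j + 1)}))"
    by (intro countable_Un countable_UN countable_exp_eq) auto
qed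

text \<open>Exchanging the arguments of the kernel \<open>A x * B y - A y * B x\<close> changes its
  sign, which gives oddness upon division by a nonzero value of \<open>stheta p\<close>; the
  three-term relation is the Pluecker identity for these minors.\<close>

lemma odd_theta_stheta:
  assumes "norm p < 1"
  shows "odd_theta (stheta p)"
proof -
  obtain A B where AB: "\<And>x y. stheta p (x + y) * stheta p (x - y) = A x * B y - A y * B x"
    using stheta_rank_two[OF assms] by blast
  show ?thesis
  proof
    fix z
    have "{z. stheta p z = 0} \<noteq> UNIV"
      using countable_stheta_zeros[OF assms] uncountable_UNIV_complex by auto
    then obtain w where w: "stheta p w \<noteq> 0" by blast
    have e: "(w + z) / 2 + (w - z) / 2 = w" "(w + z) / 2 - (w - z) / 2 = z"
       "(w - z) / 2 + (w + z) / 2 = w" "(w - z) / 2 - (w + z) / 2 = - z"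
      by (simp_all add: field_simps)
    have "stheta p w * stheta p z = - (stheta p w * stheta p (- z))"
      using AB[of "(w + z) / 2" "(w - z) / 2"] AB[of "(w - z) / 2" "(w + z) / 2"]
      unfolding e by (simp only: minus_diff_eq)
    then show "stheta p (- z) = - stheta p z" using w by (metis minus_equation_iff mult_cancel_left mult_minus_right)
  next
    fix x y u v
    show "stheta p (x + y) * stheta p (x - y) * stheta p (u + v) * stheta p (u - v) -
       stheta p (x + v) * stheta p (x - v) * stheta p (u + y) * stheta p (u - y) =
       stheta p (y + v) * stheta p (y - v) * stheta p (x + u) * stheta p (x - u)"
    proof -
      have "stheta p (x + y) * stheta p (x - y) * (stheta p (u + v) * stheta p (u - v)) -
         stheta p (x + v) * stheta p (x - v) * (stheta p (u + y) * stheta p (u - y)) =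
         stheta p (y + v) * stheta p (y - v) * (stheta p (x + u) * stheta p (x - u))"
        unfolding AB by (simp add: algebra_simps)
      then show ?thesis by (simp only: mult.assoc)
    qed
  next
    fix z
    have "isCont (\<lambda>z. theta (exp (2 * z)) p) z"
      by (rule isCont_o2[OF _ isCont_theta[OF assms]]) (auto intro!: continuous_intros)
    then show "isCont (stheta p) z" unfolding stheta_def by (intro continuous_intros)
  next
    show "countable {z. stheta p z = 0}" by (rule countable_stheta_zeros[OF assms])
  qed
qed

section \<open>Multiplicative form\<close>

text \<open>The sum of \<open>z + j h\<close> over \<open>j < n\<close>, which collects the factors
  \<open>exp\<close> split off when each \<open>theta\<close> in \<open>efac\<close> is written in
  terms of \<open>stheta\<close>.\<close>

definition efac_exponent :: "complex \<Rightarrow> complex \<Rightarrow> nat \<Rightarrow> complex" where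
  "efac_exponent h z n = of_nat n * z + h * (of_nat n * (of_nat n - 1) / 2)"

lemma sum_pairs:
  fixes z :: "nat \<Rightarrow> complex"
  shows "(\<Sum>j=1..r. \<Sum>i=1..<j. z i + z j) = (of_nat r - 1) * (\<Sum>i=1..r. z i)"
proof (induction r)
  case (Suc r)
  have "(\<Sum>i=1..<Suc r. z i + z (Suc r)) = (\<Sum>i=1..r. z i) + of_nat r * z (Suc r)"
    by (simp add: sum.distrib atLeastLessThanSuc_atLeastAtMost)
  then show ?case using Suc by (simp add: algebra_simps)
qed simp

lemma e2_eq: "2 * e2 r k + (\<Sum>i=1..r. k i * k i) = weight r k * weight r k"
proof (induction r)
  case (Suc r)
  have "(\<Sum>i=1..<Suc r. k i * k (Suc r)) = weight r k * k (Suc r)"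
    by (simp add: weight_def sum_distrib_right atLeastLessThanSuc_atLeastAtMost)
  then have "e2 (Suc r) k = e2 r k + weight r k * k (Suc r)" by (simp add: e2_def)
  moreover have "weight (Suc r) k = weight r k + k (Suc r)" by (simp add: weight_def)
  ultimately show ?case using Suc by (simp add: algebra_simps)
qed (simp add: e2_def weight_def)

context
  fixes p :: complex
  assumes p: "norm p < 1"
begin

interpretation odd_theta "stheta p"
  by (rule odd_theta_stheta[OF p])

lemma theta_exp: "theta (exp (2 * z)) p = exp z * stheta p z"
  by (simp add: stheta_def exp_minus)

lemma efac_exp: "efac (exp (2 * z)) (exp (2 * h)) p n = exp (efac_exponent h z n) * fac h z n"
proof (induction n)
  case (Suc n)
  define w where "w = z + of_nat n * h"
  have "exp (2 * z) * exp (2 * h) ^ n = exp (2 * w)"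
    unfolding w_def exp_of_nat_mult[symmetric] exp_add[symmetric] by (simp add: algebra_simps)
  then have "efac (exp (2 * z)) (exp (2 * h)) p (Suc n) = exp (efac_exponent h z n) * fac h z n * (exp w * stheta p w)"
    using Suc by (simp add: efac_def theta_exp)
  also have "\<dots> = exp (efac_exponent h z n + w) * fac h z (Suc n)"
    by (simp add: fac_Suc exp_add w_def)
  also have "efac_exponent h z n + w = efac_exponent h z (Suc n)"
    by (simp add: efac_exponent_def w_def field_simps)
  finally show ?case .
qed (simp add: efac_def efac_exponent_def)

lemma Delta_exp:
  assumes "\<And>i. i \<in> {1..r} \<Longrightarrow> y i = exp (2 * z i)"
  shows "Delta r y p = exp ((of_nat r - 1) * (\<Sum>i=1..r. z i)) * vand r z"
proof -
  have "Delta r y p = (\<Prod>j=1..r. \<Prod>i=1..<j. exp (z i + z j) * stheta p (z i - z j))"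
    unfolding Delta_def
  proof (intro prod.cong refl)
    fix i j assume ij: "j \<in> {1..r}" "i \<in> {1..<j}"
    then have e1: "y i / y j = exp (2 * (z i - z j))" by (simp add: assms exp_diff right_diff_distrib)
    have e2: "y j = exp (2 * z j)" using ij by (intro assms)
    show "y j * theta (y i / y j) p = exp (z i + z j) * stheta p (z i - z j)"
      unfolding e1 theta_exp unfolding e2 mult.assoc[symmetric] exp_add[symmetric] by (simp add: add.commute)
  qed
  also have "\<dots> = exp (\<Sum>j=1..r. \<Sum>i=1..<j. z i + z j) * vand r z"
    unfolding prod.distrib vand_def by (simp add: exp_sum)
  finally show ?thesis unfolding sum_pairs .
qed

text \<open>By \<open>theta_zero\<close> a zero would make a positive power of \<open>q\<close> an
  integral power of \<open>p\<close>; oddness reduces negative \<open>m\<close> to positive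
  \<open>m\<close>.\<close>

lemma stheta_nonzero: 
  assumes "q = exp (2 * e)" "q \<noteq> 0" "\<And>(k::nat) (n::int). k > 0 \<Longrightarrow> q ^ k \<noteq> p powi n" "m \<noteq> 0"
  shows "stheta p (of_int m * e) \<noteq> 0"
proof
  have pos: False if "stheta p (of_int m * e) = 0" "m > 0" for m
  proof -
    have q: "exp (2 * (of_int m * e)) = q ^ nat m"
      using that(2) unfolding assms(1) by (simp add: mult_ac flip: exp_of_nat_mult)
    have "theta (q ^ nat m) p = 0"
      using that(1) by (simp add: stheta_def q)
    then obtain j where "p ^ j * q ^ nat m = 1 \<or> p ^ (j + 1) / q ^ nat m = 1"
      by (rule theta_zero[OF p])
    then have "q ^ nat m = p powi (- int j) \<or> q ^ nat m = p powi int (j + 1)"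
    proof
      assume h: "p ^ j * q ^ nat m = 1"
      show ?thesis using inverse_unique[OF h] by (simp add: power_int_minus)
    next
      assume h: "p ^ (j + 1) / q ^ nat m = 1"
      then have "q ^ nat m = p ^ (j + 1)" by (auto simp: field_simps)
      then show ?thesis unfolding power_int_of_nat ..
    qed
    then show False using assms(3)[of "nat m"] that(2) by auto
  qed
  assume h: "stheta p (of_int m * e) = 0"
  show False
  proof (cases "m > 0")
    case True
    then show ?thesis using pos h by blast
  next
    case False
    then show ?thesis using pos[of "- m"] h assms(4) odd[of "of_int m * e"] by simp
  qed
qed

lemma efac_exponent_add: "efac_exponent h (z + w) n = of_nat n * z + efac_exponent h w n"
  by (simp add: efac_exponent_def algebra_simps)

text \<open>The \<open>b j\<close> and \<open>x j\<close> enter only through their sums times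
  \<open>k\<close>, so the balance removes both.\<close>

lemma row_exponent:
  fixes a c e :: complex and b x :: "nat \<Rightarrow> complex"
  assumes bal: "2 * a + e = (\<Sum>i=1..r+1. b i) + c + (\<Sum>i=1..r. x i)" and k: "k \<le> n"
  shows "efac_exponent (2 * e) (c - y) n + efac_exponent e (c - a - y) (n - k) + (\<Sum>j=1..r+1. efac_exponent (2 * e) (b j + y) k)
      - efac_exponent (2 * e) (c - y) (n - k) - efac_exponent e (a + y - c + (of_nat k - of_nat n + 1) * e) k
      - (\<Sum>j=1..r. efac_exponent (2 * e) (2 * e + y - x j) k) =
    of_nat n * (c - a) - of_nat n * y + of_nat k * (2 * a + e) +
      e * ((of_nat n * of_nat n - of_nat n) / 2 + 2 * of_nat n * of_nat k - of_nat k * of_nat k - (2 + 2 * of_nat r) * of_nat k)"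
proof -
  have 1: "(\<Sum>j=1..r+1. efac_exponent (2 * e) (b j + y) k) = of_nat k * (\<Sum>j=1..r+1. b j) + (of_nat r + 1) * efac_exponent (2 * e) y k"
    unfolding efac_exponent_add sum.distrib sum_distrib_left[symmetric] by simp
  have "2 * e + y - x j = - x j + (2 * e + y)" for j by simp
  then have 2: "(\<Sum>j=1..r. efac_exponent (2 * e) (2 * e + y - x j) k) = of_nat r * efac_exponent (2 * e) (2 * e + y) k - of_nat k * (\<Sum>j=1..r. x j)"
    by (simp only: efac_exponent_add[of _ "- x _"] sum.distrib) (simp add: sum_negf sum_distrib_left)
  have b: "(\<Sum>i=1..r+1. b i) = 2 * a + e - c - (\<Sum>i=1..r. x i)" using bal by (simp add: algebra_simps)
  show ?thesis unfolding 1 2 unfolding b efac_exponent_def of_nat_diff[OF k] by (simp add: field_simps)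
qed

text \<open>Exponentials never vanish, so the genericity conditions carry over one by one; the
  values agree because the total exponent is zero.\<close>

lemma summand_exp:
  fixes a c e :: complex and b x :: "nat \<Rightarrow> complex"
  assumes q: "q = exp (2 * e)" and a: "A = exp (2 * a)" and c: "C = exp (2 * c)"
    and Bb: "\<forall>i\<in>{1..r+1}. B i = exp (2 * b i)" and Xx: "\<forall>i\<in>{1..r}. X i = exp (2 * x i)"
    and bal: "2 * a + e = (\<Sum>i=1..r+1. b i) + c + (\<Sum>i=1..r. x i)"
  shows "summand r N p q A B C X k = additive_summand r N e a b c x k"
    and "summand_generic r N p q A B C X k \<longleftrightarrow>
      (let n = weight r k in vand r x \<noteq> 0 \<and> stheta p a \<noteq> 0 \<and>
        fac (2 * e) (a + (of_nat N + 2) * e) n \<noteq> 0 \<and> fac (2 * e) (a + (1 - of_nat N) * e) n \<noteq> 0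
        \<and> (\<forall>i\<in>{1..r+1}. fac e (b i + c - a) n \<noteq> 0)
        \<and> (\<forall>i\<in>{1..r}. fac (2 * e) (c - x i) (n - k i) \<noteq> 0
            \<and> fac e (a + x i - c + (of_nat (k i) - of_nat n + 1) * e) (k i) \<noteq> 0
            \<and> (\<forall>j\<in>{1..r}. fac (2 * e) (2 * e + x i - x j) (k i) \<noteq> 0)))"
    (is "?generic \<longleftrightarrow> ?additive_generic")
proof -
  note b = bspec[OF Bb] and x = bspec[OF Xx]
  define n where "n = weight r k"
  define SB where "SB = (\<Sum>i=1..r+1. b i)"
  define SX where "SX = (\<Sum>i=1..r. x i)"
  have Bp: "(\<Prod>i=1..r+1. B i) = exp (2 * SB)"
    unfolding SB_def sum_distrib_left exp_sum[OF finite_atLeastAtMost] by (rule prod.cong) (simp_all add: b)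
  have Xp: "(\<Prod>i=1..r. X i) = exp (2 * SX)"
    unfolding SX_def sum_distrib_left exp_sum[OF finite_atLeastAtMost] by (rule prod.cong) (simp_all add: x)
  have qn: "q ^ m = exp (of_nat m * (2 * e))" for m unfolding q by (rule exp_of_nat_mult[symmetric])
  have qi: "q powi m = exp (of_int m * (2 * e))" for m unfolding q by (rule exp_power_int)
  note comb = exp_add[symmetric] exp_diff[symmetric]
  have q2: "q\<^sup>2 = exp (2 * (2 * e))" unfolding qn by simp
  have a1: "A * q ^ (3 * n) = exp (2 * (a + 3 * of_nat n * e))" unfolding a qn comb by (simp add: algebra_simps)
  have a2: "q powi (- int N) = exp (2 * (- of_nat N * e))" unfolding qi by (simp add: algebra_simps)
  have a3: "q ^ (N + 1) = exp (2 * ((of_nat N + 1) * e))" unfolding qn by (simp add: algebra_simps)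
  have a4: "A * q ^ (N + 2) = exp (2 * (a + (of_nat N + 2) * e))" unfolding a qn comb by (simp add: algebra_simps)
  have a5: "A * q powi (1 - int N) = exp (2 * (a + (1 - of_nat N) * e))" unfolding a qi comb by (simp add: algebra_simps)
  have a6: "A * B i * q / ((\<Prod>i=1..r+1. B i) * (\<Prod>i=1..r. X i)) = exp (2 * (b i + c - a))" if "i \<in> {1..r+1}" for i
  proof -
    have "a + b i + e - (SB + SX) = b i + c - a" using bal unfolding SB_def SX_def by (simp add: algebra_simps)
    from arg_cong[OF this, of "(*) 2"] have eq: "2 * a + 2 * b i + 2 * e - (2 * SB + 2 * SX) = 2 * (b i + c - a)"
      by (simp only: distrib_left right_diff_distrib)
    show ?thesis unfolding Bp Xp a b[OF that] q comb eq ..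
  qed
  have r1: "C / X i = exp (2 * (c - x i))" and r2: "C / (A * X i) = exp (2 * (c - a - x i))"
    and r4: "A * X i * q powi (int l - int n + 1) / C = exp (2 * (a + x i - c + (of_nat l - of_nat n + 1) * e))"
    if "i \<in> {1..r}" for i l
    unfolding x[OF that] a c qi comb by (simp_all add: algebra_simps)
  have r3: "B j * X i = exp (2 * (b j + x i))" if "i \<in> {1..r}" "j \<in> {1..r+1}" for i j
    unfolding x[OF that(1)] b[OF that(2)] comb by (simp add: algebra_simps)
  have r5: "q\<^sup>2 * X i / X j = exp (2 * (2 * e + x i - x j))" if "i \<in> {1..r}" "j \<in> {1..r}" for i j
    unfolding q2 x[OF that(1)] x[OF that(2)] comb by (simp add: algebra_simps)
  have Dk: "Delta r (\<lambda>i. X i * q ^ (2 * k i)) p = exp ((of_nat r - 1) * (\<Sum>i=1..r. shifted (2 * e) x k i)) * vand r (shifted (2 * e) x k)"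
    by (rule Delta_exp) (simp add: x qn comb shifted_def algebra_simps)
  have D0: "Delta r X p = exp ((of_nat r - 1) * SX) * vand r x"
    unfolding SX_def by (rule Delta_exp) (rule x)
  show "?generic \<longleftrightarrow> ?additive_generic"
  proof -
    have f6: "efac (A * B i * q / ((\<Prod>i=1..r+1. B i) * (\<Prod>i=1..r. X i))) q p n \<noteq> 0 \<longleftrightarrow> fac e (b i + c - a) n \<noteq> 0"
      if "i \<in> {1..r+1}" for i
      unfolding a6[OF that] unfolding q efac_exp by simp
    have f1: "efac (C / X i) (q\<^sup>2) p (n - k i) \<noteq> 0 \<longleftrightarrow> fac (2 * e) (c - x i) (n - k i) \<noteq> 0"
      and f4: "efac (A * X i * q powi (int (k i) - int n + 1) / C) q p (k i) \<noteq> 0 \<longleftrightarrow> fac e (a + x i - c + (of_nat (k i) - of_nat n + 1) * e) (k i) \<noteq> 0"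
      if "i \<in> {1..r}" for i
      unfolding r1[OF that] r4[OF that] q2 unfolding q efac_exp by simp_all
    have f5: "efac (q\<^sup>2 * X i / X j) (q\<^sup>2) p (k i) \<noteq> 0 \<longleftrightarrow> fac (2 * e) (2 * e + x i - x j) (k i) \<noteq> 0" if "i \<in> {1..r}" "j \<in> {1..r}" for i j
      unfolding r5[OF that] unfolding q2 efac_exp by simp
    have f7: "Delta r X p \<noteq> 0 \<longleftrightarrow> vand r x \<noteq> 0" unfolding D0 by simp
    have f8: "theta A p \<noteq> 0 \<longleftrightarrow> stheta p a \<noteq> 0" unfolding a theta_exp by simp
    have f9: "efac (A * q ^ (N + 2)) (q\<^sup>2) p n \<noteq> 0 \<longleftrightarrow> fac (2 * e) (a + (of_nat N + 2) * e) n \<noteq> 0"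
      "efac (A * q powi (1 - int N)) (q\<^sup>2) p n \<noteq> 0 \<longleftrightarrow> fac (2 * e) (a + (1 - of_nat N) * e) n \<noteq> 0"
      unfolding a4 a5 q2 efac_exp by simp_all
    show ?thesis
      unfolding summand_generic_def Let_def n_def[symmetric] f7 f8 f9
      by (intro conj_cong ball_cong refl f6 f1 f4 f5)
  qed
  have kn: "k i \<le> n" if "i \<in> {1..r}" for i
    using member_le_sum[of i "{1..r}" k] that by (auto simp: n_def weight_def)
  define rowx where "rowx i = efac_exponent (2 * e) (c - x i) n + efac_exponent e (c - a - x i) (n - k i) + (\<Sum>j=1..r+1. efac_exponent (2 * e) (b j + x i) (k i))
      - efac_exponent (2 * e) (c - x i) (n - k i) - efac_exponent e (a + x i - c + (of_nat (k i) - of_nat n + 1) * e) (k i)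
      - (\<Sum>j=1..r. efac_exponent (2 * e) (2 * e + x i - x j) (k i))" for i
  define rowf where "rowf i = (fac (2 * e) (c - x i) n * fac e (c - a - x i) (n - k i) * (\<Prod>j=1..r+1. fac (2 * e) (b j + x i) (k i)))
        / (fac (2 * e) (c - x i) (n - k i) * fac e (a + x i - c + (of_nat (k i) - of_nat n + 1) * e) (k i)
            * (\<Prod>j=1..r. fac (2 * e) (2 * e + x i - x j) (k i)))" for i
  have quot: "exp E1 * F1 * (exp E2 * F2) * (exp E3 * F3) / (exp E4 * F4 * (exp E5 * F5) * (exp E6 * F6)) =
      exp (E1 + E2 + E3 - E4 - E5 - E6) * (F1 * F2 * F3 / (F4 * F5 * F6))" for E1 E2 E3 E4 E5 E6 F1 F2 F3 F4 F5 F6 :: complex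
    by (simp add: exp_add exp_diff mult_ac)
  have row: "(efac (C / X i) (q\<^sup>2) p n * efac (C / (A * X i)) q p (n - k i) * (\<Prod>j=1..r+1. efac (B j * X i) (q\<^sup>2) p (k i)))
          / (efac (C / X i) (q\<^sup>2) p (n - k i) * efac (A * X i * q powi (int (k i) - int n + 1) / C) q p (k i)
             * (\<Prod>j=1..r. efac (q\<^sup>2 * X i / X j) (q\<^sup>2) p (k i))) = exp (rowx i) * rowf i" if i: "i \<in> {1..r}" for i
  proof -
    have "(\<Prod>j=1..r+1. efac (B j * X i) (q\<^sup>2) p (k i)) = (\<Prod>j=1..r+1. exp (efac_exponent (2 * e) (b j + x i) (k i)) * fac (2 * e) (b j + x i) (k i))"
      by (rule prod.cong[OF refl]) (simp only: r3[OF i] q2 efac_exp)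
    then have p1: "(\<Prod>j=1..r+1. efac (B j * X i) (q\<^sup>2) p (k i)) = exp (\<Sum>j=1..r+1. efac_exponent (2 * e) (b j + x i) (k i)) * (\<Prod>j=1..r+1. fac (2 * e) (b j + x i) (k i))"
      by (simp only: prod.distrib exp_sum finite_atLeastAtMost)
    have "(\<Prod>j=1..r. efac (q\<^sup>2 * X i / X j) (q\<^sup>2) p (k i)) = (\<Prod>j=1..r. exp (efac_exponent (2 * e) (2 * e + x i - x j) (k i)) * fac (2 * e) (2 * e + x i - x j) (k i))"
      by (rule prod.cong[OF refl], subst r5[OF i], assumption) (simp only: q2 efac_exp)
    then have p2: "(\<Prod>j=1..r. efac (q\<^sup>2 * X i / X j) (q\<^sup>2) p (k i)) = exp (\<Sum>j=1..r. efac_exponent (2 * e) (2 * e + x i - x j) (k i)) * (\<Prod>j=1..r. fac (2 * e) (2 * e + x i - x j) (k i))"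
      by (simp only: prod.distrib exp_sum finite_atLeastAtMost)
    have u: "efac (C / X i) (q\<^sup>2) p l = exp (efac_exponent (2 * e) (c - x i) l) * fac (2 * e) (c - x i) l"
      "efac (C / (A * X i)) q p l = exp (efac_exponent e (c - a - x i) l) * fac e (c - a - x i) l"
      "efac (A * X i * q powi (int l - int n + 1) / C) q p l = exp (efac_exponent e (a + x i - c + (of_nat l - of_nat n + 1) * e) l) * fac e (a + x i - c + (of_nat l - of_nat n + 1) * e) l" for l
      unfolding r1[OF i] r2[OF i] r4[OF i] q2 unfolding q efac_exp by simp_all
    show ?thesis unfolding p1 p2 u quot rowx_def rowf_def ..
  qed
  define BE where "BE = (\<Sum>i=1..r+1. efac_exponent e (b i + c - a) n)"
  have "(\<Prod>i=1..r+1. efac (A * B i * q / ((\<Prod>i=1..r+1. B i) * (\<Prod>i=1..r. X i))) q p n) = (\<Prod>i=1..r+1. exp (efac_exponent e (b i + c - a) n) * fac e (b i + c - a) n)"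
    by (rule prod.cong[OF refl], subst a6) (simp_all only: q efac_exp)
  then have bfac: "(\<Prod>i=1..r+1. efac (A * B i * q / ((\<Prod>i=1..r+1. B i) * (\<Prod>i=1..r. X i))) q p n) = exp BE * (\<Prod>i=1..r+1. fac e (b i + c - a) n)"
    by (simp only: prod.distrib exp_sum finite_atLeastAtMost BE_def)
  have t1: "theta (A * q ^ (3 * n)) p / theta A p = exp (3 * of_nat n * e) * (stheta p (a + 3 * of_nat n * e) / stheta p a)"
    unfolding a1 unfolding a theta_exp by (simp add: exp_add)
  have mid: "efac A q p n * efac (q powi (- int N)) q p n * efac (q ^ (N + 1)) q p n
         / (efac (A * q ^ (N + 2)) (q\<^sup>2) p n * efac (A * q powi (1 - int N)) (q\<^sup>2) p n * (exp BE * (\<Prod>i=1..r+1. fac e (b i + c - a) n))) =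
     exp (efac_exponent e a n + efac_exponent e (- of_nat N * e) n + efac_exponent e ((of_nat N + 1) * e) n - efac_exponent (2 * e) (a + (of_nat N + 2) * e) n
         - efac_exponent (2 * e) (a + (1 - of_nat N) * e) n - BE) *
     (fac e a n * fac e (- of_nat N * e) n * fac e ((of_nat N + 1) * e) n
        / (fac (2 * e) (a + (of_nat N + 2) * e) n * fac (2 * e) (a + (1 - of_nat N) * e) n * (\<Prod>i=1..r+1. fac e (b i + c - a) n)))"
    unfolding a2 a3 a4 a5 q2 unfolding a q efac_exp quot ..
  define K2 where "K2 = (\<Sum>i=1..r. of_nat (k i) * of_nat (k i) :: complex)"
  have ns: "(\<Sum>i=1..r. of_nat (k i) :: complex) = of_nat n" by (simp add: n_def weight_def)
  have e2: "of_nat (e2 r k) = (of_nat n * of_nat n - K2) / (2 :: complex)"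
    using arg_cong[OF e2_eq[of r k], of "of_nat :: nat \<Rightarrow> complex"] unfolding K2_def n_def by (simp add: field_simps)
  have qe: "q powi (int n - int (e2 r k)) = exp ((of_nat n - (of_nat n * of_nat n - K2) / 2) * (2 * e))"
    unfolding qi by (simp add: e2)
  have Dq: "Delta r (\<lambda>i. X i * q ^ (2 * k i)) p / Delta r X p = exp ((of_nat r - 1) * (of_nat n * (2 * e))) * (vand r (shifted (2 * e) x k) / vand r x)"
  proof -
    have "(\<Sum>i=1..r. shifted (2 * e) x k i) = SX + of_nat n * (2 * e)"
      unfolding shifted_def sum.distrib SX_def sum_distrib_right[symmetric] ns ..
    then show ?thesis unfolding Dk D0 by (simp add: distrib_left exp_add)
  qed
  have rows: "(\<Sum>i=1..r. rowx i) = of_nat r * (of_nat n * (c - a)) - of_nat n * SX + of_nat n * (2 * a + e) +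
      e * (of_nat r * ((of_nat n * of_nat n - of_nat n) / 2) + 2 * of_nat n * of_nat n - K2 - (2 + 2 * of_nat r) * of_nat n)"
  proof -
    have "(\<Sum>i=1..r. rowx i) = (\<Sum>i=1..r. of_nat n * (c - a) - of_nat n * x i + of_nat (k i) * (2 * a + e) +
      e * ((of_nat n * of_nat n - of_nat n) / 2 + 2 * of_nat n * of_nat (k i) - of_nat (k i) * of_nat (k i) - (2 + 2 * of_nat r) * of_nat (k i)))"
      unfolding rowx_def by (rule sum.cong[OF refl row_exponent[OF bal kn]])
    also have "\<dots> = of_nat r * (of_nat n * (c - a)) - of_nat n * SX + (\<Sum>i=1..r. of_nat (k i)) * (2 * a + e) +
      e * (of_nat r * ((of_nat n * of_nat n - of_nat n) / 2) + 2 * of_nat n * (\<Sum>i=1..r. of_nat (k i)) - K2 - (2 + 2 * of_nat r) * (\<Sum>i=1..r. of_nat (k i)))"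
      unfolding sum.distrib sum_subtractf sum_distrib_left[symmetric] sum_distrib_right[symmetric] SX_def K2_def by (simp add: algebra_simps)
    finally show ?thesis unfolding ns .
  qed
  have BEe: "BE = of_nat n * (2 * a + e - c - SX) + (of_nat r + 1) * efac_exponent e (c - a) n"
  proof -
    have "BE = of_nat n * SB + (of_nat r + 1) * efac_exponent e (c - a) n"
      unfolding BE_def add_diff_eq[symmetric] efac_exponent_add sum.distrib sum_distrib_left[symmetric] SB_def by simp
    moreover have "SB = 2 * a + e - c - SX" using bal unfolding SB_def SX_def by (simp add: algebra_simps)
    ultimately show ?thesis by simp
  qed
  \<comment> \<open>The balance has removed the \<open>b i\<close>, the terms with \<open>SX\<close>
    cancel between the rows and \<open>BE\<close>, and the sum of squares \<open>K2\<close> left by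
    the rows cancels against that in the exponent of \<open>q\<close>, rewritten by
    \<open>e2_eq\<close>.\<close>
  have total: "(of_nat r - 1) * (of_nat n * (2 * e)) + 3 * of_nat n * e +
     (efac_exponent e a n + efac_exponent e (- of_nat N * e) n + efac_exponent e ((of_nat N + 1) * e) n - efac_exponent (2 * e) (a + (of_nat N + 2) * e) n
         - efac_exponent (2 * e) (a + (1 - of_nat N) * e) n - BE) +
     (of_nat n - (of_nat n * of_nat n - K2) / 2) * (2 * e) + (\<Sum>i=1..r. rowx i) = 0"
    unfolding rows BEe efac_exponent_def by (simp add: field_simps)
  have comb5: "exp E1 * V * (exp E2 * T) * (exp E3 * M) * exp E4 * (exp E5 * R) = V * T * M * R"
    if "E1 + E2 + E3 + E4 + E5 = 0" for E1 E2 E3 E4 E5 V T M R :: complex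
  proof -
    have "exp E1 * V * (exp E2 * T) * (exp E3 * M) * exp E4 * (exp E5 * R) = exp (E1 + E2 + E3 + E4 + E5) * (V * T * M * R)"
      by (simp add: exp_add mult_ac)
    then show ?thesis using that by simp
  qed
  have rowp: "(\<Prod>i=1..r. exp (rowx i) * rowf i) = exp (\<Sum>i=1..r. rowx i) * (\<Prod>i=1..r. rowf i)"
    by (simp only: prod.distrib exp_sum finite_atLeastAtMost)
  have "summand r N p q A B C X k =
      exp ((of_nat r - 1) * (of_nat n * (2 * e))) * (vand r (shifted (2 * e) x k) / vand r x)
      * (exp (3 * of_nat n * e) * (stheta p (a + 3 * of_nat n * e) / stheta p a))
      * (exp (efac_exponent e a n + efac_exponent e (- of_nat N * e) n + efac_exponent e ((of_nat N + 1) * e) n - efac_exponent (2 * e) (a + (of_nat N + 2) * e) n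
         - efac_exponent (2 * e) (a + (1 - of_nat N) * e) n - BE) *
     (fac e a n * fac e (- of_nat N * e) n * fac e ((of_nat N + 1) * e) n
        / (fac (2 * e) (a + (of_nat N + 2) * e) n * fac (2 * e) (a + (1 - of_nat N) * e) n * (\<Prod>i=1..r+1. fac e (b i + c - a) n))))
      * exp ((of_nat n - (of_nat n * of_nat n - K2) / 2) * (2 * e))
      * (exp (\<Sum>i=1..r. rowx i) * (\<Prod>i=1..r. rowf i))"
    unfolding summand_def Let_def n_def[symmetric] Dq t1 bfac mid qe rowp[symmetric]
    by (intro arg_cong2[of _ _ _ _ "(*)"] refl prod.cong row)
  also have "\<dots> = additive_summand r N e a b c x k"
    unfolding comb5[OF total] additive_summand_def Let_def n_def[symmetric] rowf_def ..
  finally show "summand r N p q A B C X k = additive_summand r N e a b c x k" .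
qed

lemma efac_quot_exp: "efac (exp (2 * z)) (exp (2 * h)) p n / efac (exp (2 * w)) (exp (2 * h)) p n =
    exp (of_nat n * (z - w)) * (fac h z n / fac h w n)"
proof -
  have "efac_exponent h z n - efac_exponent h w n = of_nat n * (z - w)" by (simp add: efac_exponent_def algebra_simps)
  then show ?thesis
    unfolding efac_exp times_divide_times_eq[symmetric] exp_diff[symmetric] by (simp only:)
qed

text \<open>In each quotient both factorials have length \<open>m\<close>, so only the difference of
  their arguments remains in the exponent and \<open>\<sigma>\<close> drops out; the balance makes
  the total zero.\<close>

lemma rhs_exp:
  fixes a c e \<sigma> :: complex and b x :: "nat \<Rightarrow> complex"
  assumes bal: "2 * a + e = (\<Sum>i=1..r+1. b i) + c + (\<Sum>i=1..r. x i)"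
    and q2: "q2 = exp (2 * (2 * e))"
    and u: "u1 = exp (2 * (a + e + \<sigma>))" "u2 = exp (2 * (\<sigma> - a))"
    and vv: "\<forall>i\<in>{1..r}. v1 i = exp (2 * (c + \<sigma> - a - x i))" "\<forall>i\<in>{1..r}. v2 i = exp (2 * (a + x i + e + \<sigma> - c))"
    and ww: "\<forall>i\<in>{1..r+1}. w1 i = exp (2 * (a + e + \<sigma> - b i - c))" "\<forall>i\<in>{1..r+1}. w2 i = exp (2 * (b i + c + \<sigma> - a))"
  shows "efac u1 q2 p m / efac u2 q2 p m * (\<Prod>i=1..r. efac (v1 i) q2 p m / efac (v2 i) q2 p m)
      * (\<Prod>i=1..r+1. efac (w1 i) q2 p m / efac (w2 i) q2 p m) = additive_rhs r \<sigma> m e a b c x"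
    and "efac u2 q2 p m \<noteq> 0 \<longleftrightarrow> fac (2 * e) (\<sigma> - a) m \<noteq> 0"
    and "\<And>i. i \<in> {1..r} \<Longrightarrow> efac (v2 i) q2 p m \<noteq> 0 \<longleftrightarrow> fac (2 * e) (a + x i + e + \<sigma> - c) m \<noteq> 0"
    and "\<And>i. i \<in> {1..r+1} \<Longrightarrow> efac (w2 i) q2 p m \<noteq> 0 \<longleftrightarrow> fac (2 * e) (b i + c + \<sigma> - a) m \<noteq> 0"
proof -
  note v = bspec[OF vv(1)] bspec[OF vv(2)] and w = bspec[OF ww(1)] bspec[OF ww(2)]
  show "efac u2 q2 p m \<noteq> 0 \<longleftrightarrow> fac (2 * e) (\<sigma> - a) m \<noteq> 0" unfolding u q2 efac_exp by simp
  show "efac (v2 i) q2 p m \<noteq> 0 \<longleftrightarrow> fac (2 * e) (a + x i + e + \<sigma> - c) m \<noteq> 0" if "i \<in> {1..r}" for i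
    unfolding v(2)[OF that] q2 efac_exp by simp
  show "efac (w2 i) q2 p m \<noteq> 0 \<longleftrightarrow> fac (2 * e) (b i + c + \<sigma> - a) m \<noteq> 0" if "i \<in> {1..r+1}" for i
    unfolding w(2)[OF that] q2 efac_exp by simp
  have "(\<Prod>i=1..r. efac (v1 i) q2 p m / efac (v2 i) q2 p m) = (\<Prod>i=1..r. exp (of_nat m * ((c + \<sigma> - a - x i) - (a + x i + e + \<sigma> - c))) *
      (fac (2 * e) (c + \<sigma> - a - x i) m / fac (2 * e) (a + x i + e + \<sigma> - c) m))"
    by (rule prod.cong[OF refl]) (simp only: v q2 efac_quot_exp)
  then have V: "(\<Prod>i=1..r. efac (v1 i) q2 p m / efac (v2 i) q2 p m) = exp (\<Sum>i=1..r. of_nat m * ((c + \<sigma> - a - x i) - (a + x i + e + \<sigma> - c))) *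
      (\<Prod>i=1..r. fac (2 * e) (c + \<sigma> - a - x i) m / fac (2 * e) (a + x i + e + \<sigma> - c) m)"
    by (simp only: prod.distrib exp_sum finite_atLeastAtMost)
  have "(\<Prod>i=1..r+1. efac (w1 i) q2 p m / efac (w2 i) q2 p m) = (\<Prod>i=1..r+1. exp (of_nat m * ((a + e + \<sigma> - b i - c) - (b i + c + \<sigma> - a))) *
      (fac (2 * e) (a + e + \<sigma> - b i - c) m / fac (2 * e) (b i + c + \<sigma> - a) m))"
    by (rule prod.cong[OF refl]) (simp only: w q2 efac_quot_exp)
  then have W: "(\<Prod>i=1..r+1. efac (w1 i) q2 p m / efac (w2 i) q2 p m) = exp (\<Sum>i=1..r+1. of_nat m * ((a + e + \<sigma> - b i - c) - (b i + c + \<sigma> - a))) *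
      (\<Prod>i=1..r+1. fac (2 * e) (a + e + \<sigma> - b i - c) m / fac (2 * e) (b i + c + \<sigma> - a) m)"
    by (simp only: prod.distrib exp_sum finite_atLeastAtMost)
  have s1: "(\<Sum>i=1..r. of_nat m * ((c + \<sigma> - a - x i) - (a + x i + e + \<sigma> - c))) = of_nat m * (of_nat r * (2 * c - 2 * a - e) - 2 * (\<Sum>i=1..r. x i))"
  proof -
    have "(c + \<sigma> - a - x i) - (a + x i + e + \<sigma> - c) = (2 * c - 2 * a - e) - 2 * x i" for i by simp
    then show ?thesis by (simp only: sum_subtractf sum_distrib_left[symmetric] sum_constant) (simp add: algebra_simps)
  qed
  have s2: "(\<Sum>i=1..r+1. of_nat m * ((a + e + \<sigma> - b i - c) - (b i + c + \<sigma> - a))) = of_nat m * ((of_nat r + 1) * (2 * a + e - 2 * c) - 2 * (2 * a + e - c - (\<Sum>i=1..r. x i)))"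
  proof -
    have "(a + e + \<sigma> - b i - c) - (b i + c + \<sigma> - a) = (2 * a + e - 2 * c) - 2 * b i" for i by simp
    then have "(\<Sum>i=1..r+1. of_nat m * ((a + e + \<sigma> - b i - c) - (b i + c + \<sigma> - a))) = of_nat m * ((of_nat r + 1) * (2 * a + e - 2 * c) - 2 * (\<Sum>i=1..r+1. b i))"
      by (simp only: sum_subtractf sum_distrib_left[symmetric] sum_constant) (simp add: algebra_simps)
    moreover have "(\<Sum>i=1..r+1. b i) = 2 * a + e - c - (\<Sum>i=1..r. x i)" using bal by (simp add: algebra_simps)
    ultimately show ?thesis by (simp only:)
  qed
  have comb3: "exp E1 * U * (exp E2 * V) * (exp E3 * W) = U * V * W" if "E1 + E2 + E3 = 0" for E1 E2 E3 U V W :: complex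
  proof -
    have "exp E1 * U * (exp E2 * V) * (exp E3 * W) = exp (E1 + E2 + E3) * (U * V * W)" by (simp add: exp_add mult_ac)
    then show ?thesis using that by simp
  qed
  show "efac u1 q2 p m / efac u2 q2 p m * (\<Prod>i=1..r. efac (v1 i) q2 p m / efac (v2 i) q2 p m)
      * (\<Prod>i=1..r+1. efac (w1 i) q2 p m / efac (w2 i) q2 p m) = additive_rhs r \<sigma> m e a b c x"
    unfolding V W s1 s2 unfolding u q2 efac_quot_exp additive_rhs_def
    by (rule comb3) (simp add: algebra_simps)
qed

theorem multiplicative_sum:
  fixes a c e :: complex and b x :: "nat \<Rightarrow> complex"
  assumes q: "q = exp (2 * e)" and q_generic: "\<forall>(k::nat) (n::int). k > 0 \<longrightarrow> q ^ k \<noteq> p powi n"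
    and A: "A = exp (2 * a)" and C: "C = exp (2 * c)"
    and B: "\<forall>i\<in>{1..r+1}. B i = exp (2 * b i)" and X: "\<forall>i\<in>{1..r}. X i = exp (2 * x i)"
    and bal: "2 * a + e = (\<Sum>i=1..r+1. b i) + c + (\<Sum>i=1..r. x i)"
    and generic: "\<forall>k\<in>multi_indices r N. summand_generic r N p q A B C X k"
    and N: "N + 1 = 2 * m + d" "d \<le> 1"
    and rhs: "fac (2 * e) (of_nat d * e - a) m \<noteq> 0"
       "\<forall>i\<in>{1..r}. fac (2 * e) (a + x i + e + of_nat d * e - c) m \<noteq> 0"
       "\<forall>i\<in>{1..r+1}. fac (2 * e) (b i + c + of_nat d * e - a) m \<noteq> 0"
  shows "(\<Sum>k\<in>multi_indices r N. summand r N p q A B C X k) = additive_rhs r (of_nat d * e) m e a b c x"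
proof -
  note gen = bspec[OF generic, unfolded summand_exp(2)[OF q A C B X bal] Let_def]
  have k0: "(\<lambda>l. if l \<in> {1..r} then 0 else undefined) \<in> multi_indices r N"
    by (auto simp: multi_indices_def weight_def)
  have vx: "vand r x \<noteq> 0" and a0: "stheta p a \<noteq> 0" using gen[OF k0] by auto
  have pos: "stheta p (x i - x j + of_int l * (2 * e)) \<noteq> 0" if "i \<in> {1..r}" "j \<in> {1..r}" "0 < l" "l \<le> int N" for i j l
  proof -
    \<comment> \<open>All weight is put on entry \<open>i\<close>: the denominator
      \<open>fac (2 * e) (2 * e + x i - x j) N\<close> of this index contains every shift
      \<open>1, ..., N\<close> that \<open>sum_additive\<close> asks for.\<close>
    define K where "K = (\<lambda>l. if l \<in> {1..r} then if l = i then N else 0 else undefined)"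
    have K: "K \<in> multi_indices r N" "K i = N"
      using that(1) by (auto simp: K_def multi_indices_def weight_def)
    have "fac (2 * e) (2 * e + x i - x j) N \<noteq> 0"
      using gen[OF K(1)] that(1,2) unfolding K(2)[symmetric] by blast
    moreover have "nat (l - 1) < N" using that by auto
    ultimately have "stheta p (2 * e + x i - x j + of_nat (nat (l - 1)) * (2 * e)) \<noteq> 0"
      by (auto simp: fac_def)
    then show ?thesis using that(3) by (simp add: algebra_simps)
  qed
  have zero: "stheta p (x i - x j) \<noteq> 0" if "i \<in> {1..r}" "j \<in> {1..r}" "i \<noteq> j" for i j
  proof -
    have "stheta p (x i - x j) \<noteq> 0" if "i \<in> {1..r}" "j \<in> {1..r}" "i < j" for i j
      using vx that by (auto simp: vand_def)
    then show ?thesis using that odd_diff[of "x i" "x j"] by (metis linorder_neqE_nat neg_equal_0_iff_equal)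
  qed
  have "(\<Sum>k\<in>multi_indices r N. additive_summand r N e a b c x k) = additive_rhs r (of_nat d * e) m e a b c x"
  proof (rule sum_additive)
    show "stheta p (x i - x j + of_int l * (2 * e)) \<noteq> 0" if "i \<in> {1..r}" "j \<in> {1..r}" "i \<noteq> j" "\<bar>l\<bar> \<le> int N" for i j l
    proof (cases "l = 0")
      case True
      then show ?thesis using zero that by simp
    next
      case False
      then consider "0 < l" | "0 < - l" by linarith
      then show ?thesis
      proof cases
        case 1
        then show ?thesis using pos that by simp
      next
        case 2
        have "stheta p (x j - x i + of_int (- l) * (2 * e)) \<noteq> 0" using 2 that by (intro pos) auto
        then show ?thesis using odd[of "x i - x j + of_int l * (2 * e)"] by (simp add: algebra_simps)
      qed
    qed
    show "stheta p (of_int l * e) \<noteq> 0" if "l \<noteq> 0" for l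
      by (rule stheta_nonzero[OF q _ _ that]) (use q_generic in \<open>simp_all add: q\<close>)
  qed (use bal N a0 rhs gen in auto)
  then show ?thesis using summand_exp(1)[OF q A C B X bal] by simp
qed

end

text \<open>The odd case reads \<open>N + 1 = 2 * m\<close>, since with truncated subtraction
  \<open>N = 2 * m - 1\<close> would also admit \<open>N = 0\<close> with
  \<open>m = 0\<close>.\<close>

theorem corollary4p4:
  fixes p q a c :: complex and b x :: "nat \<Rightarrow> complex" and r N :: nat
  assumes "norm p < 1" and "q \<noteq> 0"
    and "\<And>(k::nat) (n::int). k > 0 \<Longrightarrow> q ^ k \<noteq> p powi n"
    and "r \<ge> 1"
    and "a \<noteq> 0" and "c \<noteq> 0"
    and "\<And>i. i \<in> {1..r+1} \<Longrightarrow> b i \<noteq> 0"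
    and "\<And>i. i \<in> {1..r} \<Longrightarrow> x i \<noteq> 0"
    and balancing: "a\<^sup>2 * q = (\<Prod>i=1..r+1. b i) * c * (\<Prod>i=1..r. x i)"
    and generic_sum: "\<And>k. k \<in> multi_indices r N \<Longrightarrow> summand_generic r N p q a b c x k"
    and generic_even: "\<And>m. N = 2 * m \<Longrightarrow>
          efac (q / a) (q\<^sup>2) p m \<noteq> 0
          \<and> (\<forall>i\<in>{1..r}. efac (a * x i * q\<^sup>2 / c) (q\<^sup>2) p m \<noteq> 0)
          \<and> (\<forall>i\<in>{1..r+1}. efac (b i * c * q / a) (q\<^sup>2) p m \<noteq> 0)"
    and generic_odd: "\<And>m. N + 1 = 2 * m \<Longrightarrow>
          efac (1 / a) (q\<^sup>2) p m \<noteq> 0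
          \<and> (\<forall>i\<in>{1..r}. efac (a * x i * q / c) (q\<^sup>2) p m \<noteq> 0)
          \<and> (\<forall>i\<in>{1..r+1}. efac (b i * c / a) (q\<^sup>2) p m \<noteq> 0)"
  shows "(\<forall>m. N = 2 * m \<longrightarrow>
            (\<Sum>k\<in>multi_indices r N. summand r N p q a b c x k) =
              efac (a * q\<^sup>2) (q\<^sup>2) p m / efac (q / a) (q\<^sup>2) p m
              * (\<Prod>i=1..r. efac (c * q / (a * x i)) (q\<^sup>2) p m / efac (a * x i * q\<^sup>2 / c) (q\<^sup>2) p m)
              * (\<Prod>i=1..r+1. efac (a * q\<^sup>2 / (b i * c)) (q\<^sup>2) p m / efac (b i * c * q / a) (q\<^sup>2) p m))
       \<and> (\<forall>m. N + 1 = 2 * m \<longrightarrow>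
            (\<Sum>k\<in>multi_indices r N. summand r N p q a b c x k) =
              efac (a * q) (q\<^sup>2) p m / efac (1 / a) (q\<^sup>2) p m
              * (\<Prod>i=1..r. efac (c / (a * x i)) (q\<^sup>2) p m / efac (a * x i * q / c) (q\<^sup>2) p m)
              * (\<Prod>i=1..r+1. efac (a * q / (b i * c)) (q\<^sup>2) p m / efac (b i * c / a) (q\<^sup>2) p m))"
proof -
  note p = assms(1)
  define e a' b' x' where "e = Ln q / 2" and "a' = Ln a / 2" and "b' i = Ln (b i) / 2" and "x' i = Ln (x i) / 2" for i
  \<comment> \<open>\<open>Ln c / 2\<close> would satisfy the additive balance only up to a multiple
    of \<open>pi * \<i>\<close>. Hence \<open>c'\<close> is defined by that balance, and the
    multiplicative one yields \<open>c = exp (2 * c')\<close>.\<close>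
  define c' where "c' = 2 * a' + e - (\<Sum>i=1..r+1. b' i) - (\<Sum>i=1..r. x' i)"
  have q: "q = exp (2 * e)" and a: "a = exp (2 * a')"
    and b: "\<forall>i\<in>{1..r+1}. b i = exp (2 * b' i)" and x: "\<forall>i\<in>{1..r}. x i = exp (2 * x' i)"
    using assms by (simp_all add: e_def a'_def b'_def x'_def)
  have bal: "2 * a' + e = (\<Sum>i=1..r+1. b' i) + c' + (\<Sum>i=1..r. x' i)" by (simp add: c'_def)
  have c: "c = exp (2 * c')"
  proof -
    define SB where "SB = (\<Sum>i=1..r+1. b' i)"
    define SX where "SX = (\<Sum>i=1..r. x' i)"
    have B: "(\<Prod>i=1..r+1. b i) = exp (2 * SB)"
      unfolding SB_def sum_distrib_left exp_sum[OF finite_atLeastAtMost] by (rule prod.cong) (simp_all add: b)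
    have X: "(\<Prod>i=1..r. x i) = exp (2 * SX)"
      unfolding SX_def sum_distrib_left exp_sum[OF finite_atLeastAtMost] by (rule prod.cong) (simp_all add: x)
    have "exp (2 * SB) * exp (2 * c') * exp (2 * SX) = a\<^sup>2 * q"
      unfolding a q power2_eq_square exp_add[symmetric] c'_def SB_def SX_def by (simp add: algebra_simps)
    then have "exp (2 * SB) * exp (2 * c') * exp (2 * SX) = exp (2 * SB) * c * exp (2 * SX)"
      using balancing unfolding B X by simp
    then show ?thesis by simp
  qed
  have q2: "q\<^sup>2 = exp (2 * (2 * e))" unfolding q by (simp add: power2_eq_square flip: exp_add)
  have qg: "\<forall>(k::nat) (n::int). k > 0 \<longrightarrow> q ^ k \<noteq> p powi n" using assms(3) by blast
  have gs: "\<forall>k\<in>multi_indices r N. summand_generic r N p q a b c x k" using generic_sum by blast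
  note main = multiplicative_sum[OF p q qg a c b x bal gs]
  show ?thesis
  proof (intro conjI allI impI, goal_cases)
    case (1 m)
    note N = this
    \<comment> \<open>Here \<open>d = 1\<close>, in the odd case \<open>d = 0\<close>; the shift
      \<open>\<sigma>\<close> of the right-hand side is \<open>of_nat d * e\<close>.\<close>
    have Nd: "N + 1 = 2 * m + 1" "(1::nat) \<le> 1" using N by auto
    have u: "a * q\<^sup>2 = exp (2 * (a' + e + of_nat 1 * e))" "q / a = exp (2 * (of_nat 1 * e - a'))"
      unfolding q2 unfolding a q exp_add[symmetric] exp_diff[symmetric] by (simp_all add: algebra_simps)
    have v: "\<forall>i\<in>{1..r}. c * q / (a * x i) = exp (2 * (c' + of_nat 1 * e - a' - x' i))" "\<forall>i\<in>{1..r}. a * x i * q\<^sup>2 / c = exp (2 * (a' + x' i + e + of_nat 1 * e - c'))"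
    proof -
      have "c * q / (a * x i) = exp (2 * (c' + of_nat 1 * e - a' - x' i))" "a * x i * q\<^sup>2 / c = exp (2 * (a' + x' i + e + of_nat 1 * e - c'))" if "i \<in> {1..r}" for i
        unfolding q2 bspec[OF x that] unfolding a q c exp_add[symmetric] exp_diff[symmetric] by (simp_all add: algebra_simps)
      then show "\<forall>i\<in>{1..r}. c * q / (a * x i) = exp (2 * (c' + of_nat 1 * e - a' - x' i))" "\<forall>i\<in>{1..r}. a * x i * q\<^sup>2 / c = exp (2 * (a' + x' i + e + of_nat 1 * e - c'))" by blast+
    qed
    have w: "\<forall>i\<in>{1..r+1}. a * q\<^sup>2 / (b i * c) = exp (2 * (a' + e + of_nat 1 * e - b' i - c'))" "\<forall>i\<in>{1..r+1}. b i * c * q / a = exp (2 * (b' i + c' + of_nat 1 * e - a'))"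
    proof -
      have "a * q\<^sup>2 / (b i * c) = exp (2 * (a' + e + of_nat 1 * e - b' i - c'))" "b i * c * q / a = exp (2 * (b' i + c' + of_nat 1 * e - a'))" if "i \<in> {1..r+1}" for i
        unfolding q2 bspec[OF b that] unfolding a q c exp_add[symmetric] exp_diff[symmetric] by (simp_all add: algebra_simps)
      then show "\<forall>i\<in>{1..r+1}. a * q\<^sup>2 / (b i * c) = exp (2 * (a' + e + of_nat 1 * e - b' i - c'))" "\<forall>i\<in>{1..r+1}. b i * c * q / a = exp (2 * (b' i + c' + of_nat 1 * e - a'))" by blast+
    qed
    note R = rhs_exp[OF p bal q2 u v w]
    note g = generic_even[OF N]
    have "(\<Sum>k\<in>multi_indices r N. summand r N p q a b c x k) = odd_theta.additive_rhs (stheta p) r (of_nat 1 * e) m e a' b' c' x'"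
      by (rule main[OF Nd]) (use g R(2-4) in auto)
    then show ?case unfolding R(1) .
  next
    case (2 m)
    note N = this
    have Nd: "N + 1 = 2 * m + 0" "(0::nat) \<le> 1" using N by auto
    have u: "a * q = exp (2 * (a' + e + of_nat 0 * e))" "1 / a = exp (2 * (of_nat 0 * e - a'))"
      unfolding a q exp_add[symmetric] by (simp_all add: algebra_simps exp_minus inverse_eq_divide)
    have v: "\<forall>i\<in>{1..r}. c / (a * x i) = exp (2 * (c' + of_nat 0 * e - a' - x' i))" "\<forall>i\<in>{1..r}. a * x i * q / c = exp (2 * (a' + x' i + e + of_nat 0 * e - c'))"
    proof -
      have "c / (a * x i) = exp (2 * (c' + of_nat 0 * e - a' - x' i))" "a * x i * q / c = exp (2 * (a' + x' i + e + of_nat 0 * e - c'))" if "i \<in> {1..r}" for i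
        unfolding bspec[OF x that] a q c exp_add[symmetric] exp_diff[symmetric] by (simp_all add: algebra_simps)
      then show "\<forall>i\<in>{1..r}. c / (a * x i) = exp (2 * (c' + of_nat 0 * e - a' - x' i))" "\<forall>i\<in>{1..r}. a * x i * q / c = exp (2 * (a' + x' i + e + of_nat 0 * e - c'))" by blast+
    qed
    have w: "\<forall>i\<in>{1..r+1}. a * q / (b i * c) = exp (2 * (a' + e + of_nat 0 * e - b' i - c'))" "\<forall>i\<in>{1..r+1}. b i * c / a = exp (2 * (b' i + c' + of_nat 0 * e - a'))"
    proof -
      have "a * q / (b i * c) = exp (2 * (a' + e + of_nat 0 * e - b' i - c'))" "b i * c / a = exp (2 * (b' i + c' + of_nat 0 * e - a'))" if "i \<in> {1..r+1}" for i
        unfolding bspec[OF b that] a q c exp_add[symmetric] exp_diff[symmetric] by (simp_all add: algebra_simps)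
      then show "\<forall>i\<in>{1..r+1}. a * q / (b i * c) = exp (2 * (a' + e + of_nat 0 * e - b' i - c'))" "\<forall>i\<in>{1..r+1}. b i * c / a = exp (2 * (b' i + c' + of_nat 0 * e - a'))" by blast+
    qed
    note R = rhs_exp[OF p bal q2 u v w]
    note g = generic_odd[OF N]
    have "(\<Sum>k\<in>multi_indices r N. summand r N p q a b c x k) = odd_theta.additive_rhs (stheta p) r (of_nat 0 * e) m e a' b' c' x'"
      by (rule main[OF Nd]) (use g R(2-4) in auto)
    then show ?case unfolding R(1) .
  qed
qed

end
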